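(* In the setting described in the context (quadrangulation $\tilde G$, graph $G$ with $|B|=|W|$, graph $G^\bullet$), for any Kasteleyn orientation $\varphi$ of $G$, $$Z(G,a,\varphi)=\pm\sum_{(\mathsf T,\mathsf F)\in\mathscr F}\operatorname{sign}(\mathsf T,\mathsf F)\prod_{\vec e\in\mathsf F}a_{f_{\vec e}},$$ where $\pm$ is a global sign (independent of $(\mathsf T,\mathsf F)$). Moreover, $(\mathsf T,\mathsf F)\mapsto\prod_{\vec e\in\mathsf F}a_{f_{\vec e}}$ is a bijection between the terms of the sum and the monomials of $Z(G,a,\varphi)$ as a polynomial in the variables $a$.
   Context: Let $\tilde G$ be a simple quadrangulation of the sphere, properly 2-coloured black/white, with set of faces $F$ and face weights $(a_f)_{f\in F}$ (formal variables). Fix two adjacent vertices $w_r$ (white), $b_r$ (black); write the vertex set as $(W\cup\{w_r\})\sqcup(\tilde B\cup\{b_r\})$. Let $G^\bullet$ be the graph on the black vertices $\tilde B\cup\{b_r\}$ with one edge per face of $\tilde G$ joining its two black corners (embedded with $w_r$ corresponding to its outer face); for a (directed) edge $\vec e$ of $G^\bullet$, $f_{\vec e}\in F$ is the face it crosses. Let $B\subset\tilde B$ with $|B|=|W|$, and let $G$ be the graph obtained from $\tilde G$ by removing $w_r$, the black vertices of $(\tilde B\cup\{b_r\})\setminus B$ and their incident edges; so $G$ has vertices $W\sqcup B$. For a directed edge $(w,b)$ of $G$, $f(w,b)\in F$ is the face of $\tilde G$ to its right. A Kasteleyn orientation of $G$ is a skew-symmetric $\varphi$ from directed edges of $G$ to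 $\{\pm1\}$ with $\prod_{wb\in\partial f}\varphi_{(w,b)}=(-1)^{\ell+1}$ for every bounded face $f$ of $G$ of degree $2\ell$; and $Z(G,a,\varphi)=\sum_{\mathsf M}\prod_{wb\in\mathsf M}\varphi_{(w,b)}(a_{f(w,b)}-a_{f(b,w)})$ over perfect matchings $\mathsf M$ of $G$. $\mathscr F$ is the set of pairs $(\mathsf T,\mathsf F)$ with $\mathsf T$ a spanning tree of $G^\bullet$ with edges directed towards the root $b_r$, $\mathsf F$ a spanning forest of $G^\bullet$ whose components are trees each containing exactly one vertex of $(\tilde B\cup\{b_r\})\setminus B$ (its root) with edges directed towards the root, and $\mathsf T,\mathsf F$ having no common (undirected) edge. Sign: for each face $f$ of $\tilde G$ fix signs $s_f(v)\in\{\pm1\}$ on its four corners $v$ such that, going counterclockwise around $f$, a black corner followed by a white corner have equal signs, and a white corner followed by a black corner have opposite signs. Label $F=\{f_1,\dots,f_\ell\}$, $\tilde B=\{b_1,\dots,b_m\}$ and (a second copy of) $B=\{b_{m+1},\dots,b_\ell\}$ (here $\ell=|\tilde B|+|B|=|F|$). For $(\mathsf T,\mathsf F)\in\mathscr F$: each $b_j\in\tilde B$ has a unique outgoing edge in $\mathsf T$, and each $b_j$, $j>m$, has a unique outgoing edge in $\mathsf F$; let $f_{\sigma(j)}$ be the face crossed by that edge. This defines a permutation $\sigma\in S_\ell$, and $\operatorname{sign}(\mathsf T,\mathsf F)=\operatorname{sgn}(\sigma)\prod_{j=1}^{\ell}s_{f_{\sigma(j)}}(b_j)$. *)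

theory Defs
  imports
    "Graph_Theory.Graph_Theory"
    "HOL-Combinatorics.Orbits"
    "HOL-Combinatorics.Permutations"
    "HOL-Library.Poly_Mapping"
begin

section \<open>Simple maps on the sphere\<close>

text \<open>
  An embedded finite simple graph is given combinatorially, by the graph together with the
  permutation \<open>rot\<close> of its darts (directed edges, i.e. pairs of adjacent vertices) sending a dart to
  the next dart with the same tail in counterclockwise order around that tail.
\<close>

definition rotation_system :: "'v pair_pre_digraph \<Rightarrow> ('v \<times> 'v \<Rightarrow> 'v \<times> 'v) \<Rightarrow> bool" where
  "rotation_system Q rot \<longleftrightarrow>
     rot permutes parcs Q \<and> (\<forall>d\<in>parcs Q. orbit rot d = {e \<in> parcs Q. fst e = fst d})"

text \<open>
  The dart following \<open>d\<close> when going counterclockwise around the face on the left of \<open>d\<close>: at the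
  head of \<open>d\<close>, turn clockwise from the reversed dart.
\<close>

definition face_succ :: "('v \<times> 'v \<Rightarrow> 'v \<times> 'v) \<Rightarrow> 'v \<times> 'v \<Rightarrow> 'v \<times> 'v" where
  "face_succ rot d = inv rot (prod.swap d)"

text \<open>
  A face is the set of darts having it on their left. A dart \<open>d\<close> thus also encodes a corner: the
  corner at the vertex \<open>fst d\<close> of the face \<open>left_face rot d\<close>.
\<close>

definition left_face :: "('v \<times> 'v \<Rightarrow> 'v \<times> 'v) \<Rightarrow> 'v \<times> 'v \<Rightarrow> ('v \<times> 'v) set" where
  "left_face rot d = orbit (face_succ rot) d"

definition right_face :: "('v \<times> 'v \<Rightarrow> 'v \<times> 'v) \<Rightarrow> 'v \<times> 'v \<Rightarrow> ('v \<times> 'v) set" where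
  "right_face rot d = left_face rot (prod.swap d)"

definition faces :: "'v pair_pre_digraph \<Rightarrow> ('v \<times> 'v \<Rightarrow> 'v \<times> 'v) \<Rightarrow> ('v \<times> 'v) set set" where
  "faces Q rot = left_face rot ` parcs Q"

text \<open>
  The last condition is Euler's formula \<open>|V| - |E| + |F| = 2\<close>, multiplied by two because each
  edge consists of two darts; it says that the surface is the sphere.
\<close>

definition sphere_map :: "'v pair_pre_digraph \<Rightarrow> ('v \<times> 'v \<Rightarrow> 'v \<times> 'v) \<Rightarrow> bool" where
  "sphere_map Q rot \<longleftrightarrow>
     pair_graph Q \<and> rotation_system Q rot \<and> Digraph_Component.connected (with_proj Q) \<and>
     2 * card (pverts Q) + 2 * card (faces Q rot) = card (parcs Q) + 4"

definition simple_quadrangulation :: "'v pair_pre_digraph \<Rightarrow> ('v \<times> 'v \<Rightarrow> 'v \<times> 'v) \<Rightarrow> bool" where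
  "simple_quadrangulation Q rot \<longleftrightarrow> sphere_map Q rot \<and> (\<forall>f\<in>faces Q rot. card f = 4)"

definition proper_two_colouring :: "'v pair_pre_digraph \<Rightarrow> 'v set \<Rightarrow> 'v set \<Rightarrow> bool" where
  "proper_two_colouring Q White Black \<longleftrightarrow>
     White \<inter> Black = {} \<and> pverts Q = White \<union> Black \<and>
     parcs Q \<subseteq> White \<times> Black \<union> Black \<times> White"


section \<open>Kasteleyn orientations\<close>

text \<open>
  In this section \<open>A\<close> is a symmetric set of darts of \<open>Q\<close>, regarded as a subgraph with the
  inherited embedding. \<open>subgraph_face_succ\<close> is the analogue of \<open>face_succ\<close> for that subgraph: turning
  clockwise, the darts that have been removed are skipped.
\<close>

definition subgraph_face_succ ::
  "('v \<times> 'v \<Rightarrow> 'v \<times> 'v) \<Rightarrow> ('v \<times> 'v) set \<Rightarrow> 'v \<times> 'v \<Rightarrow> 'v \<times> 'v" where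
  "subgraph_face_succ rot A d =
     (inv rot ^^ (LEAST n. 0 < n \<and> (inv rot ^^ n) (prod.swap d) \<in> A)) (prod.swap d)"

text \<open>
  Deleting an edge merges the two faces on its sides, so the faces of the subgraph \<open>A\<close> are the
  classes of faces of \<open>Q\<close> under the following relation.
\<close>

definition same_face ::
  "'v pair_pre_digraph \<Rightarrow> ('v \<times> 'v \<Rightarrow> 'v \<times> 'v) \<Rightarrow> ('v \<times> 'v) set \<Rightarrow> ('v \<times> 'v) set rel" where
  "same_face Q rot A = {(left_face rot e, right_face rot e) | e. e \<in> parcs Q - A}\<^sup>*"

definition component_arcs :: "('v, 'v \<times> 'v) pre_digraph \<Rightarrow> 'v \<times> 'v \<Rightarrow> ('v \<times> 'v) set" where
  "component_arcs G d = {e \<in> arcs G. fst d \<rightarrow>\<^sup>*\<^bsub>G\<^esub> fst e}"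

text \<open>
  The boundary walks of the bounded faces of a subgraph \<open>G\<close> not containing the vertex \<open>wr\<close>, each
  as the set of darts of \<open>G\<close> having the face on their left (so that an edge with the face on both
  sides counts twice). The unbounded face is the one containing \<open>wr\<close>. If \<open>G\<close> is connected, a face
  has a single boundary walk and the last condition just says that it is not the unbounded one.
  If \<open>G\<close> is disconnected, a face can have several boundary walks, and the boundary of a bounded
  face is taken to be its outer one, namely the one whose connected component separates the face
  from \<open>wr\<close>.
\<close>

definition bounded_face_boundaries ::
  "'v pair_pre_digraph \<Rightarrow> ('v \<times> 'v \<Rightarrow> 'v \<times> 'v) \<Rightarrow> 'v \<Rightarrow> ('v, 'v \<times> 'v) pre_digraph
     \<Rightarrow> ('v \<times> 'v) set set" where
  "bounded_face_boundaries Q rot wr G =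
     {orbit (subgraph_face_succ rot (arcs G)) d | d. d \<in> arcs G \<and>
        (\<forall>e\<in>parcs Q. fst e = wr \<longrightarrow>
           (left_face rot d, left_face rot e) \<notin> same_face Q rot (component_arcs G d))}"

definition from_white :: "'v set \<Rightarrow> 'v \<times> 'v \<Rightarrow> 'v \<times> 'v" where
  "from_white White d = (if fst d \<in> White then d else prod.swap d)"

definition kasteleyn_orientation ::
  "'v pair_pre_digraph \<Rightarrow> ('v \<times> 'v \<Rightarrow> 'v \<times> 'v) \<Rightarrow> 'v \<Rightarrow> 'v set \<Rightarrow> ('v, 'v \<times> 'v) pre_digraph
     \<Rightarrow> ('v \<times> 'v \<Rightarrow> int) \<Rightarrow> bool" where
  "kasteleyn_orientation Q rot wr White G \<phi> \<longleftrightarrow>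
     (\<forall>d\<in>arcs G. \<phi> d \<in> {1, -1} \<and> \<phi> (prod.swap d) = - \<phi> d) \<and>
     (\<forall>D\<in>bounded_face_boundaries Q rot wr G. \<forall>l. card D = 2 * l \<longrightarrow>
        (\<Prod>d\<in>D. \<phi> (from_white White d)) = (-1) ^ (l + 1))"


section \<open>The partition function\<close>

text \<open>Integer polynomials in variables indexed by \<open>'x\<close>: exponent vectors are mapped to coefficients.\<close>

type_synonym 'x int_mpoly = "('x \<Rightarrow>\<^sub>0 nat) \<Rightarrow>\<^sub>0 int"

definition var :: "'x \<Rightarrow> 'x int_mpoly" where
  "var x = Poly_Mapping.single (Poly_Mapping.single x 1) 1"

definition monomials :: "'x int_mpoly \<Rightarrow> 'x int_mpoly set" where
  "monomials p = (\<lambda>\<alpha>. Poly_Mapping.single \<alpha> 1) ` Poly_Mapping.keys p"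

text \<open>An edge of the bipartite graph is represented by its dart from white to black.\<close>

definition perfect_matchings :: "'v set \<Rightarrow> ('v, 'v \<times> 'v) pre_digraph \<Rightarrow> ('v \<times> 'v) set set" where
  "perfect_matchings White G =
     {M. M \<subseteq> {e \<in> arcs G. fst e \<in> White} \<and> (\<forall>v\<in>verts G. \<exists>!e. e \<in> M \<and> (fst e = v \<or> snd e = v))}"

definition partition_function ::
  "('v \<times> 'v \<Rightarrow> 'v \<times> 'v) \<Rightarrow> 'v set \<Rightarrow> ('v, 'v \<times> 'v) pre_digraph \<Rightarrow> ('v \<times> 'v \<Rightarrow> int)
     \<Rightarrow> ('v \<times> 'v) set int_mpoly" where
  "partition_function rot White G \<phi> =
     (\<Sum>M\<in>perfect_matchings White G. \<Prod>(w, b)\<in>M.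
        of_int (\<phi> (w, b)) * (var (right_face rot (w, b)) - var (right_face rot (b, w))))"


section \<open>Complementary trees and forests\<close>

text \<open>
  In the general notions below, \<open>H\<close> is a multigraph given by directed edges, with \<open>rv\<close> the
  reversal of directed edges, and a set \<open>A\<close> of directed edges represents a spanning subgraph whose
  edges carry a direction.
\<close>

definition undirected ::
  "('a, 'b) pre_digraph \<Rightarrow> ('b \<Rightarrow> 'b) \<Rightarrow> 'b set \<Rightarrow> ('a, 'b) pre_digraph" where
  "undirected H rv A = H\<lparr>arcs := A \<union> rv ` A\<rparr>"

text \<open>
  \<open>pre_digraph.cycle\<close> admits walking along an edge and straight back, which is not a cycle of the
  undirected graph; this is excluded by requiring the undirected edges to be distinct.
\<close>

definition oriented_forest ::
  "('a, 'b) pre_digraph \<Rightarrow> ('b \<Rightarrow> 'b) \<Rightarrow> 'b set \<Rightarrow> bool" where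
  "oriented_forest H rv A \<longleftrightarrow>
     A \<subseteq> arcs H \<and> (\<forall>e\<in>A. rv e \<notin> A) \<and>
     \<not> (\<exists>p. pre_digraph.cycle (undirected H rv A) p \<and> distinct (map (\<lambda>e. {e, rv e}) p))"

definition rooted_spanning_tree ::
  "('a, 'b) pre_digraph \<Rightarrow> ('b \<Rightarrow> 'b) \<Rightarrow> 'a \<Rightarrow> 'b set \<Rightarrow> bool" where
  "rooted_spanning_tree H rv r A \<longleftrightarrow>
     oriented_forest H rv A \<and> Digraph_Component.connected (undirected H rv A) \<and>
     (\<forall>v\<in>verts H. v \<rightarrow>\<^sup>*\<^bsub>H\<lparr>arcs := A\<rparr>\<^esub> r)"

definition rooted_spanning_forest ::
  "('a, 'b) pre_digraph \<Rightarrow> ('b \<Rightarrow> 'b) \<Rightarrow> 'a set \<Rightarrow> 'b set \<Rightarrow> bool" where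
  "rooted_spanning_forest H rv R A \<longleftrightarrow>
     oriented_forest H rv A \<and>
     (\<forall>v\<in>verts H. \<exists>!r. r \<in> R \<and> v \<rightarrow>\<^sup>*\<^bsub>undirected H rv A\<^esub> r) \<and>
     (\<forall>v\<in>verts H. \<forall>r\<in>R. v \<rightarrow>\<^sup>*\<^bsub>undirected H rv A\<^esub> r \<longrightarrow> v \<rightarrow>\<^sup>*\<^bsub>H\<lparr>arcs := A\<rparr>\<^esub> r)"

text \<open>
  The graph \<open>G\<^sup>\<bullet>\<close>. Its directed edge from the black corner \<open>d\<close> of a quadrangle to the opposite
  black corner is represented by the dart \<open>d\<close> itself. It crosses the face \<open>left_face rot d\<close>, and
  its reversal is \<open>opposite rot d\<close>. Multiple edges occur.
\<close>

definition opposite :: "('v \<times> 'v \<Rightarrow> 'v \<times> 'v) \<Rightarrow> 'v \<times> 'v \<Rightarrow> 'v \<times> 'v" where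
  "opposite rot d = face_succ rot (face_succ rot d)"

definition black_graph ::
  "'v pair_pre_digraph \<Rightarrow> ('v \<times> 'v \<Rightarrow> 'v \<times> 'v) \<Rightarrow> 'v set \<Rightarrow> ('v, 'v \<times> 'v) pre_digraph" where
  "black_graph Q rot Black =
     \<lparr>verts = Black, arcs = {d \<in> parcs Q. fst d \<in> Black},
      tail = fst, head = (\<lambda>d. fst (opposite rot d))\<rparr>"

definition tree_forest_pairs ::
  "'v pair_pre_digraph \<Rightarrow> ('v \<times> 'v \<Rightarrow> 'v \<times> 'v) \<Rightarrow> 'v set \<Rightarrow> 'v \<Rightarrow> 'v set
     \<Rightarrow> (('v \<times> 'v) set \<times> ('v \<times> 'v) set) set" where
  "tree_forest_pairs Q rot Bt br B =
     {(T, F).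
        rooted_spanning_tree (black_graph Q rot (Bt \<union> {br})) (opposite rot) br T \<and>
        rooted_spanning_forest (black_graph Q rot (Bt \<union> {br})) (opposite rot) ((Bt \<union> {br}) - B) F \<and>
        left_face rot ` T \<inter> left_face rot ` F = {}}"


section \<open>The sign of a pair\<close>

text \<open>\<open>s d\<close> is the sign at the corner encoded by the dart \<open>d\<close>.\<close>

definition corner_signs ::
  "'v pair_pre_digraph \<Rightarrow> ('v \<times> 'v \<Rightarrow> 'v \<times> 'v) \<Rightarrow> 'v set \<Rightarrow> ('v \<times> 'v \<Rightarrow> int) \<Rightarrow> bool" where
  "corner_signs Q rot Black s \<longleftrightarrow>
     (\<forall>d\<in>parcs Q. s d \<in> {1, -1} \<and>
        (if fst d \<in> Black then s (face_succ rot d) = s d else s (face_succ rot d) = - s d))"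

text \<open>
  In the following \<open>fl\<close> labels the faces by \<open>1, \<dots>, l\<close>, and \<open>bl\<close> labels \<open>Bt\<close> by \<open>1, \<dots>, m\<close> and \<open>B\<close>
  by \<open>m + 1, \<dots>, l\<close>.
\<close>

definition out_arc :: "nat \<Rightarrow> (nat \<Rightarrow> 'v) \<Rightarrow> ('v \<times> 'v) set \<times> ('v \<times> 'v) set \<Rightarrow> nat \<Rightarrow> 'v \<times> 'v" where
  "out_arc m bl TF j = (THE d. d \<in> (if j \<le> m then fst TF else snd TF) \<and> fst d = bl j)"

definition pair_perm ::
  "('v \<times> 'v \<Rightarrow> 'v \<times> 'v) \<Rightarrow> nat \<Rightarrow> nat \<Rightarrow> (nat \<Rightarrow> ('v \<times> 'v) set) \<Rightarrow> (nat \<Rightarrow> 'v)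
     \<Rightarrow> ('v \<times> 'v) set \<times> ('v \<times> 'v) set \<Rightarrow> nat \<Rightarrow> nat" where
  "pair_perm rot m l fl bl TF j =
     (if j \<in> {1..l} then the_inv_into {1..l} fl (left_face rot (out_arc m bl TF j)) else j)"

definition pair_sign ::
  "('v \<times> 'v \<Rightarrow> 'v \<times> 'v) \<Rightarrow> ('v \<times> 'v \<Rightarrow> int) \<Rightarrow> nat \<Rightarrow> nat \<Rightarrow> (nat \<Rightarrow> ('v \<times> 'v) set)
     \<Rightarrow> (nat \<Rightarrow> 'v) \<Rightarrow> ('v \<times> 'v) set \<times> ('v \<times> 'v) set \<Rightarrow> int" where
  "pair_sign rot s m l fl bl TF =
     sign (pair_perm rot m l fl bl TF) * (\<Prod>j=1..l. s (out_arc m bl TF j))"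

definition forest_monomial ::
  "('v \<times> 'v \<Rightarrow> 'v \<times> 'v) \<Rightarrow> ('v \<times> 'v) set \<times> ('v \<times> 'v) set \<Rightarrow> ('v \<times> 'v) set int_mpoly" where
  "forest_monomial rot TF = (\<Prod>d\<in>snd TF. var (left_face rot d))"

end

theory Submission
  imports Defs "Jordan_Normal_Form.Determinant"
begin

text \<open>
  Kasteleyn's theorem turns the partition function into \<open>\<plusminus> det N\<close> with
  \<open>N w b = a (f (w, b)) - a (f (b, w))\<close> on the edges of \<open>G\<close>. To prove it, the matchings are
  joined by switching alternating cycles. The region enclosed by such a cycle is found by writing the
  flow along the cycle as the gradient of a potential on the faces; the signs of permutations of the
  enclosed darts provide the parity of Euler's formula for that region.

  Let \<open>A\<close> and \<open>C\<close> be the incidence matrices of faces against black and white vertices,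
  signed by the corner signs. The two faces at an edge give \<open>C A = 0\<close>, whereas
  \<open>C diag(a) A = N\<close>. Let \<open>D\<close> consist of the columns of \<open>A\<close> for \<open>Bt\<close> and of those of
  \<open>diag(a) A\<close> for \<open>B\<close>. Multiplying \<open>D\<close> by \<open>C\<close>, completed with unit rows at the faces crossed
  by a spanning tree of the black graph, gives a block triangular matrix, and the complementary
  faces form a spanning tree of the white graph. Hence \<open>det N = \<plusminus> det D\<close>.

  In the Leibniz expansion of \<open>det D\<close> a permutation lets each vertex choose an outgoing arc of the
  black graph, once for the tree and once for the forest. For a fixed set of faces used by the forest,
  if some choices run into a cycle then a union of connected components without a root gives a linear
  relation between the columns, and otherwise the permutation is unique. So exactly the pairs of a
  tree and a forest remain, each with its own monomial.
\<close>

section \<open>Permutations\<close>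

text \<open>Genus zero enters once, through the number of faces, which makes
  \<open>completion\<close> a square matrix. Connectedness makes it nonsingular, and its network
  structure then forces its determinant to be 1 or -1. This one integrality fact is used twice. It
  makes the passage from \<open>det N\<close> to \<open>det D\<close> cost no more than a sign, and
  it makes every integral cocycle of the black graph an integral coboundary on the white vertices.
  The latter stands in for the Jordan curve theorem: it supplies the potential of the flow along an
  alternating cycle, and the parity of that potential separates inside from outside.

  The graph \<open>G\<close> may be disconnected, and Kasteleyn's condition then only concerns the
  outer boundary walk of a bounded face. For this reason only those enclosed darts are counted that
  lie in the connected component of the cycle. Their face walks are separated from \<open>wr\<close>
  by that component, so the condition applies to them, and the matchings still pair up the enclosed
  vertices among their tails.\<close>

text \<open>Two maps used later are first-return maps: a permutation with one point cut out of its
  cycle, and the rotation around a vertex that skips deleted darts.\<close>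

lemma orbit_first_return:
  assumes B: "x \<in> B"
    and ret: "\<And>x. x \<in> B \<Longrightarrow> q x \<in> B \<and> (\<exists>n>0. q x = (p ^^ n) x \<and> (\<forall>i. 0 < i \<and> i < n \<longrightarrow> (p ^^ i) x \<notin> B))"
  shows "orbit q x = orbit p x \<inter> B"
proof
  have "y \<in> B \<and> y \<in> orbit p x" if "y \<in> orbit q x" for y
    using that
  proof induction
    case base
    then show ?case using ret[OF B] by (auto simp: orbit_altdef)
  next
    case (step y)
    then have "q y \<in> B" "q y \<in> orbit p y" using ret[of y] by (auto simp: orbit_altdef)
    then show ?case using step orbit_trans by metis
  qed
  then show "orbit q x \<subseteq> orbit p x \<inter> B" by blast
next
  have "(p ^^ n) x \<in> orbit q x" if "0 < n" "x \<in> B" "(p ^^ n) x \<in> B" for n x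
    using that
  proof (induction n arbitrary: x rule: less_induct)
    case (less n)
    obtain k where k: "k > 0" "q x = (p ^^ k) x" "\<forall>i. 0 < i \<and> i < k \<longrightarrow> (p ^^ i) x \<notin> B" "q x \<in> B"
      using ret[OF less.prems(2)] by blast
    have "k \<le> n" using k(3) less.prems by (meson not_le)
    show ?case
    proof (cases "k = n")
      case True
      then show ?thesis using k(2) orbit.base[of q x] by simp
    next
      case False
      have eq: "(p ^^ (n - k)) (q x) = (p ^^ n) x"
        using \<open>k \<le> n\<close> k(2) by (metis comp_apply funpow_add le_add_diff_inverse2)
      have "(p ^^ (n - k)) (q x) \<in> orbit q (q x)"
        using False \<open>k \<le> n\<close> k less.prems eq by (intro less.IH) auto
      then show ?thesis using eq orbit_subset by metis
    qed
  qed
  then show "orbit p x \<inter> B \<subseteq> orbit q x" using B by (auto simp: orbit_altdef[of p])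
qed

lemma orbit_eq_if_mem:
  assumes "permutation p" "y \<in> orbit p x"
  shows "orbit p y = orbit p x"
  using assms cyclic_on_orbit' orbit_cyclic_eq3 by metis

text \<open>A transposition that cuts \<open>a\<close> out of its orbit flips the sign and shortens
  exactly one orbit by one, so both sides change alike. A fixed point contributes the factor
  1.\<close>

lemma sign_eq_prod_orbits:
  assumes "finite A" "p permutes A"
  shows "sign p = (\<Prod>U\<in>orbit p ` A. (-1) ^ (card U + 1))"
  using assms
proof (induction A arbitrary: p rule: finite_induct)
  case empty
  then show ?case by simp
next
  case (insert a A)
  have fin: "finite (insert a A)" using insert by simp
  have perm: "permutation p" using insert.prems fin permutation_permutes by blast
  show ?case
  proof (cases "p a = a")
    case True
    have p: "p permutes A"
      using insert.prems True by (metis Diff_insert_absorb insert.hyps(2) permutes_insert_lemma transpose_eq_id_iff id_comp)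
    have oa: "orbit p a = {a}" using True by (simp add: orbit_eq_singleton_iff)
    have "orbit p a \<notin> orbit p ` A"
      using permutes_orbit_subset[OF p] oa insert.hyps(2) by (metis imageE insert_subset)
    then show ?thesis using insert.IH[OF p] oa insert.hyps by simp
  next
    case False
    define q where "q = transpose a (p a) \<circ> p"
    have q: "q permutes A"
      unfolding q_def by (rule permutes_insert_lemma[OF insert.prems])
    have permq: "permutation q" using q insert.hyps permutation_permutes by blast
    have "p = transpose a (p a) \<circ> q" unfolding q_def by (simp add: fun_eq_iff)
    then have "sign p = sign (transpose a (p a)) * sign q"
      using sign_compose[OF permutation_swap_id permq, of a "p a"] by simp
    then have sgn: "sign p = - sign q" using False by (simp add: sign_swap_id)
    have orb: "orbit q x = orbit p x - {a}" if "x \<in> A" for x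
    proof -
      have bij: "inj p" using insert.prems permutes_inj by blast
      have "orbit q x = orbit p x \<inter> (- {a})"
      proof (rule orbit_first_return)
        show "x \<in> - {a}" using that insert.hyps by auto
        fix y assume y: "y \<in> - {a}"
        show "q y \<in> - {a} \<and> (\<exists>n>0. q y = (p ^^ n) y \<and> (\<forall>i. 0 < i \<and> i < n \<longrightarrow> (p ^^ i) y \<notin> - {a}))"
        proof (cases "p y = a")
          case True
          then show ?thesis using False unfolding q_def
            by (auto intro!: exI[of _ 2] simp: numeral_2_eq_2 less_Suc_eq)
        next
          case F: False
          have "p y \<noteq> p a" using y bij by (auto dest: injD)
          then show ?thesis using F unfolding q_def
            by (auto intro!: exI[of _ 1])
        qed
      qed
      then show ?thesis by auto
    qed
    define h where "h = (\<lambda>U. U - {a})"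
    have pa: "p a \<in> A" using insert.prems False by (metis insert_iff permutes_in_image)
    have A1: "orbit p ` insert a A = orbit p ` A"
      using pa permutation_orbit_step[OF perm, of a] by (metis image_eqI image_insert insert_absorb)
    have im: "orbit q ` A = h ` (orbit p ` A)" using orb unfolding h_def by force
    \<comment> \<open>No orbit becomes empty and no two become equal, because each of them keeps a
      point of \<open>A\<close>; the orbit of \<open>a\<close> keeps \<open>p a\<close>.\<close>
    have inj: "inj_on h (orbit p ` A)"
    proof (rule inj_onI)
      fix U V assume U: "U \<in> orbit p ` A" and V: "V \<in> orbit p ` A" and e: "h U = h V"
      then obtain x y where xy: "x \<in> A" "U = orbit p x" "y \<in> A" "V = orbit p y" by auto
      have "x \<in> U" "x \<noteq> a" using xy permutation_self_in_orbit[OF perm] insert.hyps by auto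
      then have "x \<in> V" using e unfolding h_def by blast
      then show "U = V" using xy orbit_eq_if_mem[OF perm] by metis
    qed
    let ?O = "orbit p a"
    have Oin: "?O \<in> orbit p ` A" using A1 by auto
    have ain: "a \<in> ?O" using permutation_self_in_orbit[OF perm] .
    have finO: "finite ?O" using ain finite_orbit by fast
    have cO: "card ?O \<noteq> 0" using finO ain by auto
    have other: "h U = U" if "U \<in> orbit p ` A - {?O}" for U
    proof -
      have "a \<notin> U" using that orbit_eq_if_mem[OF perm] by auto
      then show ?thesis unfolding h_def by simp
    qed
    have "sign q = (\<Prod>U\<in>orbit p ` A. (-1) ^ (card (h U) + 1))"
      unfolding insert.IH[OF q] im by (subst prod.reindex[OF inj]) simp
    also have "\<dots> = (-1) ^ (card (h ?O) + 1) * (\<Prod>U\<in>orbit p ` A - {?O}. (-1) ^ (card (h U) + 1))"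
      using Oin insert.hyps by (intro prod.remove) auto
    also have "(\<Prod>U\<in>orbit p ` A - {?O}. (-1) ^ (card (h U) + 1)) = (\<Prod>U\<in>orbit p ` A - {?O}. (-1::int) ^ (card U + 1))"
      using other by (intro prod.cong) auto
    also have "(-1::int) ^ (card (h ?O) + 1) = - ((-1) ^ (card ?O + 1))"
      using cO ain finO unfolding h_def by (cases "card ?O") auto
    also have "- ((-1::int) ^ (card ?O + 1)) * (\<Prod>U\<in>orbit p ` A - {?O}. (-1) ^ (card U + 1))
        = - (\<Prod>U\<in>orbit p ` A. (-1) ^ (card U + 1))"
      using Oin insert.hyps prod.remove[of "orbit p ` A" ?O "\<lambda>U. (-1::int) ^ (card U + 1)"] by simp
    finally show ?thesis using sgn A1 by simp
  qed
qed

section \<open>Determinants\<close>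

text \<open>The library version of this block formula assumes an integral domain.\<close>

lemma det_block_upper_triangular:
  fixes P :: "'a :: comm_ring_1 mat"
  assumes P: "P \<in> carrier_mat n n" and "m \<le> n"
    and zero: "\<And>i j. m \<le> i \<Longrightarrow> i < n \<Longrightarrow> j < m \<Longrightarrow> P $$ (i, j) = 0"
  shows "det P = det (mat m m (\<lambda>(i, j). P $$ (i, j))) * det (mat (n - m) (n - m) (\<lambda>(i, j). P $$ (m + i, m + j)))"
  using assms
proof (induction m arbitrary: n P)
  case 0
  have "mat (n - 0) (n - 0) (\<lambda>(i, j). P $$ (0 + i, 0 + j)) = P"
    using 0 by (intro eq_matI) auto
  then show ?case by (simp add: det_dim_zero[of "mat 0 0 f" for f])
next
  case (Suc m)
  let ?T = "mat (Suc m) (Suc m) (\<lambda>(i, j). P $$ (i, j))"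
  let ?R = "mat (n - Suc m) (n - Suc m) (\<lambda>(i, j). P $$ (Suc m + i, Suc m + j))"
  \<comment> \<open>Deleting the first column and one of the upper rows leaves the lower right block
    intact, so its determinant factors out of the Laplace expansion; the lower rows do not
    contribute to it.\<close>
  have minor: "det (mat_delete P i 0) = det (mat_delete ?T i 0) * det ?R" if i: "i < Suc m" for i
  proof -
    let ?D = "mat_delete P i 0"
    have D: "?D \<in> carrier_mat (n - 1) (n - 1)" using Suc.prems by auto
    have "det ?D = det (mat m m (\<lambda>(i, j). ?D $$ (i, j)))
        * det (mat (n - 1 - m) (n - 1 - m) (\<lambda>(i, j). ?D $$ (m + i, m + j)))"
    proof (rule Suc.IH[OF D])
      show "m \<le> n - 1" using Suc.prems by simp
      fix i' j assume "m \<le> i'" "i' < n - 1" "j < m"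
      then show "?D $$ (i', j) = 0"
        using Suc.prems i by (auto simp: mat_delete_def)
    qed
    moreover have "mat m m (\<lambda>(i, j). ?D $$ (i, j)) = mat_delete ?T i 0"
      using Suc.prems i by (intro eq_matI) (auto simp: mat_delete_def)
    moreover have "mat (n - 1 - m) (n - 1 - m) (\<lambda>(i, j). ?D $$ (m + i, m + j)) = ?R"
      using Suc.prems i by (intro eq_matI) (auto simp: mat_delete_def)
    ultimately show ?thesis by simp
  qed
  have "det P = (\<Sum>i<n. P $$ (i, 0) * cofactor P i 0)"
    using Suc.prems by (intro laplace_expansion_column) auto
  also have "\<dots> = (\<Sum>i<Suc m. P $$ (i, 0) * cofactor P i 0)"
    using Suc.prems by (intro sum.mono_neutral_right) auto
  also have "\<dots> = (\<Sum>i<Suc m. ?T $$ (i, 0) * cofactor ?T i 0 * det ?R)"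
    by (intro sum.cong refl) (simp add: cofactor_def minor mult.assoc)
  also have "\<dots> = det ?T * det ?R"
    using laplace_expansion_column[of ?T "Suc m" 0] by (simp add: sum_distrib_right del: sum.lessThan_Suc)
  finally show ?case .
qed

section \<open>Network matrices\<close>

definition transversal :: "nat \<Rightarrow> 'a::zero mat \<Rightarrow> (nat \<Rightarrow> nat) \<Rightarrow> bool" where
  "transversal n A p \<longleftrightarrow> p permutes {0..<n} \<and> (\<forall>j<n. A $$ (p j, j) \<noteq> 0)"

text \<open>
  Think of the columns as vertices and of the rows as edges, a row joining the at most two columns
  where it is nonzero, and with a missing second end at a root. A transversal lets each vertex
  choose an edge, and \<open>choice_rel\<close> relates a vertex to the other end of its edge.
\<close>

definition network :: "nat \<Rightarrow> int mat \<Rightarrow> bool" where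
  "network n A \<longleftrightarrow> A \<in> carrier_mat n n \<and>
     (\<forall>i<n. \<forall>j<n. \<forall>j'<n. j \<noteq> j' \<longrightarrow> A $$ (i, j) \<noteq> 0 \<longrightarrow> A $$ (i, j') \<noteq> 0 \<longrightarrow> A $$ (i, j) + A $$ (i, j') = 0)"

definition choice_rel :: "nat \<Rightarrow> int mat \<Rightarrow> (nat \<Rightarrow> nat) \<Rightarrow> nat rel" where
  "choice_rel n A p = {(j', j). j < n \<and> j' < n \<and> j' \<noteq> j \<and> A $$ (p j, j') \<noteq> 0}"

text \<open>Induction from the roots along \<open>choice_rel\<close>. If \<open>q\<close> gives the
  row \<open>p j\<close> to a column \<open>k\<close> other than \<open>j\<close>, then
  \<open>k\<close> is the other end of the edge chosen by \<open>j\<close>, where both permutations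
  already agree; this contradicts injectivity.\<close>

lemma transversal_unique:
  assumes "transversal n A p" "wf (choice_rel n A p)" "transversal n A q"
  shows "q = p"
proof -
  have p: "p permutes {0..<n}" "\<And>j. j < n \<Longrightarrow> A $$ (p j, j) \<noteq> 0"
    and q: "q permutes {0..<n}" "\<And>j. j < n \<Longrightarrow> A $$ (q j, j) \<noteq> 0"
    using assms by (auto simp: transversal_def)
  have "j < n \<longrightarrow> q j = p j" for j
    using assms(2)
  proof (induction j rule: wf_induct_rule)
    case (less j)
    show ?case
    proof
      assume j: "j < n"
      define k where "k = Hilbert_Choice.inv q (p j)"
      have qk: "q k = p j" using q(1) by (simp add: k_def permutes_inverses)
      have k: "k < n" using j p(1) q(1) qk
        by (metis atLeastLessThan_iff le0 permutes_in_image)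
      have "k = j"
      proof (rule ccontr)
        assume "k \<noteq> j"
        then have "(k, j) \<in> choice_rel n A p" using q(2)[OF k] qk j k by (auto simp: choice_rel_def)
        then have "q k = p k" using less.IH k by blast
        then have "p k = p j" using qk by simp
        then show False using \<open>k \<noteq> j\<close> permutes_inj[OF p(1)] by (auto dest: injD)
      qed
      then show "q j = p j" using qk by simp
    qed
  qed
  moreover have "q j = p j" if "\<not> j < n" for j
    using that p(1) q(1) by (metis atLeastLessThan_iff permutes_not_in)
  ultimately show ?thesis by blast
qed

lemma det_eq_sum_transversals:
  fixes A :: "int mat"
  assumes "A \<in> carrier_mat n n"
  shows "det A = (\<Sum>p | transversal n A p. sign p * (\<Prod>j<n. A $$ (p j, j)))"
proof -
  have "det A = (\<Sum>p | p permutes {0..<n}. sign p * (\<Prod>j<n. A $$ (p j, j)))"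
    using det_col[OF assms] by simp
  also have "\<dots> = (\<Sum>p | transversal n A p. sign p * (\<Prod>j<n. A $$ (p j, j)))"
    by (intro sum.mono_neutral_right finite_permutations) (auto simp: transversal_def)
  finally show ?thesis .
qed

lemma network_det_wf:
  assumes "network n A" "transversal n A p" "wf (choice_rel n A p)"
  shows "det A = sign p * (\<Prod>j<n. A $$ (p j, j))"
proof -
  have "{q. transversal n A q} = {p}" using transversal_unique[OF assms(2,3)] assms(2) by blast
  then show ?thesis using det_eq_sum_transversals[of A n] assms(1) by (simp add: network_def)
qed

text \<open>
  The vertices whose choices never reach a root form a union of connected components
  without a root, so their columns sum to zero.
\<close>

lemma network_det_not_wf:
  assumes net: "network n A" and t: "transversal n A p" and nwf: "\<not> wf (choice_rel n A p)"
  shows "det A = 0"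
proof -
  let ?r = "choice_rel n A p"
  define X where "X = {j. j < n \<and> j \<notin> Wellfounded.acc ?r}"
  have A: "A \<in> carrier_mat n n" using net by (simp add: network_def)
  have p: "p permutes {0..<n}" "\<And>j. j < n \<Longrightarrow> A $$ (p j, j) \<noteq> 0" using t by (auto simp: transversal_def)
  have opp: "A $$ (i, j) + A $$ (i, j') = 0"
    if "i < n" "j < n" "j' < n" "j \<noteq> j'" "A $$ (i, j) \<noteq> 0" "A $$ (i, j') \<noteq> 0" for i j j'
    using net that by (auto simp: network_def)
  have pn: "p j < n" if "j < n" for j using p(1) that by (metis atLeastLessThan_iff le0 permutes_in_image)
  \<comment> \<open>A row has at most two nonzero entries: three of them would sum to zero in pairs,
    and hence all vanish.\<close>
  have uniq: "j' = j''" if "(j', j) \<in> ?r" "(j'', j) \<in> ?r" for j j' j''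
  proof (rule ccontr)
    assume "j' \<noteq> j''"
    then show False
      using that opp[of "p j" j j'] opp[of "p j" j j''] opp[of "p j" j' j''] p(2)[of j] pn[of j]
      by (auto simp: choice_rel_def)
  qed
  obtain x where "x \<notin> Wellfounded.acc ?r" using nwf wf_iff_acc by blast
  then obtain y where "(y, x) \<in> ?r" by (meson accI)
  then have Xne: "x \<in> X" using \<open>x \<notin> _\<close> by (auto simp: X_def choice_rel_def)
  \<comment> \<open>As \<open>j'\<close> is the only predecessor of \<open>j\<close>, accessibility
    passes in both directions, and so does membership in \<open>X\<close>.\<close>
  have Xiff: "j' \<in> X \<longleftrightarrow> j \<in> X" if "(j', j) \<in> ?r" for j j'
  proof -
    have "j' \<in> Wellfounded.acc ?r \<longleftrightarrow> j \<in> Wellfounded.acc ?r"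
      using that uniq by (metis accI acc_downward)
    then show ?thesis using that by (auto simp: X_def choice_rel_def)
  qed
  define v where "v = vec n (\<lambda>j. if j \<in> X then 1 else (0::int))"
  \<comment> \<open>The row \<open>i\<close> is chosen by a single column \<open>j\<close>. If it
    has a second end, then both ends or neither lie in \<open>X\<close> and the entries cancel;
    otherwise \<open>j\<close> is accessible, hence outside of \<open>X\<close>.\<close>
  have sum0: "(\<Sum>j<n. A $$ (i, j) * (if j \<in> X then 1 else 0)) = 0" if i: "i < n" for i
  proof -
    obtain j where j: "j < n" "i = p j"
      using p(1) i by (metis atLeastLessThan_iff le0 permutes_in_image permutes_inverses(1) permutes_inv)
    show ?thesis
    proof (cases "\<exists>j'. (j', j) \<in> ?r")
      case True
      then obtain j' where j': "(j', j) \<in> ?r" by blast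
      have n': "j' < n" "j' \<noteq> j" "A $$ (i, j') \<noteq> 0" using j' j by (auto simp: choice_rel_def)
      have "A $$ (i, k) = 0" if "k < n" "k \<noteq> j" "k \<noteq> j'" for k
        using that uniq[OF j', of k] j by (auto simp: choice_rel_def)
      then have "(\<Sum>k<n. A $$ (i, k) * (if k \<in> X then 1 else 0)) = (\<Sum>k\<in>{j, j'}. A $$ (i, k) * (if k \<in> X then 1 else 0))"
        using j n' by (intro sum.mono_neutral_right) auto
      also have "\<dots> = 0" using n' j p(2) opp[OF i j(1) n'(1)] Xiff[OF j'] by auto
      finally show ?thesis .
    next
      case False
      then have "j \<in> Wellfounded.acc ?r" by (auto intro: accI)
      then have "j \<notin> X" by (simp add: X_def)
      moreover have "A $$ (i, k) = 0" if "k < n" "k \<noteq> j" for k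
        using that False j by (auto simp: choice_rel_def)
      ultimately show ?thesis by (intro sum.neutral) auto
    qed
  qed
  have "v \<noteq> 0\<^sub>v n"
  proof
    assume "v = 0\<^sub>v n"
    then have "v $ x = 0" using Xne by (simp add: X_def)
    then show False using Xne by (simp add: v_def X_def)
  qed
  moreover have "A *\<^sub>v v = 0\<^sub>v n"
    using A sum0 by (intro eq_vecI) (auto simp: v_def scalar_prod_def atLeast0LessThan)
  ultimately show ?thesis
    unfolding det_0_iff_vec_prod_zero[OF A] by (intro exI[of _ v]) (auto simp: v_def)
qed

text \<open>A nonzero determinant has a transversal, whose choices are then well-founded, so that
  the Leibniz sum collapses to a single product of units.\<close>

lemma network_det_unimodular:
  assumes "network n A" "det A \<noteq> 0" "\<And>i j. i < n \<Longrightarrow> j < n \<Longrightarrow> A $$ (i, j) \<in> {0, 1, -1}"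
  shows "det A \<in> {1, -1}"
proof -
  have "\<exists>p. transversal n A p"
  proof (rule ccontr)
    assume "\<nexists>p. transversal n A p"
    then show False using det_eq_sum_transversals[of A n] assms(1,2) by (simp add: network_def)
  qed
  then obtain p where p: "transversal n A p" by blast
  then have w: "wf (choice_rel n A p)" using network_det_not_wf assms by blast
  have "\<bar>A $$ (p j, j)\<bar> = 1" if "j < n" for j
  proof -
    have "p j < n" using that p by (metis atLeastLessThan_iff le0 permutes_in_image transversal_def)
    then have "A $$ (p j, j) \<in> {0, 1, -1}" using assms(3) that by blast
    moreover have "A $$ (p j, j) \<noteq> 0" using p that by (simp add: transversal_def)
    ultimately show ?thesis by auto
  qed
  then have "\<bar>det A\<bar> = 1" unfolding network_det_wf[OF assms(1) p w] by (simp add: abs_mult abs_prod)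
  then show ?thesis by auto
qed

text \<open>Since the determinant squares to 1, its multiple of the adjugate is an integral
  inverse.\<close>

lemma int_solvable_if_unimodular:
  fixes A :: "int mat"
  assumes A: "A \<in> carrier_mat n n" and det: "det A \<in> {1, -1}" and x: "x \<in> carrier_vec n"
  obtains y where "y \<in> carrier_vec n" "A *\<^sub>v y = x"
proof
  let ?y = "det A \<cdot>\<^sub>v (adj_mat A *\<^sub>v x)"
  have adj: "adj_mat A \<in> carrier_mat n n" "A * adj_mat A = det A \<cdot>\<^sub>m 1\<^sub>m n" using adj_mat[OF A] by auto
  show "?y \<in> carrier_vec n" using adj x by auto
  have "A *\<^sub>v ?y = det A \<cdot>\<^sub>v (A *\<^sub>v (adj_mat A *\<^sub>v x))"
    using A adj x by (intro eq_vecI) auto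
  also have "A *\<^sub>v (adj_mat A *\<^sub>v x) = (A * adj_mat A) *\<^sub>v x"
    using A adj x by (intro assoc_mult_mat_vec[symmetric, of _ n n _ n]) auto
  also have "\<dots> = det A \<cdot>\<^sub>v x"
    unfolding adj(2) using x by (intro eq_vecI) auto
  also have "det A \<cdot>\<^sub>v (det A \<cdot>\<^sub>v x) = x" using det by (auto simp: smult_smult_assoc)
  finally show "A *\<^sub>v ?y = x" .
qed

section \<open>Bicoloured quadrangulations\<close>

locale bicoloured_quadrangulation =
  fixes Q :: "'v pair_pre_digraph" and rot :: "'v \<times> 'v \<Rightarrow> 'v \<times> 'v" and White Black :: "'v set"
  assumes quad: "simple_quadrangulation Q rot"
    and colour: "proper_two_colouring Q White Black"
    and nonempty: "White \<noteq> {}" "Black \<noteq> {}"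
begin

abbreviation "fs \<equiv> face_succ rot"
abbreviation "opp \<equiv> opposite rot"
abbreviation "lf \<equiv> left_face rot"
abbreviation "rot_inv \<equiv> Hilbert_Choice.inv rot"

section \<open>Darts, corners and quadrangles\<close>

lemma graph: "pair_graph Q"
  using quad by (simp add: simple_quadrangulation_def sphere_map_def)

sublocale pair_graph Q by (rule graph)

lemma finite_darts [simp]: "finite (parcs Q)"
  by (rule pair_finite_arcs)

lemma colours: "White \<inter> Black = {}" "pverts Q = White \<union> Black" "finite White" "finite Black"
  using colour pair_finite_verts by (auto simp: proper_two_colouring_def)

lemma dart_colours:
  assumes "d \<in> parcs Q"
  shows "fst d \<in> White \<longleftrightarrow> snd d \<in> Black" "fst d \<in> Black \<longleftrightarrow> snd d \<in> White"
    "fst d \<in> White \<longleftrightarrow> fst d \<notin> Black" "snd d \<in> White \<longleftrightarrow> snd d \<notin> Black"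
proof -
  have "d \<in> White \<times> Black \<union> Black \<times> White"
    using assms colour by (auto simp: proper_two_colouring_def)
  then show "fst d \<in> White \<longleftrightarrow> snd d \<in> Black" "fst d \<in> Black \<longleftrightarrow> snd d \<in> White"
    "fst d \<in> White \<longleftrightarrow> fst d \<notin> Black" "snd d \<in> White \<longleftrightarrow> snd d \<notin> Black"
    using colours(1) by auto
qed

lemma swap_mem [simp]: "prod.swap d \<in> parcs Q \<longleftrightarrow> d \<in> parcs Q"
  using pair_sym_arcs by (cases d) (auto simp: symmetric_def sym_def)

lemma rot_permutes: "rot permutes parcs Q"
  using quad by (simp add: simple_quadrangulation_def sphere_map_def rotation_system_def)

lemma orbit_rot: "d \<in> parcs Q \<Longrightarrow> orbit rot d = {e \<in> parcs Q. fst e = fst d}"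
  using quad by (simp add: simple_quadrangulation_def sphere_map_def rotation_system_def)

lemma permutation_rot: "permutation rot"
  using rot_permutes finite_darts permutation_permutes by blast

lemma rot_mem [simp]: "rot d \<in> parcs Q \<longleftrightarrow> d \<in> parcs Q"
  using rot_permutes by (simp add: permutes_in_image)

lemma inv_rot_mem [simp]: "rot_inv d \<in> parcs Q \<longleftrightarrow> d \<in> parcs Q"
  using permutes_inv[OF rot_permutes] by (simp add: permutes_in_image)

lemma rot_rot_inv [simp]: "rot (rot_inv d) = d" "rot_inv (rot d) = d"
  using permutes_inverses[OF rot_permutes] by auto

lemma fst_rot [simp]: "d \<in> parcs Q \<Longrightarrow> fst (rot d) = fst d"
  using orbit_rot[of d] orbit.base[of rot d] by auto

lemma fst_inv_rot [simp]: "d \<in> parcs Q \<Longrightarrow> fst (rot_inv d) = fst d"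
  using fst_rot[of "rot_inv d"] by simp

lemma fs_mem [simp]: "fs d \<in> parcs Q \<longleftrightarrow> d \<in> parcs Q"
  by (simp add: face_succ_def)

lemma fst_fs: "d \<in> parcs Q \<Longrightarrow> fst (fs d) = snd d"
  by (simp add: face_succ_def)

lemma fs_swap_rot [simp]: "fs (prod.swap (rot d)) = d"
  by (simp add: face_succ_def)

lemma inj_fs: "fs d = fs e \<longleftrightarrow> d = e"
  unfolding face_succ_def by (metis rot_rot_inv(1) swap_swap)

text \<open>Off the darts \<open>fs\<close> merely swaps the components of a pair, possibly on an
  infinite set. Replacing it there by the identity gives a permutation of finite support without
  changing the orbits of darts.\<close>

lemma permutation_fs: "permutation (\<lambda>d. if d \<in> parcs Q then fs d else d)"
proof -
  have "inj_on fs (parcs Q)" using inj_fs by (auto intro: inj_onI)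
  moreover have "fs ` parcs Q = parcs Q"
    using \<open>inj_on fs (parcs Q)\<close> by (intro endo_inj_surj) auto
  ultimately have "bij_betw fs (parcs Q) (parcs Q)" by (simp add: bij_betw_def)
  then have "(\<lambda>d. if d \<in> parcs Q then fs d else d) permutes parcs Q"
    by (intro bij_imp_permutes) (auto cong: bij_betw_cong)
  then show ?thesis using permutation_permutes finite_darts by blast
qed

lemma lf_alt: "d \<in> parcs Q \<Longrightarrow> lf d = orbit (\<lambda>d. if d \<in> parcs Q then fs d else d) d"
  unfolding left_face_def by (rule orbit_cong0[where A = "parcs Q"]) auto

lemma lf_eq_if_mem: "d \<in> parcs Q \<Longrightarrow> e \<in> lf d \<Longrightarrow> e \<in> parcs Q \<and> lf e = lf d"
proof -
  assume d: "d \<in> parcs Q" and e: "e \<in> lf d"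
  have "e \<in> parcs Q" using e unfolding left_face_def by induction (use d in auto)
  then show ?thesis using d e orbit_eq_if_mem[OF permutation_fs] by (simp add: lf_alt)
qed

lemma self_mem_lf: "d \<in> parcs Q \<Longrightarrow> d \<in> lf d"
  using lf_alt permutation_self_in_orbit[OF permutation_fs] by simp

lemma card_lf: "d \<in> parcs Q \<Longrightarrow> card (lf d) = 4"
  using quad by (auto simp: simple_quadrangulation_def faces_def)

lemma lf_explicit:
  assumes d: "d \<in> parcs Q"
  shows "lf d = {d, fs d, fs (fs d), fs (fs (fs d))}" "fs (fs (fs (fs d))) = d"
    "distinct [d, fs d, fs (fs d), fs (fs (fs d))]"
proof -
  have self: "d \<in> orbit fs d" using self_mem_lf[OF d] by (simp add: left_face_def)
  define n where "n = funpow_dist1 fs d d"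
  have img: "lf d = (\<lambda>k. (fs ^^ k) d) ` {0..<n}"
    unfolding n_def left_face_def by (rule orbit_conv_funpow_dist1[OF self])
  have inj: "inj_on (\<lambda>k. (fs ^^ k) d) {0..<n}"
    unfolding n_def by (rule inj_on_funpow_dist1[OF self])
  have "n = 4" using card_lf[OF d] card_image[OF inj] img by simp
  have s4: "{0..<4::nat} = {0, 1, 2, 3}" by auto
  have pw: "(fs ^^ 0) d = d" "(fs ^^ 1) d = fs d" "(fs ^^ 2) d = fs (fs d)" "(fs ^^ 3) d = fs (fs (fs d))"
    by (simp_all add: eval_nat_numeral)
  show "lf d = {d, fs d, fs (fs d), fs (fs (fs d))}"
    unfolding img \<open>n = 4\<close> s4 by (simp add: pw[unfolded One_nat_def])
  have "(fs ^^ 4) d = d" using funpow_dist1_prop[OF self] \<open>n = 4\<close> by (simp only: n_def[symmetric])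
  then show "fs (fs (fs (fs d))) = d" by (simp add: eval_nat_numeral)
  show "distinct [d, fs d, fs (fs d), fs (fs (fs d))]"
    using inj_onD[OF inj, of 0 1] inj_onD[OF inj, of 0 2] inj_onD[OF inj, of 0 3]
      inj_onD[OF inj, of 1 2] inj_onD[OF inj, of 1 3] inj_onD[OF inj, of 2 3] \<open>n = 4\<close>
    by (auto simp: pw[unfolded One_nat_def])
qed

lemma opp_mem [simp]: "opp d \<in> parcs Q \<longleftrightarrow> d \<in> parcs Q"
  by (simp add: opposite_def)

lemma opp_opp [simp]: "d \<in> parcs Q \<Longrightarrow> opp (opp d) = d"
  by (simp add: opposite_def lf_explicit)

lemma opp_neq [simp]: "d \<in> parcs Q \<Longrightarrow> opp d \<noteq> d"
  using lf_explicit(3)[of d] by (auto simp: opposite_def)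

lemma lf_fs [simp]: "d \<in> parcs Q \<Longrightarrow> lf (fs d) = lf d"
  using lf_eq_if_mem[of d "fs d"] lf_explicit(1)[of d] by auto

lemma lf_opp [simp]: "d \<in> parcs Q \<Longrightarrow> lf (opp d) = lf d"
  by (simp add: opposite_def)

lemma lf_eq_iff: "d \<in> parcs Q \<Longrightarrow> e \<in> parcs Q \<Longrightarrow> lf d = lf e \<longleftrightarrow> e \<in> lf d"
  using lf_eq_if_mem self_mem_lf by blast

lemma lf_swap: "d \<in> parcs Q \<Longrightarrow> lf (prod.swap d) = lf (rot_inv d)"
  using lf_fs[of "prod.swap d"] by (simp add: face_succ_def)

lemma fs_opp: "d \<in> parcs Q \<Longrightarrow> fs (opp d) = prod.swap (rot d)"
  using inj_fs[of "fs (opp d)" "prod.swap (rot d)"] lf_explicit(2)[of d] by (simp add: opposite_def)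

lemma white_fs: "d \<in> parcs Q \<Longrightarrow> fst (fs d) \<in> White \<longleftrightarrow> fst d \<in> Black"
  using dart_colours by (simp add: fst_fs)

lemma black_fs: "d \<in> parcs Q \<Longrightarrow> fst (fs d) \<in> Black \<longleftrightarrow> fst d \<in> White"
  using dart_colours by (simp add: fst_fs)

lemma black_opp: "d \<in> parcs Q \<Longrightarrow> fst (opp d) \<in> Black \<longleftrightarrow> fst d \<in> Black"
  unfolding opposite_def using white_fs black_fs by simp

lemma lf_eq_black:
  assumes "d \<in> parcs Q" "e \<in> parcs Q" "fst d \<in> Black" "fst e \<in> Black"
  shows "lf d = lf e \<longleftrightarrow> e = d \<or> e = opp d"
proof -
  have "fst (fs d) \<notin> Black" "fst (fs (fs (fs d))) \<notin> Black"
    using assms white_fs black_fs dart_colours(3) by simp_all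
  then show ?thesis using assms lf_explicit(1)[of d] lf_eq_iff[of d e] by (auto simp: opposite_def)
qed

section \<open>Counting faces\<close>

lemma finite_faces [simp]: "finite (faces Q rot)"
  by (simp add: faces_def)

lemma disjoint_faces:
  assumes "f \<in> faces Q rot" "f' \<in> faces Q rot" "d \<in> f" "d \<in> f'"
  shows "f = f'"
proof -
  obtain e e' where "e \<in> parcs Q" "f = lf e" "e' \<in> parcs Q" "f' = lf e'"
    using assms(1,2) by (auto simp: faces_def)
  then show ?thesis using lf_eq_if_mem[of e d] lf_eq_if_mem[of e' d] assms(3,4) by simp
qed

lemma Union_faces: "\<Union> (faces Q rot) = parcs Q"
proof
  show "\<Union> (faces Q rot) \<subseteq> parcs Q"
    unfolding faces_def using lf_eq_if_mem[THEN conjunct1] by blast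
  show "parcs Q \<subseteq> \<Union> (faces Q rot)"
    unfolding faces_def using self_mem_lf by blast
qed

lemma card_darts: "card (parcs Q) = 4 * card (faces Q rot)"
proof -
  have "card (\<Union> (faces Q rot)) = (\<Sum>f\<in>faces Q rot. card f)"
    using disjoint_faces Union_faces
    by (intro card_Union_disjoint) (auto 4 3 simp: pairwise_def disjnt_def intro: finite_subset[OF _ finite_darts])
  also have "\<dots> = (\<Sum>f\<in>faces Q rot. 4)"
    by (intro sum.cong refl) (auto simp: faces_def card_lf)
  finally show ?thesis by (simp add: Union_faces mult.commute)
qed

text \<open>Each face has four darts, so there are twice as many edges as faces. This is where
  Euler's formula is used.\<close>

lemma card_faces: "card White + card Black = card (faces Q rot) + 2"
proof -
  have "2 * card (pverts Q) + 2 * card (faces Q rot) = card (parcs Q) + 4"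
    using quad by (simp add: simple_quadrangulation_def sphere_map_def)
  then show ?thesis using card_darts colours by (simp add: card_Un_disjoint)
qed

section \<open>Connectedness of the map and of the black graph\<close>

lemma constant_if_dart_invariant:
  assumes y: "\<And>d. d \<in> parcs Q \<Longrightarrow> y (fst d) = y (snd d)" and "u \<in> pverts Q" "v \<in> pverts Q"
  shows "y u = y v"
proof -
  have "Digraph_Component.connected (with_proj Q)"
    using quad by (simp add: simple_quadrangulation_def sphere_map_def)
  then have "u \<rightarrow>\<^sup>*\<^bsub>with_proj (mk_symmetric (with_proj Q))\<^esub> v"
    using assms(2,3) by (auto simp: Digraph_Component.connected_def strongly_connected_def mk_symmetric_def)
  then show ?thesis
    unfolding reachable_def
  proof (induction rule: rtrancl_on_induct)
    case (step v' w)
    then show ?case using y[of "(v', w)"] y[of "(w, v')"] by (auto simp: mk_symmetric_def)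
  qed simp
qed

lemma ex_dart: "v \<in> pverts Q \<Longrightarrow> \<exists>d\<in>parcs Q. fst d = v"
proof (rule ccontr)
  assume v: "v \<in> pverts Q" and "\<not> (\<exists>d\<in>parcs Q. fst d = v)"
  then have no: "fst d \<noteq> v" "snd d \<noteq> v" if "d \<in> parcs Q" for d
    using that swap_mem[of d] by (metis, metis fst_swap)
  obtain u where u: "u \<in> pverts Q" "u \<noteq> v" using nonempty colours by blast
  \<comment> \<open>The indicator function of an isolated vertex would be invariant along all darts,
    although there is a second vertex.\<close>
  have "(u = v) = (v = v)"
    by (rule constant_if_dart_invariant[of "\<lambda>x. x = v"]) (use no v u in auto)
  then show False using u by simp
qed

text \<open>Consecutive neighbours of a white vertex are the two black corners of a face, so
  \<open>y\<close> is constant on the neighbours of each white vertex. Giving the white vertex that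
  value extends \<open>y\<close> to a function \<open>z\<close> invariant along all darts.\<close>

lemma constant_on_black:
  assumes y: "\<And>d. d \<in> parcs Q \<Longrightarrow> fst d \<in> Black \<Longrightarrow> y (fst d) = y (fst (opp d))"
    and "u \<in> Black" "v \<in> Black"
  shows "y u = y v"
proof -
  have step: "y (snd (rot d)) = y (snd d)" if "d \<in> parcs Q" "fst d \<in> White" for d
  proof -
    let ?e = "prod.swap (rot d)"
    have e: "?e \<in> parcs Q" using that by simp
    have "fst ?e \<in> Black" using dart_colours(1)[of "rot d"] that by simp
    moreover have "opp ?e = fs d" by (simp add: opposite_def)
    ultimately show ?thesis using y[OF e] that by (simp add: fst_fs)
  qed
  have nbr: "y (snd e) = y (snd d)" if "d \<in> parcs Q" "fst d \<in> White" "e \<in> parcs Q" "fst e = fst d" for d e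
  proof -
    have "e \<in> orbit rot d" using orbit_rot that by auto
    then have "e \<in> parcs Q \<and> fst e = fst d \<and> y (snd e) = y (snd d)"
      by induction (use that step in auto)
    then show ?thesis by simp
  qed
  define z where "z x = (if x \<in> Black then y x else y (snd (SOME d. d \<in> parcs Q \<and> fst d = x)))" for x
  have zw: "z (fst d) = y (snd d)" if "d \<in> parcs Q" "fst d \<in> White" for d
  proof -
    let ?d = "SOME e. e \<in> parcs Q \<and> fst e = fst d"
    have "?d \<in> parcs Q \<and> fst ?d = fst d" 
      by (rule someI[where P = "\<lambda>e. e \<in> parcs Q \<and> fst e = fst d" and x = d]) (use that in simp)
    then show ?thesis using nbr[of d ?d] that dart_colours[of d] by (simp add: z_def)
  qed
  have "z (fst d) = z (snd d)" if d: "d \<in> parcs Q" for d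
  proof (cases "fst d \<in> White")
    case True
    then show ?thesis using zw[OF d] dart_colours[OF d] by (simp add: z_def)
  next
    case False
    then have "fst (prod.swap d) \<in> White" "fst d \<in> Black" using dart_colours[OF d] by auto
    then show ?thesis using zw[of "prod.swap d"] d by (simp add: z_def)
  qed
  then have "z u = z v" by (rule constant_if_dart_invariant) (use assms(2,3) colours(2) in auto)
  then show ?thesis using assms(2,3) by (simp add: z_def)
qed

lemma swap_colours: "bicoloured_quadrangulation Q rot Black White"
  using quad colour nonempty by unfold_locales (auto simp: proper_two_colouring_def)

end

section \<open>The signed incidence matrix\<close>

text \<open>A sum over corners, because both corners of one colour may be the same vertex: the path
  with two edges has a single face, of degree four. The two signs then cancel, as for a loop in an
  incidence matrix.\<close>

definition incidence :: "('v \<times> 'v \<Rightarrow> int) \<Rightarrow> ('v \<times> 'v) set \<Rightarrow> 'v \<Rightarrow> int" where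
  "incidence s f v = (\<Sum>d | d \<in> f \<and> fst d = v. s d)"

locale signed_quadrangulation = bicoloured_quadrangulation +
  fixes s :: "'a \<times> 'a \<Rightarrow> int"
  assumes signs: "corner_signs Q rot Black s"
begin

lemma sign_pm: "d \<in> parcs Q \<Longrightarrow> s d \<in> {1, -1}"
  using signs by (simp add: corner_signs_def)

lemma sign_sq: "d \<in> parcs Q \<Longrightarrow> s d * s d = 1"
  using sign_pm by fastforce

lemma sign_fs_black: "d \<in> parcs Q \<Longrightarrow> fst d \<in> Black \<Longrightarrow> s (fs d) = s d"
  using signs by (simp add: corner_signs_def)

lemma sign_fs_white: "d \<in> parcs Q \<Longrightarrow> fst d \<in> White \<Longrightarrow> s (fs d) = - s d"
  using signs dart_colours(3) by (simp add: corner_signs_def)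

lemma sign_opp: "d \<in> parcs Q \<Longrightarrow> s (opp d) = - s d"
proof (cases "fst d \<in> White")
  case True
  moreover assume d: "d \<in> parcs Q"
  ultimately show ?thesis
    using sign_fs_white[of d] sign_fs_black[of "fs d"] black_fs[of d] by (simp add: opposite_def)
next
  case False
  moreover assume d: "d \<in> parcs Q"
  ultimately show ?thesis
    using sign_fs_black[of d] sign_fs_white[of "fs d"] white_fs[of d] dart_colours(3)[of d] by (simp add: opposite_def)
qed

lemma incidence_same_colour:
  assumes d: "d \<in> parcs Q" and v: "fst d \<in> White \<longleftrightarrow> v \<in> White" "v \<in> pverts Q"
  shows "incidence s (lf d) v = (if fst d = v then s d else 0) - (if fst (opp d) = v then s d else 0)"
proof -
  have "fst (fs d) \<noteq> v" "fst (fs (fs (fs d))) \<noteq> v"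
    using v colours(1,2) d white_fs[of d] white_fs[of "fs (fs d)"] black_fs[of "fs d"] white_fs[of "fs d"]
      dart_colours(3)[of d] dart_colours(3)[of "fs (fs d)"] by (metis fs_mem)+
  then have "{e. e \<in> lf d \<and> fst e = v} = {e \<in> {d, opp d}. fst e = v}"
    using lf_explicit(1)[OF d] by (auto simp: opposite_def)
  then have "incidence s (lf d) v = (\<Sum>e\<in>{d, opp d}. if fst e = v then s e else 0)"
    unfolding incidence_def by (simp add: sum.If_cases Int_def conj_commute)
  then show ?thesis using opp_neq[OF d] sign_opp[OF d] by (simp add: eq_commute[of d])
qed

lemma sum_incidence:
  fixes X :: "('a \<times> 'a) set \<Rightarrow> 'b :: comm_ring_1"
  shows "(\<Sum>f\<in>faces Q rot. of_int (incidence s f v) * X f) = (\<Sum>d | d \<in> parcs Q \<and> fst d = v. of_int (s d) * X (lf d))"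
proof -
  have fin: "finite f" if "f \<in> faces Q rot" for f
    using that Union_faces by (metis Union_upper finite_darts finite_subset)
  have "(\<Sum>f\<in>faces Q rot. of_int (incidence s f v) * X f)
      = (\<Sum>f\<in>faces Q rot. \<Sum>d | d \<in> parcs Q \<and> fst d = v \<and> lf d = f. of_int (s d) * X (lf d))"
  proof (intro sum.cong refl)
    fix f assume f: "f \<in> faces Q rot"
    have "{d \<in> f. fst d = v} = {d. d \<in> parcs Q \<and> fst d = v \<and> lf d = f}"
      using f lf_eq_if_mem self_mem_lf unfolding faces_def by blast
    then show "of_int (incidence s f v) * X f = (\<Sum>d | d \<in> parcs Q \<and> fst d = v \<and> lf d = f. of_int (s d) * X (lf d))"
      unfolding incidence_def by (auto simp: sum_distrib_right intro!: sum.cong)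
  qed
  also have "\<dots> = (\<Sum>f\<in>faces Q rot. \<Sum>d\<in>{d \<in> {d. d \<in> parcs Q \<and> fst d = v}. lf d = f}. of_int (s d) * X (lf d))"
    by (simp add: conj_assoc)
  also have "\<dots> = (\<Sum>d | d \<in> parcs Q \<and> fst d = v. of_int (s d) * X (lf d))"
    by (intro sum.group) (auto simp: faces_def)
  finally show ?thesis .
qed

text \<open>Only the corners at \<open>w\<close> contribute. The corner \<open>d\<close> lies
  between the edges \<open>d\<close> and \<open>rot d\<close>; its face counts positively if
  \<open>rot d\<close> leads to \<open>b\<close> and negatively if \<open>d\<close> does. Rotating
  the positive part by one step turns the left face of \<open>d\<close> into the right face of
  \<open>rot d\<close>.\<close>

lemma incidence_product:
  fixes a :: "('a \<times> 'a) set \<Rightarrow> 'b :: comm_ring_1"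
  assumes w: "w \<in> White" and b: "b \<in> Black"
  shows "(\<Sum>f\<in>faces Q rot. of_int (incidence s f w) * (of_int (incidence s f b) * a f)) =
    (if (w, b) \<in> parcs Q then a (right_face rot (w, b)) - a (right_face rot (b, w)) else 0)"
proof -
  let ?D = "{d. d \<in> parcs Q \<and> fst d = w}"
  have "(\<Sum>f\<in>faces Q rot. of_int (incidence s f w) * (of_int (incidence s f b) * a f))
      = (\<Sum>d\<in>?D. (if snd (rot d) = b then a (lf d) else 0) - (if snd d = b then a (lf d) else 0))"
    unfolding sum_incidence
  proof (intro sum.cong refl)
    fix d assume "d \<in> ?D"
    then have d: "d \<in> parcs Q" "fst d \<in> White" using w by auto
    have op: "opp (fs d) = prod.swap (rot d)" using fs_opp[OF d(1)] by (simp add: opposite_def)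
    have "b \<notin> White" using b colours(1) by blast
    then have "incidence s (lf d) b = (if snd d = b then - s d else 0) + (if snd (rot d) = b then s d else 0)"
      using incidence_same_colour[of "fs d" b] d b colours(1,2) black_fs[of d] dart_colours(3)[of "fs d"] sign_fs_white[of d]
      unfolding op by (simp add: fst_fs)
    then have "s d * incidence s (lf d) b = (if snd (rot d) = b then 1 else 0) - (if snd d = b then 1 else 0)"
      using sign_sq[OF d(1)] by (cases "snd d = b"; cases "snd (rot d) = b") simp_all
    then have "of_int (s d) * of_int (incidence s (lf d) b) = (of_int ((if snd (rot d) = b then 1 else 0) - (if snd d = b then 1 else 0)) :: 'b)"
      by (metis of_int_mult)
    then show "of_int (s d) * (of_int (incidence s (lf d) b) * a (lf d)) =
        (if snd (rot d) = b then a (lf d) else 0) - (if snd d = b then a (lf d) else 0)"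
      by (simp flip: mult.assoc)
  qed
  also have "\<dots> = (\<Sum>d\<in>?D. if snd (rot d) = b then a (lf d) else 0) - (\<Sum>d\<in>?D. if snd d = b then a (lf d) else 0)"
    by (rule sum_subtractf)
  also have "(\<Sum>d\<in>?D. if snd (rot d) = b then a (lf d) else 0) = (\<Sum>d\<in>?D. if snd d = b then a (right_face rot d) else 0)"
  proof (rule sum.reindex_bij_witness[of _ "rot_inv" rot])
    show "(if snd (rot d) = b then a (right_face rot (rot d)) else 0) = (if snd (rot d) = b then a (lf d) else 0)"
      if "d \<in> ?D" for d
      using that lf_swap[of "rot d"] by (simp add: right_face_def)
  qed auto
  also have "(\<Sum>d\<in>?D. if snd d = b then a (right_face rot d) else 0) = (if (w, b) \<in> parcs Q then a (right_face rot (w, b)) else 0)"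
  proof -
    have "(\<Sum>d\<in>?D. if snd d = b then a (right_face rot d) else 0) = (\<Sum>d\<in>?D. if d = (w, b) then a (right_face rot (w, b)) else 0)"
      by (intro sum.cong) auto
    then show ?thesis by simp
  qed
  also have "(\<Sum>d\<in>?D. if snd d = b then a (lf d) else 0) = (if (w, b) \<in> parcs Q then a (lf (w, b)) else 0)"
  proof -
    have "(\<Sum>d\<in>?D. if snd d = b then a (lf d) else 0) = (\<Sum>d\<in>?D. if d = (w, b) then a (lf (w, b)) else 0)"
      by (intro sum.cong) auto
    then show ?thesis by simp
  qed
  finally show ?thesis by (simp add: right_face_def)
qed

lemma incidence_orthogonal:
  assumes "w \<in> White" "b \<in> Black"
  shows "(\<Sum>f\<in>faces Q rot. incidence s f w * incidence s f b) = 0"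
  using incidence_product[OF assms, of "\<lambda>_. 1::int"] by simp

end

lemma left_kernel_trivial:
  fixes A :: "int mat"
  assumes A: "A \<in> carrier_mat n n" and det: "det A \<noteq> 0"
    and y: "\<And>j. j < n \<Longrightarrow> (\<Sum>i<n. A $$ (i, j) * y i) = 0" and "i < n"
  shows "y i = 0"
proof -
  have At: "transpose_mat A \<in> carrier_mat n n" using A by simp
  have "det (transpose_mat A) \<noteq> 0" using det det_transpose[OF A] by simp
  moreover have "transpose_mat A *\<^sub>v vec n y = 0\<^sub>v n"
    using A y by (intro eq_vecI) (auto simp: scalar_prod_def atLeast0LessThan)
  ultimately have "vec n y = 0\<^sub>v n"
    using det_0_iff_vec_prod_zero[OF At] by (metis vec_carrier)
  then show ?thesis using \<open>i < n\<close> by (metis index_vec index_zero_vec(1))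
qed

context signed_quadrangulation
begin

section \<open>Faces as edges between corners of equal colour, and distances\<close>

lemma ex_black_dart: "f \<in> faces Q rot \<Longrightarrow> \<exists>d\<in>parcs Q. fst d \<in> Black \<and> f = lf d"
  using dart_colours(3) black_fs unfolding faces_def by (metis (no_types, lifting) fs_mem imageE lf_fs)

lemma ex_white_dart: "f \<in> faces Q rot \<Longrightarrow> \<exists>d\<in>parcs Q. fst d \<in> White \<and> f = lf d"
  using dart_colours(3) white_fs unfolding faces_def by (metis (no_types, lifting) fs_mem imageE lf_fs)

lemma ex_dart_of_colour:
  assumes "f \<in> faces Q rot" "v \<in> pverts Q"
  obtains d where "d \<in> parcs Q" "fst d \<in> White \<longleftrightarrow> v \<in> White" "f = lf d"
  using ex_black_dart[OF assms(1)] ex_white_dart[OF assms(1)] dart_colours(3) assms(2) by metis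

lemma incidence_range:
  assumes "f \<in> faces Q rot" "v \<in> pverts Q"
  shows "incidence s f v \<in> {0, 1, -1}"
proof -
  obtain d where d: "d \<in> parcs Q" "fst d \<in> White \<longleftrightarrow> v \<in> White" "f = lf d"
    using ex_dart_of_colour assms .
  show ?thesis
    using incidence_same_colour[OF d(1,2) assms(2)] sign_pm[OF d(1)] by (auto simp: d(3))
qed

lemma incidence_opposite:
  assumes "f \<in> faces Q rot" "u \<in> pverts Q" "v \<in> pverts Q" "u \<in> White \<longleftrightarrow> v \<in> White" "u \<noteq> v"
    and "incidence s f u \<noteq> 0" "incidence s f v \<noteq> 0"
  shows "incidence s f u + incidence s f v = 0"
proof -
  obtain d where d: "d \<in> parcs Q" "fst d \<in> White \<longleftrightarrow> v \<in> White" "f = lf d"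
    using ex_dart_of_colour assms(1,3) .
  then show ?thesis
    using incidence_same_colour[of d u] incidence_same_colour[of d v] assms by (auto split: if_splits)
qed

definition black_dist :: "'a \<Rightarrow> 'a \<Rightarrow> nat" where
  "black_dist r v = (LEAST n. (v, r) \<in> {(fst d, fst (opp d)) | d. d \<in> parcs Q \<and> fst d \<in> Black} ^^ n)"

text \<open>Choosing such a dart at every black vertex except \<open>r\<close> produces a
  breadth-first spanning tree. That \<open>r\<close> can be reached at all is a property invariant
  along the arcs, hence it holds everywhere by connectedness.\<close>

lemma ex_closer_dart:
  assumes r: "r \<in> Black" and v: "v \<in> Black" "v \<noteq> r"
  shows "\<exists>d. d \<in> parcs Q \<and> fst d = v \<and> black_dist r (fst (opp d)) < black_dist r v"
proof -
  define R where "R = {(fst d, fst (opp d)) | d. d \<in> parcs Q \<and> fst d \<in> Black}"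
  have "((v, r) \<in> R\<^sup>*) = ((r, r) \<in> R\<^sup>*)"
  proof (rule constant_on_black[where y = "\<lambda>v. (v, r) \<in> R\<^sup>*"])
    fix d assume d: "d \<in> parcs Q" "fst d \<in> Black"
    have "(fst d, fst (opp d)) \<in> R" using d unfolding R_def by blast
    moreover have "(fst (opp d), fst (opp (opp d))) \<in> R" using d black_opp opp_mem unfolding R_def by blast
    ultimately show "((fst d, r) \<in> R\<^sup>*) = ((fst (opp d), r) \<in> R\<^sup>*)"
      unfolding opp_opp[OF d(1)] by (blast intro: converse_rtrancl_into_rtrancl)
  qed (use r v in auto)
  then obtain n where "(v, r) \<in> R ^^ n" using rtrancl_imp_relpow by blast
  then have least: "(v, r) \<in> R ^^ black_dist r v"
    unfolding black_dist_def R_def[symmetric] by (rule LeastI)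
  then obtain n where n: "black_dist r v = Suc n" using v(2) by (cases "black_dist r v") auto
  then obtain u where u: "(v, u) \<in> R" "(u, r) \<in> R ^^ n" 
    using relpow_Suc_D2[OF least[unfolded n]] by blast
  have "black_dist r u \<le> n" unfolding black_dist_def R_def[symmetric] using u(2) by (rule Least_le)
  then have "black_dist r u < black_dist r v" using n by simp
  then show ?thesis using u(1) unfolding R_def by blast
qed

end

section \<open>Complementary minors\<close>

text \<open>Numbering the faces by \<open>m + k\<close>, with \<open>m\<close> black and
  \<open>k\<close> white vertices apart from the roots, encodes Euler's formula.\<close>

locale rooted_quadrangulation =
  signed_quadrangulation Q rot "W \<union> {wr}" "Bt \<union> {br}" s
  for Q :: "'v pair_pre_digraph" and rot W wr Bt br s +
  fixes m k :: nat and f :: "nat \<Rightarrow> ('v \<times> 'v) set" and b w :: "nat \<Rightarrow> 'v"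
  assumes roots: "wr \<notin> W" "br \<notin> Bt"
    and f: "bij_betw f {..<m + k} (faces Q rot)"
    and b: "bij_betw b {..<m} Bt"
    and w: "bij_betw w {..<k} W"
begin

abbreviation A :: "nat \<Rightarrow> nat \<Rightarrow> int" where "A i j \<equiv> incidence s (f i) (b j)"
abbreviation C :: "nat \<Rightarrow> nat \<Rightarrow> int" where "C i r \<equiv> incidence s (f i) (w r)"

lemma f_mem [simp]: "i < m + k \<Longrightarrow> f i \<in> faces Q rot"
  using f by (auto simp: bij_betw_def)

lemma b_mem [simp]: "j < m \<Longrightarrow> b j \<in> Bt"
  using b by (auto simp: bij_betw_def)

lemma w_mem [simp]: "r < k \<Longrightarrow> w r \<in> W"
  using w by (auto simp: bij_betw_def)

lemma b_eq_iff: "i < m \<Longrightarrow> j < m \<Longrightarrow> b i = b j \<longleftrightarrow> i = j"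
  using b by (auto simp: bij_betw_def inj_on_def)

lemma w_eq_iff: "i < k \<Longrightarrow> j < k \<Longrightarrow> w i = w j \<longleftrightarrow> i = j"
  using w by (auto simp: bij_betw_def inj_on_def)

lemma f_eq_iff: "i < m + k \<Longrightarrow> j < m + k \<Longrightarrow> f i = f j \<longleftrightarrow> i = j"
  using f by (auto simp: bij_betw_def inj_on_def)

lemma black_mem: "v \<in> Bt \<union> {br} \<Longrightarrow> v \<in> pverts Q \<and> v \<notin> W \<union> {wr}"
  using colours(1,2) by auto

lemma white_mem: "v \<in> W \<union> {wr} \<Longrightarrow> v \<in> pverts Q \<and> v \<notin> Bt \<union> {br}"
  using colours(1,2) by auto

lemma sum_faces: "(\<Sum>x\<in>faces Q rot. g x) = (\<Sum>i<m + k. g (f i))"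
  using sum.reindex_bij_betw[OF f, of g] by simp

text \<open>The faces crossed by a spanning tree of the black graph rooted at \<open>br\<close>.\<close>

lemma ex_tree_rows:
  obtains t where "inj_on t {..<m}" "t ` {..<m} \<subseteq> {..<m + k}" "det (mat m m (\<lambda>(r, j). A (t r) j)) \<in> {1, -1}"
proof -
  define g where "g v = (SOME d. d \<in> parcs Q \<and> fst d = v \<and> black_dist br (fst (opp d)) < black_dist br v)" for v
  have g: "g v \<in> parcs Q \<and> fst (g v) = v \<and> black_dist br (fst (opp (g v))) < black_dist br v" if "v \<in> Bt" for v
    unfolding g_def by (rule someI_ex) (use ex_closer_dart that roots in auto)
  define t where "t r = inv_into {..<m + k} f (lf (g (b r)))" for r
  have gP: "lf (g (b r)) \<in> f ` {..<m + k}" if "r < m" for r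
    using f g[OF b_mem[OF that]] by (auto simp: bij_betw_def faces_def)
  have t: "t r < m + k" "f (t r) = lf (g (b r))" if "r < m" for r
    using gP[OF that] inv_into_into[of _ f "{..<m + k}"] f_inv_into_f[of _ f "{..<m + k}"] by (auto simp: t_def)
  have inc: "A (t r) j = (if b r = b j then s (g (b r)) else 0) - (if fst (opp (g (b r))) = b j then s (g (b r)) else 0)"
    if "r < m" "j < m" for r j
    using incidence_same_colour[of "g (b r)" "b j"] g[OF b_mem[OF that(1)]] that black_mem by (auto simp: t(2))
  have inj: "inj_on t {..<m}"
  proof (rule inj_onI)
    fix r r' assume r: "r \<in> {..<m}" "r' \<in> {..<m}" "t r = t r'"
    then have gr: "g (b r) \<in> parcs Q" "g (b r') \<in> parcs Q" "fst (g (b r)) \<in> Bt" "fst (g (b r')) \<in> Bt"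
      "lf (g (b r)) = lf (g (b r'))"
      using g[of "b r"] g[of "b r'"] t(2)[of r] t(2)[of r'] by auto
    then have "g (b r') = g (b r) \<or> g (b r') = opp (g (b r))" using lf_eq_black by blast
    then have "b r = b r'"
    proof
      assume "g (b r') = g (b r)"
      then show ?thesis using g[of "b r"] g[of "b r'"] r by auto
    next
      \<comment> \<open>Each of the two vertices would be strictly closer to \<open>br\<close> than
        the other.\<close>
      assume "g (b r') = opp (g (b r))"
      then have "g (b r) = opp (g (b r'))" using gr by simp
      then show ?thesis using g[of "b r"] g[of "b r'"] r \<open>g (b r') = opp (g (b r))\<close>
        by (metis b_mem lessThan_iff less_asym)
    qed
    then show "r = r'" using b_eq_iff r by auto
  qed
  let ?A = "mat m m (\<lambda>(r, j). A (t r) j)"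
  have net: "network m ?A"
    unfolding network_def using incidence_opposite[OF f_mem[OF t(1)]] black_mem b_eq_iff by simp
  have ent: "A (t j) j = s (g (b j))" if "j < m" for j
    using inc[OF that that] g[OF b_mem[OF that]] by auto
  have s1: "s (g (b j)) \<in> {1, -1}" if "j < m" for j using sign_pm g[OF b_mem[OF that]] by blast
  have trans: "transversal m ?A id"
    using ent s1 by (fastforce simp: transversal_def permutes_id)
  \<comment> \<open>The chosen edges approach the root, so the identity is a transversal with
    well-founded choices, and the determinant is the product of the diagonal.\<close>
  have "choice_rel m ?A id \<subseteq> measure (\<lambda>j. black_dist br (b j))"
  proof
    fix z assume z: "z \<in> choice_rel m ?A id"
    obtain j' j where "z = (j', j)" "j < m" "j' < m" "j' \<noteq> j" "A (t j) j' \<noteq> 0"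
      using z by (auto simp: choice_rel_def)
    moreover have "fst (opp (g (b j))) = b j'" using inc[of j j'] b_eq_iff calculation by (auto split: if_splits)
    ultimately show "z \<in> measure (\<lambda>j. black_dist br (b j))" using g[of "b j"] by auto
  qed
  then have "wf (choice_rel m ?A id)" using wf_measure wf_subset by blast
  then have "det ?A = (\<Prod>j<m. s (g (b j)))"
    using network_det_wf[OF net trans] ent by simp
  moreover have "\<bar>s (g (b j))\<bar> = 1" if "j < m" for j using s1[OF that] by auto
  ultimately have "\<bar>det ?A\<bar> = 1" by (simp add: abs_prod)
  then have "det ?A \<in> {1, -1}" by auto
  moreover have "t ` {..<m} \<subseteq> {..<m + k}" using t(1) by auto
  ultimately show ?thesis using that inj by blast
qed

section \<open>The unimodular completion of the white incidence rows\<close>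

definition tree_rows :: "nat \<Rightarrow> nat" where
  "tree_rows = (SOME t. inj_on t {..<m} \<and> t ` {..<m} \<subseteq> {..<m + k} \<and> det (mat m m (\<lambda>(r, j). A (t r) j)) \<in> {1, -1})"

lemma tree_rows: "inj_on tree_rows {..<m}" "r < m \<Longrightarrow> tree_rows r < m + k"
  "det (mat m m (\<lambda>(r, j). A (tree_rows r) j)) \<in> {1, -1}"
proof -
  have "inj_on tree_rows {..<m} \<and> tree_rows ` {..<m} \<subseteq> {..<m + k} \<and> det (mat m m (\<lambda>(r, j). A (tree_rows r) j)) \<in> {1, -1}"
    (is "?P tree_rows")
  proof -
    obtain t where "inj_on t {..<m}" "t ` {..<m} \<subseteq> {..<m + k}" "det (mat m m (\<lambda>(r, j). A (t r) j)) \<in> {1, -1}"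
      by (rule ex_tree_rows)
    then have "?P t" by blast
    then show ?thesis unfolding tree_rows_def by (rule someI[where P = ?P])
  qed
  then show "inj_on tree_rows {..<m}" "r < m \<Longrightarrow> tree_rows r < m + k"
    "det (mat m m (\<lambda>(r, j). A (tree_rows r) j)) \<in> {1, -1}" by auto
qed

text \<open>
  The rows of the incidence matrix of the white graph annihilate that of the black graph;
  \<open>completion\<close> adds rows that select a nonsingular minor of the latter.
\<close>

definition completion :: "int mat" where
  "completion = mat (m + k) (m + k) (\<lambda>(r, i). if r < m then if i = tree_rows r then 1 else 0 else C i (r - m))"

lemma completion_carrier [simp]: "completion \<in> carrier_mat (m + k) (m + k)"
  by (simp add: completion_def)

lemma completion_dim [simp]: "dim_row completion = m + k" "dim_col completion = m + k"
  by (simp_all add: completion_def)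

lemma orthogonal: "r < k \<Longrightarrow> v \<in> Bt \<union> {br} \<Longrightarrow> (\<Sum>i<m + k. C i r * incidence s (f i) v) = 0"
  using incidence_orthogonal[of "w r" v] by (simp add: sum_faces)

lemma sum_split: "(\<Sum>r<m + k. g r) = (\<Sum>r<m. g r) + (\<Sum>r<k. g (m + r))"
  for g :: "nat \<Rightarrow> 'z :: comm_monoid_add"
  using sum.union_disjoint[of "{..<m}" "{m..<m + k}" g] sum.shift_bounds_nat_ivl[of g 0 m k]
  by (simp add: ivl_disj_un atLeast0LessThan ivl_disj_int add.commute)

lemma completion_row_sum:
  assumes i: "i < m + k"
  shows "(\<Sum>r<m + k. completion $$ (r, i) * y r) = (\<Sum>r<m. if i = tree_rows r then y r else 0) + (\<Sum>r<k. C i r * y (m + r))"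
proof -
  have "(\<Sum>r<m + k. completion $$ (r, i) * y r) = (\<Sum>r<m. completion $$ (r, i) * y r) + (\<Sum>r<k. completion $$ (m + r, i) * y (m + r))"
    by (rule sum_split)
  also have "(\<Sum>r<m. completion $$ (r, i) * y r) = (\<Sum>r<m. if i = tree_rows r then y r else 0)"
    using i by (intro sum.cong) (auto simp: completion_def)
  also have "(\<Sum>r<k. completion $$ (m + r, i) * y (m + r)) = (\<Sum>r<k. C i r * y (m + r))"
    using i by (intro sum.cong) (auto simp: completion_def)
  finally show ?thesis .
qed

text \<open>Pairing with the columns of \<open>A\<close> annihilates the white rows by
  orthogonality. What remains is the nonsingular tree minor applied to the first \<open>m\<close>
  coefficients.\<close>

lemma completion_top_zero:
  assumes x: "\<And>i. i < m + k \<Longrightarrow> x i = (\<Sum>r<m + k. completion $$ (r, i) * y r)"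
    and orth: "\<And>j. j < m \<Longrightarrow> (\<Sum>i<m + k. A i j * x i) = 0" and "r < m"
  shows "y r = 0"
proof (rule left_kernel_trivial[OF _ _ _ \<open>r < m\<close>])
  let ?A = "mat m m (\<lambda>(r, j). A (tree_rows r) j)"
  show "?A \<in> carrier_mat m m" by simp
  show "det ?A \<noteq> 0" using tree_rows(3) by auto
  fix j assume j: "j < m"
  have "(\<Sum>i<m + k. A i j * x i) = (\<Sum>i<m + k. A i j * (\<Sum>r<m. if i = tree_rows r then y r else 0))
      + (\<Sum>i<m + k. A i j * (\<Sum>r<k. C i r * y (m + r)))"
    by (simp add: x completion_row_sum distrib_left sum.distrib)
  also have "(\<Sum>i<m + k. A i j * (\<Sum>r<k. C i r * y (m + r))) = (\<Sum>r<k. (\<Sum>i<m + k. C i r * A i j) * y (m + r))"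
    unfolding sum_distrib_left sum_distrib_right by (subst sum.swap) (simp add: mult_ac)
  also have "\<dots> = 0" using orthogonal j by simp
  also have "(\<Sum>i<m + k. A i j * (\<Sum>r<m. if i = tree_rows r then y r else 0))
      = (\<Sum>r<m. \<Sum>i<m + k. if i = tree_rows r then A i j * y r else 0)"
    unfolding sum_distrib_left by (subst sum.swap) (auto intro!: sum.cong)
  also have "\<dots> = (\<Sum>r<m. A (tree_rows r) j * y r)"
    using tree_rows(2) by (intro sum.cong) auto
  finally have "(\<Sum>r<m. A (tree_rows r) j * y r) = 0" using orth[OF j] by simp
  then show "(\<Sum>i<m. ?A $$ (i, j) * y i) = 0" using j by simp
qed

text \<open>On white vertices the incidence matrix acts as a signed gradient across faces. The
  normalization at \<open>wr\<close> replaces the missing column of that vertex.\<close>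

lemma sum_white_incidence:
  assumes d: "d \<in> parcs Q" "fst d \<in> W \<union> {wr}" and y: "y wr = 0"
  shows "(\<Sum>u\<in>W. incidence s (lf d) u * y u) = s d * (y (fst d) - y (fst (opp d)))"
proof -
  interpret sw: bicoloured_quadrangulation Q rot "Bt \<union> {br}" "W \<union> {wr}" by (rule swap_colours)
  have op: "fst (opp d) \<in> W \<union> {wr}" using sw.black_opp d by simp
  have fin: "finite (W \<union> {wr})" using colours(3) .
  have "(\<Sum>u\<in>W. incidence s (lf d) u * y u) = (\<Sum>u\<in>W \<union> {wr}. incidence s (lf d) u * y u)"
    using fin y by (intro sum.mono_neutral_left) auto
  also have "\<dots> = (\<Sum>u\<in>W \<union> {wr}. (if u = fst d then s d * y u else 0) - (if u = fst (opp d) then s d * y u else 0))"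
  proof (intro sum.cong refl)
    fix u assume "u \<in> W \<union> {wr}"
    then show "incidence s (lf d) u * y u = (if u = fst d then s d * y u else 0) - (if u = fst (opp d) then s d * y u else 0)"
      using incidence_same_colour[of d u] d white_mem by auto
  qed
  also have "\<dots> = s d * (y (fst d) - y (fst (opp d)))"
    unfolding sum_subtractf using fin d(2) op by (simp add: sum.delta right_diff_distrib)
  finally show ?thesis .
qed

text \<open>A vanishing gradient means equal values at the two white corners of every face; by
  connectedness of the white graph \<open>y\<close> equals its value at \<open>wr\<close>.\<close>

lemma white_kernel_trivial:
  assumes y: "y wr = 0" and zero: "\<And>x. x \<in> faces Q rot \<Longrightarrow> (\<Sum>u\<in>W. incidence s x u * y u) = 0" and "u \<in> W"
  shows "y u = 0"
proof -
  interpret sw: bicoloured_quadrangulation Q rot "Bt \<union> {br}" "W \<union> {wr}" by (rule swap_colours)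
  have "y u = y wr"
  proof (rule sw.constant_on_black)
    fix d assume d: "d \<in> parcs Q" "fst d \<in> W \<union> {wr}"
    then have "s d * (y (fst d) - y (fst (opp d))) = 0"
      using sum_white_incidence[of d y] zero[of "lf d"] y by (simp add: faces_def)
    then show "y (fst d) = y (fst (opp d))" using sign_pm[OF d(1)] by auto
  qed (use assms in auto)
  then show ?thesis using y by simp
qed

text \<open>The last \<open>k\<close> coefficients read as a function on the vertices, with the
  default value 0 grounding it at \<open>wr\<close>.\<close>

definition extend :: "(nat \<Rightarrow> int) \<Rightarrow> 'v \<Rightarrow> int" where
  "extend y u = (if u \<in> W then y (m + inv_into {..<k} w u) else 0)"

lemma sum_extend: "(\<Sum>r<k. incidence s x (w r) * y (m + r)) = (\<Sum>u\<in>W. incidence s x u * extend y u)"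
proof -
  have "(\<Sum>u\<in>W. incidence s x u * extend y u) = (\<Sum>r<k. incidence s x (w r) * extend y (w r))"
    using sum.reindex_bij_betw[OF w, of "\<lambda>u. incidence s x u * extend y u"] by simp
  moreover have "extend y (w r) = y (m + r)" if "r < k" for r
    using w that by (simp add: extend_def bij_betw_def)
  ultimately show ?thesis by simp
qed

text \<open>A vanishing combination of rows has no tree part by \<open>completion_top_zero\<close>,
  and its white part is a function with zero gradient.\<close>

lemma det_completion_nonzero: "det completion \<noteq> 0"
proof
  assume "det completion = 0"
  then have "det (transpose_mat completion) = 0" using det_transpose[OF completion_carrier] by simp
  moreover have "transpose_mat completion \<in> carrier_mat (m + k) (m + k)" by simp
  ultimately obtain v where v: "v \<in> carrier_vec (m + k)" "v \<noteq> 0\<^sub>v (m + k)" "transpose_mat completion *\<^sub>v v = 0\<^sub>v (m + k)"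
    using det_0_iff_vec_prod_zero by blast
  define y where "y r = v $ r" for r
  have zero: "(\<Sum>r<m + k. completion $$ (r, i) * y r) = 0" if i: "i < m + k" for i
  proof -
    have "(transpose_mat completion *\<^sub>v v) $ i = (\<Sum>r<m + k. completion $$ (r, i) * y r)"
      using i v(1) completion_carrier by (simp add: scalar_prod_def y_def atLeast0LessThan)
    then show ?thesis using v(3) i by simp
  qed
  have top: "y r = 0" if "r < m" for r
    by (rule completion_top_zero[where x = "\<lambda>_. 0"]) (use zero that in auto)
  have "extend y u = 0" if "u \<in> W" for u
  proof (rule white_kernel_trivial)
    show "extend y wr = 0" using roots by (simp add: extend_def)
    fix x assume "x \<in> faces Q rot"
    then obtain i where i: "i < m + k" "x = f i" using f by (auto simp: bij_betw_def)
    have "(\<Sum>r<m. if i = tree_rows r then y r else 0) = 0" using top by (intro sum.neutral) auto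
    then show "(\<Sum>u\<in>W. incidence s x u * extend y u) = 0"
      using zero[OF i(1)] unfolding completion_row_sum[OF i(1)] sum_extend i(2) by simp
  qed (rule that)
  then have "y (m + r) = 0" if "r < k" for r
    using that w by (force simp: extend_def bij_betw_def)
  then have "y r = 0" if "r < m + k" for r
    using that top by (cases "r < m") (auto simp: not_less dest!: le_Suc_ex)
  then have "v = 0\<^sub>v (m + k)" using v(1) by (intro eq_vecI) (auto simp: y_def)
  then show False using v(2) by simp
qed

text \<open>
  A unit row forces the choice of its column, so the other entries of that column may be
  replaced by zero, which turns the transpose into a network matrix.
\<close>

lemma det_completion: "det completion \<in> {1, -1}"
proof -
  let ?n = "m + k"
  define D where "D = mat ?n ?n (\<lambda>(i, r). if r < m \<or> i \<notin> tree_rows ` {..<m} then completion $$ (r, i) else 0)"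
  have D: "D \<in> carrier_mat ?n ?n" by (simp add: D_def)
  have Dt: "transpose_mat D \<in> carrier_mat ?n ?n" using D by simp
  have "det (transpose_mat D) = det completion"
    unfolding det_def'[OF completion_carrier] det_def'[OF Dt]
  proof (intro sum.cong refl arg_cong2[where f = "(*)"])
    fix p assume "p \<in> {p. p permutes {0..<?n}}"
    then have p: "p permutes {0..<?n}" by simp
    have pn: "p i < ?n" if "i < ?n" for i using p that by (metis atLeastLessThan_iff le0 permutes_in_image)
    show "(\<Prod>i = 0..<?n. transpose_mat D $$ (i, p i)) = (\<Prod>i = 0..<?n. completion $$ (i, p i))"
    proof (cases "\<forall>r<m. p r = tree_rows r")
      case True
      show ?thesis
      proof (intro prod.cong refl)
        fix i assume i: "i \<in> {0..<?n}"
        have "p i \<notin> tree_rows ` {..<m}" if "\<not> i < m"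
        proof
          assume "p i \<in> tree_rows ` {..<m}"
          then obtain r where "r < m" "p i = p r" using True by auto
          then show False using that permutes_inj[OF p] by (auto dest: injD)
        qed
        then show "transpose_mat D $$ (i, p i) = completion $$ (i, p i)" using i pn D by (auto simp: D_def)
      qed
    next
      case False
      then obtain r where r: "r < m" "p r \<noteq> tree_rows r" by blast
      then have "completion $$ (r, p r) = 0" "transpose_mat D $$ (r, p r) = 0"
        using pn[of r] D by (auto simp: completion_def D_def)
      then have "(\<Prod>i = 0..<?n. completion $$ (i, p i)) = 0" "(\<Prod>i = 0..<?n. transpose_mat D $$ (i, p i)) = 0"
        using r(1) by (auto intro!: prod_zero bexI[of _ r])
      then show ?thesis by (simp only:)
    qed
  qed
  then have eq: "det D = det completion" using det_transpose[OF D] by simp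
  have "network ?n D"
    unfolding network_def
  proof (intro conjI D allI impI)
    fix i j j' assume ij: "i < ?n" "j < ?n" "j' < ?n" "j \<noteq> j'" "D $$ (i, j) \<noteq> 0" "D $$ (i, j') \<noteq> 0"
    have tree: "i = tree_rows r" if "r < m" "D $$ (i, r) \<noteq> 0" for r
      using that ij(1) by (auto simp: D_def completion_def split: if_splits)
    have not_tree: "i \<notin> tree_rows ` {..<m}" "D $$ (i, r) = C i (r - m)" if "\<not> r < m" "r < ?n" "D $$ (i, r) \<noteq> 0" for r
      using that ij(1) by (auto simp: D_def completion_def split: if_splits)
    \<comment> \<open>In \<open>D\<close> a tree face meets only its own unit column and any other
      face only white columns, so two nonzero entries belong to the two white corners of one
      face.\<close>
    show "D $$ (i, j) + D $$ (i, j') = 0"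
    proof (cases "j < m \<or> j' < m")
      case True
      then show ?thesis using ij tree[of j] tree[of j'] not_tree(1)[of j] not_tree(1)[of j'] tree_rows(1)
        by (metis imageI inj_onD lessThan_iff)
    next
      case False
      then have "w (j - m) \<noteq> w (j' - m)" "j - m < k" "j' - m < k" using ij w_eq_iff by auto
      then show ?thesis
        using False ij not_tree(2)[of j] not_tree(2)[of j'] white_mem
          incidence_opposite[OF f_mem[OF ij(1)], of "w (j - m)" "w (j' - m)"] by auto
    qed
  qed
  moreover have "D $$ (i, j) \<in> {0, 1, -1}" if "i < ?n" "j < ?n" for i j
  proof -
    have "C i (j - m) \<in> {0, 1, -1}" if "\<not> j < m"
      using \<open>i < ?n\<close> \<open>j < ?n\<close> that incidence_range[OF f_mem, of i "w (j - m)"] white_mem by simp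
    then show ?thesis using that by (auto simp: D_def completion_def)
  qed
  ultimately have "det D \<in> {1, -1}"
    using eq det_completion_nonzero by (intro network_det_unimodular) auto
  then show ?thesis using eq by simp
qed

text \<open>This is the vanishing of the first integral cohomology of the sphere. Unimodularity
  solves the completed system over the integers, and the coefficients of the tree rows vanish
  because \<open>x\<close> is orthogonal to the black columns.\<close>

lemma black_orthogonal_imp_white_coboundary:
  assumes x: "\<And>v. v \<in> Bt \<Longrightarrow> (\<Sum>z\<in>faces Q rot. incidence s z v * x z) = 0"
  obtains y where "y wr = 0" "\<And>z. z \<in> faces Q rot \<Longrightarrow> x z = (\<Sum>u\<in>W. incidence s z u * y u)"
proof -
  have "det (transpose_mat completion) \<in> {1, -1}" using det_completion det_transpose[OF completion_carrier] by simp
  then obtain v where v: "v \<in> carrier_vec (m + k)" "transpose_mat completion *\<^sub>v v = vec (m + k) (\<lambda>i. x (f i))"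
    using int_solvable_if_unimodular[of "transpose_mat completion" "m + k" "vec (m + k) (\<lambda>i. x (f i))"] by auto
  define y where "y r = v $ r" for r
  have sol: "x (f i) = (\<Sum>r<m + k. completion $$ (r, i) * y r)" if i: "i < m + k" for i
  proof -
    have "(transpose_mat completion *\<^sub>v v) $ i = (\<Sum>r<m + k. completion $$ (r, i) * y r)"
      using i v(1) completion_carrier by (simp add: scalar_prod_def y_def atLeast0LessThan)
    then show ?thesis using v(2) i by simp
  qed
  have top: "y r = 0" if "r < m" for r
    by (rule completion_top_zero[where x = "\<lambda>i. x (f i)"])
      (use sol that x sum_faces[of "\<lambda>z. incidence s z v * x z" for v] in auto)
  show ?thesis
  proof (rule that)
    show "extend y wr = 0" using roots by (simp add: extend_def)
    fix z assume "z \<in> faces Q rot"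
    then obtain i where i: "i < m + k" "z = f i" using f by (auto simp: bij_betw_def)
    have "(\<Sum>r<m. if i = tree_rows r then y r else 0) = 0" using top by (intro sum.neutral) auto
    then show "x z = (\<Sum>u\<in>W. incidence s z u * extend y u)"
      using sol[OF i(1)] unfolding completion_row_sum[OF i(1)] sum_extend i(2) by simp
  qed
qed

section \<open>Passing from edge weights to face weights\<close>

definition edge_weight :: "(('v \<times> 'v) set \<Rightarrow> 'r) \<Rightarrow> 'v \<Rightarrow> 'v \<Rightarrow> 'r :: comm_ring_1" where
  "edge_weight a x y = (if (x, y) \<in> parcs Q then a (right_face rot (x, y)) - a (right_face rot (y, x)) else 0)"

definition doubled_incidence :: "(('v \<times> 'v) set \<Rightarrow> 'r) \<Rightarrow> (nat \<Rightarrow> 'v) \<Rightarrow> 'r :: comm_ring_1 mat" where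
  "doubled_incidence a c = mat (m + k) (m + k)
     (\<lambda>(i, j). if j < m then of_int (A i j) else of_int (incidence s (f i) (c (j - m))) * a (f i))"

text \<open>The product of \<open>completion\<close> and \<open>doubled_incidence\<close> is block triangular.\<close>

lemma det_edge_weight:
  fixes a :: "('v \<times> 'v) set \<Rightarrow> 'r :: comm_ring_1"
  assumes c: "\<And>j. j < k \<Longrightarrow> c j \<in> Bt"
  shows "of_int (det completion) * det (doubled_incidence a c) =
    of_int (det (mat m m (\<lambda>(r, j). A (tree_rows r) j))) * det (mat k k (\<lambda>(i, j). edge_weight a (w i) (c j)))"
proof -
  interpret hom: comm_ring_hom "of_int :: int \<Rightarrow> 'r" by unfold_locales auto
  let ?n = "m + k" and ?C = "map_mat (of_int :: int \<Rightarrow> 'r) completion" and ?D = "doubled_incidence a c"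
  have C: "?C \<in> carrier_mat ?n ?n" and D: "?D \<in> carrier_mat ?n ?n" by (simp_all add: doubled_incidence_def)
  have idx: "(?C * ?D) $$ (r, j) = (\<Sum>i<?n. of_int (completion $$ (r, i)) * ?D $$ (i, j))"
    if "r < ?n" "j < ?n" for r j
    using that by (auto simp: doubled_incidence_def scalar_prod_def atLeast0LessThan intro!: sum.cong)
  have top: "(?C * ?D) $$ (r, j) = ?D $$ (tree_rows r, j)" if "r < m" "j < ?n" for r j
  proof -
    have "(?C * ?D) $$ (r, j) = (\<Sum>i<?n. if i = tree_rows r then ?D $$ (i, j) else 0)"
      unfolding idx[OF trans_less_add1[OF that(1)] that(2)]
      by (rule sum.cong) (use that in \<open>auto simp: completion_def\<close>)
    then show ?thesis using tree_rows(2)[OF that(1)] by simp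
  qed
  have bottom: "(?C * ?D) $$ (m + r, j) = (\<Sum>i<?n. of_int (C i r) * ?D $$ (i, j))" if "r < k" "j < ?n" for r j
    using that by (subst idx) (auto simp: completion_def intro!: sum.cong)
  have zero: "(?C * ?D) $$ (r, j) = 0" if rj: "m \<le> r" "r < ?n" "j < m" for r j
  proof -
    have "(?C * ?D) $$ (m + (r - m), j) = (\<Sum>i<?n. of_int (C i (r - m) * A i j))"
      using rj by (subst bottom) (auto simp: doubled_incidence_def intro!: sum.cong)
    also have "\<dots> = of_int (\<Sum>i<?n. C i (r - m) * A i j)" by simp
    also have "(\<Sum>i<?n. C i (r - m) * A i j) = 0" using rj by (intro orthogonal) auto
    finally show ?thesis using rj by simp
  qed
  have lower: "(?C * ?D) $$ (m + r, m + j) = edge_weight a (w r) (c j)" if rj: "r < k" "j < k" for r j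
  proof -
    have "(?C * ?D) $$ (m + r, m + j) = (\<Sum>i<?n. of_int (C i r) * (of_int (incidence s (f i) (c j)) * a (f i)))"
      using rj by (subst bottom) (auto simp: doubled_incidence_def intro!: sum.cong)
    also have "\<dots> = edge_weight a (w r) (c j)"
      using incidence_product[of "w r" "c j" a] rj c by (simp add: sum_faces edge_weight_def)
    finally show ?thesis .
  qed
  have "of_int (det completion) * det ?D = det (?C * ?D)"
    using det_mult[OF C D] by simp
  also have "\<dots> = det (mat m m (\<lambda>(i, j). (?C * ?D) $$ (i, j))) * det (mat (?n - m) (?n - m) (\<lambda>(i, j). (?C * ?D) $$ (m + i, m + j)))"
    using C D zero by (intro det_block_upper_triangular[of _ ?n]) auto
  also have "mat m m (\<lambda>(i, j). (?C * ?D) $$ (i, j)) = map_mat of_int (mat m m (\<lambda>(r, j). A (tree_rows r) j))"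
  proof (rule eq_matI)
    fix i j assume "i < dim_row (map_mat of_int (mat m m (\<lambda>(r, j). A (tree_rows r) j)) :: 'r mat)"
      "j < dim_col (map_mat of_int (mat m m (\<lambda>(r, j). A (tree_rows r) j)) :: 'r mat)"
    then have ij: "i < m" "j < m" by auto
    have "(?C * ?D) $$ (i, j) = of_int (A (tree_rows i) j)"
      unfolding top[OF ij(1) trans_less_add1[OF ij(2)]] using tree_rows(2)[OF ij(1)] ij by (simp add: doubled_incidence_def)
    then show "mat m m (\<lambda>(i, j). (?C * ?D) $$ (i, j)) $$ (i, j) = map_mat of_int (mat m m (\<lambda>(r, j). A (tree_rows r) j)) $$ (i, j)"
      using ij by (simp del: index_mult_mat)
  qed simp_all
  also have "mat (?n - m) (?n - m) (\<lambda>(i, j). (?C * ?D) $$ (m + i, m + j)) = mat k k (\<lambda>(i, j). edge_weight a (w i) (c j))"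
    by (rule eq_matI) (simp_all add: lower del: index_mult_mat)
  finally show ?thesis by simp
qed

text \<open>Both integer factors in \<open>det_edge_weight\<close> are units, so they can be moved
  across without division in the coefficient ring; their product is the sign.\<close>

lemma det_edge_weight_eq:
  fixes a :: "('v \<times> 'v) set \<Rightarrow> 'r :: comm_ring_1"
  assumes "\<And>j. j < k \<Longrightarrow> c j \<in> Bt"
  obtains \<epsilon> :: int where "\<epsilon> \<in> {1, -1}"
    "det (mat k k (\<lambda>(i, j). edge_weight a (w i) (c j))) = of_int \<epsilon> * det (doubled_incidence a c)"
proof
  let ?x = "det completion" and ?y = "det (mat m m (\<lambda>(r, j). A (tree_rows r) j))"
  show "?x * ?y \<in> {1, -1}" using det_completion tree_rows(3) by auto
  have "?y * ?y = 1" using tree_rows(3) by auto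
  then have y: "of_int ?y * of_int ?y = (1 :: 'r)" by (metis of_int_1 of_int_mult)
  have "of_int (?x * ?y) * det (doubled_incidence a c) = of_int ?y * (of_int ?x * det (doubled_incidence a c))"
    by (simp add: mult_ac)
  also have "\<dots> = (of_int ?y * of_int ?y) * det (mat k k (\<lambda>(i, j). edge_weight a (w i) (c j)))"
    by (simp add: det_edge_weight[OF assms] mult.assoc)
  finally show "det (mat k k (\<lambda>(i, j). edge_weight a (w i) (c j))) = of_int (?x * ?y) * det (doubled_incidence a c)"
    unfolding y by simp
qed

end

section \<open>Forests given by choosing outgoing arcs\<close>

lemma (in pre_digraph) cas_nth:
  assumes "cas u p v" "Suc i < length p"
  shows "tail G (p ! Suc i) = head G (p ! i)"
  using assms
proof (induction p arbitrary: u i)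
  case (Cons e p)
  then show ?case by (cases i; cases p) auto
qed simp

lemma (in pre_digraph) cas_ends:
  assumes "cas u p v" "p \<noteq> []"
  shows "tail G (p ! 0) = u" "head G (p ! (length p - 1)) = v"
  using assms by (induction p arbitrary: u) (auto simp: nth_Cons' split: if_splits)

lemma (in pre_digraph) closed_walk_neighbours:
  assumes "cas u p u" "i < length p"
  shows "\<exists>j<length p. head G (p ! j) = tail G (p ! i)" "\<exists>j<length p. tail G (p ! j) = head G (p ! i)"
proof -
  have ne: "p \<noteq> []" using assms by auto
  show "\<exists>j<length p. head G (p ! j) = tail G (p ! i)"
  proof (cases i)
    case 0
    then show ?thesis using cas_ends[OF assms(1) ne] ne by (auto intro!: exI[of _ "length p - 1"])
  next
    case (Suc j)
    then show ?thesis using cas_nth[OF assms(1), of j] assms(2) by (auto intro!: exI[of _ j])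
  qed
  show "\<exists>j<length p. tail G (p ! j) = head G (p ! i)"
  proof (cases "Suc i < length p")
    case True
    then show ?thesis using cas_nth[OF assms(1), of i] by blast
  next
    case False
    then have "i = length p - 1" using assms(2) by simp
    then show ?thesis using cas_ends[OF assms(1) ne] ne by (auto intro!: exI[of _ 0])
  qed
qed

context bicoloured_quadrangulation
begin

abbreviation "H \<equiv> black_graph Q rot Black"

section \<open>Arc sets as relations between black vertices\<close>

definition steps :: "('v \<times> 'v) set \<Rightarrow> 'v rel" where
  "steps A = (\<lambda>d. (fst d, fst (opp d))) ` A"

lemma stepsI: "d \<in> A \<Longrightarrow> fst d = u \<Longrightarrow> fst (opp d) = v \<Longrightarrow> (u, v) \<in> steps A"
  unfolding steps_def by blast

lemma stepsE:
  assumes "(u, v) \<in> steps A"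
  obtains d where "d \<in> A" "u = fst d" "v = fst (opp d)"
  using assms unfolding steps_def by blast

lemma H_simps [simp]:
  "verts H = Black" "arcs H = {d \<in> parcs Q. fst d \<in> Black}" "tail H = fst" "head H = (\<lambda>d. fst (opp d))"
  by (simp_all add: black_graph_def)

lemma reachable_iff:
  assumes "A \<subseteq> arcs H"
  shows "u \<rightarrow>\<^sup>*\<^bsub>H\<lparr>arcs := A\<rparr>\<^esub> v \<longleftrightarrow> u \<in> Black \<and> (u, v) \<in> (steps A)\<^sup>*"
proof -
  interpret A: wf_digraph "H\<lparr>arcs := A\<rparr>"
    using assms black_opp by unfold_locales auto
  have ends: "arcs_ends (H\<lparr>arcs := A\<rparr>) = steps A"
    by (simp add: arcs_ends_conv steps_def)
  have "u \<rightarrow>\<^sup>*\<^bsub>H\<lparr>arcs := A\<rparr>\<^esub> v \<longleftrightarrow> u \<in> Black \<and> v \<in> Black \<and> (u, v) \<in> (steps A)\<^sup>*"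
    unfolding A.reachable_conv ends by auto
  moreover have "v \<in> Black" if "(u, v) \<in> (steps A)\<^sup>*" "u \<in> Black"
    using that by induction (use assms black_opp in \<open>auto elim!: stepsE\<close>)
  ultimately show ?thesis by blast
qed

lemma undirected_subset: "A \<subseteq> arcs H \<Longrightarrow> A \<union> opp ` A \<subseteq> arcs H"
  using black_opp by auto

lemma steps_undirected: "A \<subseteq> arcs H \<Longrightarrow> steps (A \<union> opp ` A) = steps A \<union> (steps A)\<inverse>"
proof -
  assume A: "A \<subseteq> arcs H"
  have "steps (opp ` A) = (steps A)\<inverse>"
    unfolding steps_def image_image
  proof (rule Set.set_eqI)
    fix z
    have "z \<in> (\<lambda>d. (fst (opp d), fst (opp (opp d)))) ` A \<longleftrightarrow> z \<in> (\<lambda>d. (fst (opp d), fst d)) ` A"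
      using A by (intro arg_cong[where f = "\<lambda>X. z \<in> X"] image_cong) auto
    also have "\<dots> \<longleftrightarrow> z \<in> ((\<lambda>d. (fst d, fst (opp d))) ` A)\<inverse>" by (cases z) auto
    finally show "z \<in> (\<lambda>d. (fst (opp d), fst (opp (opp d)))) ` A \<longleftrightarrow> z \<in> ((\<lambda>d. (fst d, fst (opp d))) ` A)\<inverse>" .
  qed
  then show ?thesis by (simp add: steps_def image_Un)
qed

lemma finite_steps: "A \<subseteq> arcs H \<Longrightarrow> finite (steps A)"
proof -
  assume "A \<subseteq> arcs H"
  then have "finite A" by (auto intro: finite_subset[OF _ finite_darts])
  then show ?thesis by (simp add: steps_def)
qed

definition choice :: "('v \<times> 'v) set \<Rightarrow> bool" where
  "choice A \<longleftrightarrow> A \<subseteq> arcs H \<and> inj_on fst A \<and> (\<forall>e\<in>A. opp e \<notin> A)"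

text \<open>On an undirected cycle take a vertex \<open>v\<close> that chooses an edge of the cycle
  but is entered by no chosen arc of it. Both edges of the cycle at \<open>v\<close> would have to
  be chosen by \<open>v\<close>, which chooses only one; the walk would then use the same edge
  twice.\<close>

lemma choice_wf_imp_oriented_forest:
  assumes "choice A" "wf ((steps A)\<inverse>)"
  shows "oriented_forest H opp A"
proof -
  have A: "A \<subseteq> arcs H" "inj_on fst A" "\<And>e. e \<in> A \<Longrightarrow> opp e \<notin> A" using assms by (auto simp: choice_def)
  have wf: "wf (steps A)"
    using assms(2) finite_steps[OF A(1)] wf_acyclic finite_acyclic_wf acyclic_converse by metis
  have False
    if p: "pre_digraph.cycle (undirected H opp A) p" "distinct (map (\<lambda>e. {e, opp e}) p)" for p
  proof -
    interpret U: pre_digraph "undirected H opp A" .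
    obtain u where u: "U.awalk u p u" "p \<noteq> []" using p(1) by (auto simp: U.cycle_def)
    have cas: "U.cas u p u" and sub: "set p \<subseteq> A \<union> opp ` A"
      using u(1) unfolding U.awalk_def by (auto simp: undirected_def)
    have nb: "\<exists>j<length p. fst (opp (p ! j)) = fst (p ! i)" "\<exists>j<length p. fst (p ! j) = fst (opp (p ! i))"
      if "i < length p" for i
      using U.closed_walk_neighbours[OF cas that] by (simp_all add: undirected_def)
    have same: "i = j" if "i < length p" "j < length p" "{p ! i, opp (p ! i)} = {p ! j, opp (p ! j)}" for i j
      using p(2) that by (auto simp: distinct_conv_nth)
    have AP: "d \<in> parcs Q" if "d \<in> A" for d using A(1) that by auto
    define X where "X = {fst d | d. d \<in> A \<and> (d \<in> set p \<or> opp d \<in> set p)}"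
    have inX: "fst d \<in> X" if "d \<in> A" "d \<in> set p \<or> opp d \<in> set p" for d
      using that unfolding X_def by blast
    have "p ! 0 \<in> A \<union> opp ` A" using subsetD[OF sub nth_mem[of 0 p]] u(2) by simp
    then have "X \<noteq> {}"
    proof
      assume "p ! 0 \<in> A"
      then show ?thesis using inX[of "p ! 0"] u(2) nth_mem[of 0 p] by auto
    next
      assume "p ! 0 \<in> opp ` A"
      then obtain d where "d \<in> A" "opp d \<in> set p" using u(2) nth_mem[of 0 p] by fastforce
      then show ?thesis using inX by blast
    qed
    then obtain v where v: "v \<in> X" "\<And>y. (y, v) \<in> steps A \<Longrightarrow> y \<notin> X"
      using wfE_min'[OF wf] by metis
    then obtain d where d: "d \<in> A" "fst d = v" "d \<in> set p \<or> opp d \<in> set p" by (auto simp: X_def)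
    then obtain i where i: "i < length p" "p ! i = d \<or> p ! i = opp d" by (metis in_set_conv_nth)
    have out: "e = d" if "e \<in> A" "fst e = v" for e using A(2) that d by (auto dest: inj_onD)
    from i(2) show False
    proof
      assume pi: "p ! i = d"
      obtain j where j: "j < length p" "fst (opp (p ! j)) = v" using nb(1)[OF i(1)] pi d by auto
      have "p ! j \<notin> A"
      proof
        assume "p ! j \<in> A"
        then have "(fst (p ! j), v) \<in> steps A" "fst (p ! j) \<in> X"
          using j inX nth_mem stepsI by auto
        then show False using v(2) by blast
      qed
      then obtain e where e: "e \<in> A" "p ! j = opp e" using sub j(1) nth_mem by blast
      then have "e = d" using out[of e] j(2) AP by simp
      then have "i = j" using same[OF i(1) j(1)] pi e AP[OF d(1)] by auto
      then show False using pi e \<open>e = d\<close> opp_neq[OF AP[OF d(1)]] by simp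
    next
      assume pi: "p ! i = opp d"
      obtain j where j: "j < length p" "fst (p ! j) = v" using nb(2)[OF i(1)] pi d AP[OF d(1)] by auto
      have "p ! j \<in> A"
      proof (rule ccontr)
        assume "p ! j \<notin> A"
        then obtain e where e: "e \<in> A" "p ! j = opp e" using sub j(1) nth_mem by blast
        then have "(fst e, v) \<in> steps A" using j stepsI by auto
        moreover have "fst e \<in> X" using inX[OF e(1)] e(2) j(1) nth_mem by metis
        ultimately show False using v(2) by blast
      qed
      then have pj: "p ! j = d" using out j by blast
      then have "i = j" using same[OF i(1) j(1)] pi AP[OF d(1)] by auto
      then show False using pi pj opp_neq[OF AP[OF d(1)]] by simp
    qed
  qed
  then show ?thesis using A by (auto simp: oriented_forest_def)
qed

context
  fixes A :: "('v \<times> 'v) set"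
  assumes choice: "choice A"
begin

lemma choice_single_valued: "(u, v) \<in> steps A \<Longrightarrow> (u, v') \<in> steps A \<Longrightarrow> v = v'"
  using choice unfolding choice_def by (elim stepsE) (metis inj_onD)

lemma choice_root_terminal: "r \<notin> fst ` A \<Longrightarrow> (r, v) \<in> (steps A)\<^sup>* \<Longrightarrow> v = r"
  by (erule converse_rtranclE) (auto elim: stepsE)

text \<open>Since \<open>steps A\<close> is single-valued, there is only one way to continue from a
  vertex; choices are well-founded precisely if this way ends, and it can only end at a
  root.\<close>

lemma choice_wf_iff:
  "wf ((steps A)\<inverse>) \<longleftrightarrow> (\<forall>v\<in>Black. \<exists>r\<in>Black - fst ` A. (v, r) \<in> (steps A)\<^sup>*)"
proof
  assume wf: "wf ((steps A)\<inverse>)"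
  have "v \<in> Black \<longrightarrow> (\<exists>r\<in>Black - fst ` A. (v, r) \<in> (steps A)\<^sup>*)" for v
    using wf
  proof (induction v rule: wf_induct_rule)
    case (less v)
    show ?case
    proof (cases "v \<in> fst ` A")
      case True
      then obtain d where d: "d \<in> A" "fst d = v" by blast
      then have st: "(v, fst (opp d)) \<in> steps A" by (simp add: stepsI)
      have "fst (opp d) \<in> Black" using d choice black_opp[of d] by (auto simp: choice_def)
      then show ?thesis using less.IH[of "fst (opp d)"] st by (meson converseI converse_rtrancl_into_rtrancl)
    qed blast
  qed
  then show "\<forall>v\<in>Black. \<exists>r\<in>Black - fst ` A. (v, r) \<in> (steps A)\<^sup>*" by blast
next
  assume reach: "\<forall>v\<in>Black. \<exists>r\<in>Black - fst ` A. (v, r) \<in> (steps A)\<^sup>*"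
  have "v \<in> Wellfounded.acc ((steps A)\<inverse>)" for v
  proof (cases "v \<in> Black")
    case True
    then obtain r where r: "r \<notin> fst ` A" "(v, r) \<in> (steps A)\<^sup>*" using reach by blast
    from r(2) show ?thesis
    proof (induction rule: converse_rtrancl_induct)
      case base
      have "(y, r) \<notin> (steps A)\<inverse>" for y using r(1) by (auto elim: stepsE)
      then show ?case by (meson accI)
    next
      case (step y z)
      then show ?case using choice_single_valued by (metis accI converseD)
    qed
  next
    case False
    then have "(y, v) \<notin> (steps A)\<inverse>" for y using choice by (auto simp: choice_def elim!: stepsE)
    then show ?thesis by (meson accI)
  qed
  then show "wf ((steps A)\<inverse>)" by (simp add: wf_iff_acc)
qed

text \<open>The set of roots reached by directed steps is the same at both ends of an arc, because
  the tail has no other arc to follow. Hence it is constant on undirected components, and at a root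
  it is that root alone.\<close>

lemma choice_undirected_root:
  assumes vr: "(v, r) \<in> (steps A \<union> (steps A)\<inverse>)\<^sup>*" and r: "r \<in> Black - fst ` A"
  shows "{r' \<in> Black - fst ` A. (v, r') \<in> (steps A)\<^sup>*} = {r}"
proof -
  let ?P = "\<lambda>v. {r' \<in> Black - fst ` A. (v, r') \<in> (steps A)\<^sup>*}"
  have eq: "?P u = ?P v" if uv: "(u, v) \<in> steps A" for u v
  proof
    show "?P v \<subseteq> ?P u" using uv by (auto intro: converse_rtrancl_into_rtrancl)
    have "u \<in> fst ` A" using uv by (auto elim!: stepsE)
    show "?P u \<subseteq> ?P v"
    proof
      fix r' assume "r' \<in> ?P u"
      then have r': "r' \<in> Black - fst ` A" "(u, r') \<in> (steps A)\<^sup>*" by auto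
      from r'(2) have "(v, r') \<in> (steps A)\<^sup>*"
        by (cases rule: converse_rtranclE) (use r'(1) \<open>u \<in> fst ` A\<close> uv choice_single_valued in auto)
      then show "r' \<in> ?P v" using r' by blast
    qed
  qed
  have "?P v = ?P r"
    using vr
  proof (induction rule: converse_rtrancl_induct)
    case (step y z)
    then have "?P y = ?P z" using eq[of y z] eq[of z y] by blast
    then show ?case using step.IH by simp
  qed simp
  also have "?P r = {r}" using r choice_root_terminal by auto
  finally show ?thesis .
qed

lemma choice_spanning_forest:
  assumes wf: "wf ((steps A)\<inverse>)"
  shows "rooted_spanning_forest H opp (Black - fst ` A) A"
  unfolding rooted_spanning_forest_def
proof (intro conjI ballI impI)
  have A: "A \<subseteq> arcs H" using choice by (simp add: choice_def)
  have und: "v \<rightarrow>\<^sup>*\<^bsub>undirected H opp A\<^esub> r \<longleftrightarrow> v \<in> Black \<and> (v, r) \<in> (steps A \<union> (steps A)\<inverse>)\<^sup>*" for v r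
    unfolding undirected_def reachable_iff[OF undirected_subset[OF A]] steps_undirected[OF A] ..
  show "oriented_forest H opp A" using choice_wf_imp_oriented_forest[OF choice wf] .
  {
    fix v assume v: "v \<in> verts H"
    then obtain r where r: "r \<in> Black - fst ` A" "(v, r) \<in> (steps A)\<^sup>*" using wf choice_wf_iff by auto
    have vr: "(v, r) \<in> (steps A \<union> (steps A)\<inverse>)\<^sup>*" using r(2) by (meson Un_upper1 in_mono rtrancl_mono)
    have uniq: "r' = r" if "r' \<in> Black - fst ` A" "(v, r') \<in> (steps A \<union> (steps A)\<inverse>)\<^sup>*" for r'
    proof -
      have "r \<in> {r' \<in> Black - fst ` A. (v, r') \<in> (steps A)\<^sup>*}" using r by simp
      then show ?thesis unfolding choice_undirected_root[OF that(2,1)] by simp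
    qed
    show "\<exists>!r. r \<in> Black - fst ` A \<and> v \<rightarrow>\<^sup>*\<^bsub>undirected H opp A\<^esub> r"
      unfolding und
    proof (rule ex1I[of _ r])
      show "r \<in> Black - fst ` A \<and> v \<in> Black \<and> (v, r) \<in> (steps A \<union> (steps A)\<inverse>)\<^sup>*"
        using vr r v by simp
    qed (use uniq in blast)
  }
  fix v r assume "v \<in> verts H" "r \<in> Black - fst ` A" "v \<rightarrow>\<^sup>*\<^bsub>undirected H opp A\<^esub> r"
  then have vr: "v \<in> Black" "(v, r) \<in> (steps A \<union> (steps A)\<inverse>)\<^sup>*" "r \<in> Black - fst ` A"
    unfolding und by simp_all
  have "r \<in> {r' \<in> Black - fst ` A. (v, r') \<in> (steps A)\<^sup>*}"
    unfolding choice_undirected_root[OF vr(2,3)] by simp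
  then show "v \<rightarrow>\<^sup>*\<^bsub>H\<lparr>arcs := A\<rparr>\<^esub> r"
    unfolding reachable_iff[OF A] using vr(1) by simp
qed

lemma choice_spanning_tree:
  assumes wf: "wf ((steps A)\<inverse>)" and r: "Black - fst ` A = {r}"
  shows "rooted_spanning_tree H opp r A"
  unfolding rooted_spanning_tree_def
proof (intro conjI ballI)
  have A: "A \<subseteq> arcs H" using choice by (simp add: choice_def)
  show "oriented_forest H opp A" using choice_wf_imp_oriented_forest[OF choice wf] .
  have reach: "(v, r) \<in> (steps A)\<^sup>*" if "v \<in> Black" for v
    using wf r that choice_wf_iff by auto
  then show "v \<rightarrow>\<^sup>*\<^bsub>H\<lparr>arcs := A\<rparr>\<^esub> r" if "v \<in> verts H" for v
    unfolding reachable_iff[OF A] using that by simp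
  let ?M = "mk_symmetric (undirected H opp A)"
  have sub: "steps A \<subseteq> parcs ?M" "(steps A)\<inverse> \<subseteq> parcs ?M"
    by (force simp: mk_symmetric_def undirected_def steps_def)+
  have heads: "v \<in> Black" if "(u, v) \<in> steps A" for u v
    using that A black_opp by (auto elim!: stepsE)
  have tails: "u \<in> Black" if "(u, v) \<in> steps A" for u v
    using that A by (auto elim!: stepsE)
  have forth: "(v, r) \<in> rtrancl_on Black (parcs ?M)" if "v \<in> Black" for v
    using reach[OF that]
  proof (induction rule: converse_rtrancl_induct)
    case base
    then show ?case using r by auto
  next
    case (step y z)
    then show ?case using sub(1) tails by (meson converse_rtrancl_on_into_rtrancl_on in_mono)
  qed
  have fro: "(r, v) \<in> rtrancl_on Black (parcs ?M)" if "v \<in> Black" for v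
    using reach[OF that]
  proof (induction rule: converse_rtrancl_induct)
    case base
    then show ?case using r by auto
  next
    case (step y z)
    then have "(z, y) \<in> parcs ?M" "y \<in> Black" using sub(2) tails by auto
    then show ?case using step.IH rtrancl_on_into_rtrancl_on by metis
  qed
  have "verts (with_proj ?M) = Black" "arcs_ends (with_proj ?M) = parcs ?M"
    by (simp_all add: mk_symmetric_def undirected_def)
  then show "Digraph_Component.connected (undirected H opp A)"
    unfolding Digraph_Component.connected_def strongly_connected_def reachable_def
    using forth fro r by (auto intro: rtrancl_on_trans)
qed

end

end

section \<open>The determinant as a sum over trees and forests\<close>

text \<open>
  The locale parameter \<open>Bt \<union> {br}\<close> must not be normalized to \<open>insert br Bt\<close>, or the
  interpreted simplification rules no longer match.
\<close>

declare Un_insert_right [simp del]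

locale forest_quadrangulation = rooted_quadrangulation +
  fixes B :: "'a set" and c :: "nat \<Rightarrow> 'a"
  assumes B: "B \<subseteq> Bt" and c: "bij_betw c {..<k} B"
begin

text \<open>A vertex of \<open>B\<close> has two columns, one in the tree layer below
  \<open>m\<close> and one in the forest layer, so \<open>vtx\<close> is injective only within a
  layer.\<close>

definition vtx :: "nat \<Rightarrow> 'a" where "vtx j = (if j < m then b j else c (j - m))"

abbreviation "I i j \<equiv> incidence s (f i) (vtx j)"

definition incident :: "(nat \<Rightarrow> nat) \<Rightarrow> bool" where
  "incident p \<longleftrightarrow> p permutes {0..<m + k} \<and> (\<forall>j<m + k. I (p j) j \<noteq> 0)"

text \<open>For an incident \<open>p\<close> this is \<open>choice_rel\<close> of the matrix
  restricted to the forest rows of \<open>p\<close>, expressed without that matrix; it treats both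
  layers at once.\<close>

definition end_rel :: "(nat \<Rightarrow> nat) \<Rightarrow> nat rel" where
  "end_rel p = {(j', j). j < m + k \<and> j' < m + k \<and> j' \<noteq> j \<and> (j < m \<longleftrightarrow> j' < m) \<and> I (p j) j' \<noteq> 0}"

lemma end_relD: "(j', j) \<in> end_rel p \<Longrightarrow> j < m + k \<and> j' < m + k \<and> j' \<noteq> j \<and> (j < m \<longleftrightarrow> j' < m) \<and> I (p j) j' \<noteq> 0"
  by (simp add: end_rel_def)

definition good :: "(nat \<Rightarrow> nat) set" where "good = {p. incident p \<and> wf (end_rel p)}"

definition forest_rows :: "(nat \<Rightarrow> nat) \<Rightarrow> nat set" where "forest_rows p = p ` {m..<m + k}"

text \<open>The rows in \<open>S\<close> may only be used by the forest, the other ones only by the tree.\<close>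

definition restricted :: "nat set \<Rightarrow> int mat" where
  "restricted S = mat (m + k) (m + k) (\<lambda>(i, j). if i \<in> S \<longleftrightarrow> m \<le> j then I i j else 0)"

abbreviation "G \<equiv> with_proj Q \<restriction> (W \<union> B)"

lemma c_mem: "j < k \<Longrightarrow> c j \<in> B" using c by (auto simp: bij_betw_def)

lemma c_eq_iff: "i < k \<Longrightarrow> j < k \<Longrightarrow> c i = c j \<longleftrightarrow> i = j"
  using inj_on_eq_iff[OF bij_betw_imp_inj_on[OF c]] by simp

lemma ex_w: "u \<in> W \<Longrightarrow> \<exists>i<k. u = w i" and ex_c: "u \<in> B \<Longrightarrow> \<exists>i<k. u = c i"
  using w c by (auto simp: bij_betw_def)

lemma W_B: "u \<in> W \<Longrightarrow> u \<notin> B" "u \<in> B \<Longrightarrow> u \<notin> W"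
  using B colours(1) by blast+

lemma vtx_mem: "j < m + k \<Longrightarrow> vtx j \<in> Bt"
  using c_mem[of "j - m"] B by (auto simp: vtx_def)

lemma vtx_colour: "j < m + k \<Longrightarrow> vtx j \<in> pverts Q" "j < m + k \<Longrightarrow> vtx j \<in> Bt \<union> {br}"
  "j < m + k \<Longrightarrow> vtx j \<notin> W \<union> {wr}"
  using vtx_mem[of j] black_mem[of "vtx j"] by blast+

lemma vtx_eq_iff: "i < m + k \<Longrightarrow> j < m + k \<Longrightarrow> (i < m \<longleftrightarrow> j < m) \<Longrightarrow> vtx i = vtx j \<longleftrightarrow> i = j"
  using b_eq_iff[of i j] inj_on_eq_iff[OF bij_betw_imp_inj_on[OF c], of "i - m" "j - m"]
  by (cases "j < m") (auto simp: vtx_def)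

lemma vtx_image: "vtx ` {..<m} = Bt" "vtx ` {m..<m + k} = B"
proof -
  show "vtx ` {..<m} = Bt" using b by (auto simp: vtx_def bij_betw_def)
  have "vtx ` {m..<m + k} = c ` {..<k}"
    by (force simp: vtx_def image_iff intro: bexI[of _ "m + x" for x])
  then show "vtx ` {m..<m + k} = B" using c by (simp add: bij_betw_def)
qed

lemma restricted_carrier [simp]: "restricted S \<in> carrier_mat (m + k) (m + k)"
  by (simp add: restricted_def)

text \<open>A face may meet columns of both layers, which spoils the network condition. The
  restriction leaves each row only one layer, where two nonzero entries are the two black corners of
  the face, with opposite signs.\<close>

lemma network_restricted: "network (m + k) (restricted S)"
  unfolding network_def
proof (intro conjI restricted_carrier allI impI)
  fix i j j' assume ij: "i < m + k" "j < m + k" "j' < m + k" "j \<noteq> j'"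
    "restricted S $$ (i, j) \<noteq> 0" "restricted S $$ (i, j') \<noteq> 0"
  then have e: "restricted S $$ (i, j) = I i j" "restricted S $$ (i, j') = I i j'" "m \<le> j \<longleftrightarrow> m \<le> j'"
    by (auto simp: restricted_def split: if_splits)
  then have "vtx j \<noteq> vtx j'" using ij vtx_eq_iff[of j j'] by auto
  then show "restricted S $$ (i, j) + restricted S $$ (i, j') = 0"
    using ij(5,6) incidence_opposite[OF f_mem[OF ij(1)] vtx_colour(1)[OF ij(2)] vtx_colour(1)[OF ij(3)]]
      vtx_colour(3)[OF ij(2)] vtx_colour(3)[OF ij(3)]
    unfolding e(1,2) by blast
qed

lemma perm_less: "p permutes {0..<m + k} \<Longrightarrow> j < m + k \<Longrightarrow> p j < m + k"
  by (metis atLeastLessThan_iff le0 permutes_in_image)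

lemma mem_forest_rows:
  assumes "p permutes {0..<m + k}" "j < m + k"
  shows "p j \<in> forest_rows p \<longleftrightarrow> m \<le> j"
  using assms(2) inj_image_mem_iff[OF permutes_inj[OF assms(1)]] by (simp add: forest_rows_def)

lemma transversal_restricted_iff:
  assumes S: "S \<subseteq> {..<m + k}"
  shows "transversal (m + k) (restricted S) p \<longleftrightarrow> incident p \<and> forest_rows p = S"
proof
  assume t: "transversal (m + k) (restricted S) p"
  then have p: "p permutes {0..<m + k}" by (simp add: transversal_def)
  have *: "(p j \<in> S \<longleftrightarrow> m \<le> j) \<and> I (p j) j \<noteq> 0" if "j < m + k" for j
    using t that perm_less[OF p] by (auto simp: transversal_def restricted_def split: if_splits)
  have "forest_rows p = S"
  proof
    show "forest_rows p \<subseteq> S" using * by (auto simp: forest_rows_def)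
    show "S \<subseteq> forest_rows p"
    proof
      fix i assume i: "i \<in> S"
      obtain j where "i = p j" using permutes_surj[OF p] by blast
      then show "i \<in> forest_rows p" using i S * permutes_in_image[OF p, of j] by (auto simp: forest_rows_def)
    qed
  qed
  then show "incident p \<and> forest_rows p = S" using p * by (simp add: incident_def)
next
  assume "incident p \<and> forest_rows p = S"
  then show "transversal (m + k) (restricted S) p"
    using mem_forest_rows perm_less by (auto simp: incident_def transversal_def restricted_def)
qed

lemma choice_rel_restricted:
  assumes "incident p"
  shows "choice_rel (m + k) (restricted (forest_rows p)) p = end_rel p"
proof -
  have p: "p permutes {0..<m + k}" using assms by (simp add: incident_def)
  have "restricted (forest_rows p) $$ (p j, j') \<noteq> 0 \<longleftrightarrow> (j < m \<longleftrightarrow> j' < m) \<and> I (p j) j' \<noteq> 0"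
    if "j < m + k" "j' < m + k" for j j'
    using that mem_forest_rows[OF p that(1)] perm_less[OF p that(1)] by (auto simp: restricted_def)
  then show ?thesis by (auto simp: choice_rel_def end_rel_def)
qed

lemma forest_rows_subset: "incident p \<Longrightarrow> forest_rows p \<subseteq> {..<m + k}"
  using perm_less by (auto simp: incident_def forest_rows_def)

text \<open>Both permutations are transversals of the same restricted matrix. This uniqueness is
  what later keeps distinct terms from sharing a monomial.\<close>

lemma good_unique:
  assumes "p \<in> good" "incident q" "forest_rows q = forest_rows p"
  shows "q = p"
proof (rule transversal_unique)
  have p: "incident p" "wf (end_rel p)" using assms by (auto simp: good_def)
  show "transversal (m + k) (restricted (forest_rows p)) p" "transversal (m + k) (restricted (forest_rows p)) q"
    using transversal_restricted_iff forest_rows_subset p assms by metis+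
  show "wf (choice_rel (m + k) (restricted (forest_rows p)) p)" using p choice_rel_restricted by simp
qed

lemma finite_incident [simp]: "finite {p. incident p}"
  by (rule finite_subset[of _ "{p. p permutes {0..<m + k}}"]) (auto simp: incident_def finite_permutations)

lemma finite_good [simp]: "finite good"
  by (rule finite_subset[OF _ finite_incident]) (auto simp: good_def)

text \<open>If the forest rows also admit a permutation that is not good, then the network determinant is zero.\<close>

lemma sum_fixed_forest_rows:
  assumes S: "S \<subseteq> {..<m + k}"
  shows "(\<Sum>p | incident p \<and> forest_rows p = S. sign p * (\<Prod>j<m + k. I (p j) j)) =
    (\<Sum>p | p \<in> good \<and> forest_rows p = S. sign p * (\<Prod>j<m + k. I (p j) j))"
proof (cases "\<exists>p\<in>good. forest_rows p = S")
  case True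
  then obtain p where "p \<in> good" "forest_rows p = S" by blast
  then have "{p. incident p \<and> forest_rows p = S} = {p. p \<in> good \<and> forest_rows p = S}"
    using good_unique by (auto simp: good_def)
  then show ?thesis by simp
next
  case False
  have "(\<Sum>p | incident p \<and> forest_rows p = S. sign p * (\<Prod>j<m + k. I (p j) j)) = det (restricted S)"
    unfolding det_eq_sum_transversals[OF restricted_carrier]
  proof (rule sum.cong)
    fix p assume p: "p \<in> {p. transversal (m + k) (restricted S) p}"
    then have t: "incident p" "forest_rows p = S" using transversal_restricted_iff[OF S] by auto
    then have perm: "p permutes {0..<m + k}" by (simp add: incident_def)
    have "restricted S $$ (p j, j) = I (p j) j" if "j < m + k" for j
      using that perm_less[OF perm that] mem_forest_rows[OF perm that] t by (simp add: restricted_def)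
    then show "sign p * (\<Prod>j<m + k. I (p j) j) = sign p * (\<Prod>j<m + k. restricted S $$ (p j, j))" by simp
  qed (use transversal_restricted_iff[OF S] in auto)
  also have "\<dots> = 0"
  proof (cases "\<exists>p. incident p \<and> forest_rows p = S")
    case True
    then obtain p where p: "incident p" "forest_rows p = S" by blast
    then have "\<not> wf (end_rel p)" using False by (auto simp: good_def)
    then show ?thesis
      using network_det_not_wf[OF network_restricted, of S p] transversal_restricted_iff[OF S] p choice_rel_restricted by auto
  next
    case F: False
    then have "{p. incident p \<and> forest_rows p = S} = {}" by blast
    then show ?thesis
      unfolding det_eq_sum_transversals[OF restricted_carrier] transversal_restricted_iff[OF S] by (simp only: sum.empty)
  qed
  moreover have "{p. p \<in> good \<and> forest_rows p = S} = {}" using False by blast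
  ultimately show ?thesis by (simp only: sum.empty)
qed

text \<open>The weights in a Leibniz term depend only on its forest rows. Grouping the terms by
  these rows leaves integer coefficients, which are determinants of restricted matrices.\<close>

lemma det_doubled_incidence:
  fixes a :: "('a \<times> 'a) set \<Rightarrow> 'r :: comm_ring_1"
  shows "det (doubled_incidence a c) =
    (\<Sum>p\<in>good. of_int (sign p * (\<Prod>j<m + k. I (p j) j)) * (\<Prod>i\<in>forest_rows p. a (f i)))"
proof -
  let ?n = "m + k" and ?g = "\<lambda>p. sign p * (\<Prod>j<m + k. I (p j) j)" and ?M = "\<lambda>S. (\<Prod>i\<in>S. a (f i))"
  have D: "doubled_incidence a c \<in> carrier_mat ?n ?n" by (simp add: doubled_incidence_def)
  have "det (doubled_incidence a c) = (\<Sum>p | p permutes {0..<?n}. of_int (?g p) * ?M (forest_rows p))"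
    unfolding det_col[OF D]
  proof (intro sum.cong refl)
    fix p assume "p \<in> {p. p permutes {0..<?n}}"
    then have p: "p permutes {0..<?n}" by simp
    have "(\<Prod>j<?n. doubled_incidence a c $$ (p j, j)) = (\<Prod>j<?n. of_int (I (p j) j) * (if m \<le> j then a (f (p j)) else 1))"
      using perm_less[OF p] by (intro prod.cong) (auto simp: doubled_incidence_def vtx_def)
    also have "\<dots> = of_int (\<Prod>j<?n. I (p j) j) * (\<Prod>j<?n. if m \<le> j then a (f (p j)) else 1)"
      by (simp add: prod.distrib)
    also have "(\<Prod>j<?n. if m \<le> j then a (f (p j)) else 1) = (\<Prod>j\<in>{j \<in> {..<?n}. m \<le> j}. a (f (p j)))"
      by (rule prod.inter_filter[symmetric]) simp
    also have "{j \<in> {..<?n}. m \<le> j} = {m..<?n}" by auto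
    also have "(\<Prod>j\<in>{m..<?n}. a (f (p j))) = ?M (forest_rows p)"
      unfolding forest_rows_def by (subst prod.reindex) (auto intro: inj_on_subset[OF permutes_inj[OF p]])
    finally show "of_int (sign p) * (\<Prod>j<?n. doubled_incidence a c $$ (p j, j)) = of_int (?g p) * ?M (forest_rows p)"
      by (simp add: mult.assoc)
  qed
  also have "\<dots> = (\<Sum>p | incident p. of_int (?g p) * ?M (forest_rows p))"
  proof (rule sum.mono_neutral_right)
    show "\<forall>p\<in>{p. p permutes {0..<?n}} - {p. incident p}. of_int (?g p) * ?M (forest_rows p) = 0"
    proof
      fix p assume "p \<in> {p. p permutes {0..<?n}} - {p. incident p}"
      then obtain j where "j < ?n" "I (p j) j = 0" by (auto simp: incident_def)
      then have "(\<Prod>j<?n. I (p j) j) = 0" by (auto intro!: prod_zero bexI[of _ j])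
      then have "?g p = 0" by simp
      then show "of_int (?g p) * ?M (forest_rows p) = 0" by (simp only: of_int_0 mult_zero_left)
    qed
  qed (auto simp: incident_def finite_permutations)
  also have "\<dots> = (\<Sum>S\<in>Pow {..<?n}. \<Sum>p\<in>{p \<in> {p. incident p}. forest_rows p = S}. of_int (?g p) * ?M (forest_rows p))"
    using forest_rows_subset by (intro sum.group[symmetric]) auto
  also have "\<dots> = (\<Sum>S\<in>Pow {..<?n}. \<Sum>p\<in>{p \<in> good. forest_rows p = S}. of_int (?g p) * ?M (forest_rows p))"
  proof (rule sum.cong[OF refl])
    fix S assume "S \<in> Pow {..<?n}"
    then have S: "S \<subseteq> {..<?n}" by simp
    have "(\<Sum>p\<in>{p \<in> {p. incident p}. forest_rows p = S}. of_int (?g p) * ?M (forest_rows p)) = of_int (\<Sum>p | incident p \<and> forest_rows p = S. ?g p) * ?M S"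
      unfolding of_int_sum sum_distrib_right by (rule sum.cong) auto
    also have "\<dots> = of_int (\<Sum>p | p \<in> good \<and> forest_rows p = S. ?g p) * ?M S"
      using sum_fixed_forest_rows[OF S] by simp
    also have "\<dots> = (\<Sum>p\<in>{p \<in> good. forest_rows p = S}. of_int (?g p) * ?M (forest_rows p))"
      unfolding of_int_sum sum_distrib_right by (rule sum.cong) auto
    finally show "(\<Sum>p\<in>{p \<in> {p. incident p}. forest_rows p = S}. of_int (?g p) * ?M (forest_rows p))
      = (\<Sum>p\<in>{p \<in> good. forest_rows p = S}. of_int (?g p) * ?M (forest_rows p))" .
  qed
  also have "\<dots> = (\<Sum>p\<in>good. of_int (?g p) * ?M (forest_rows p))"
    using forest_rows_subset by (intro sum.group) (auto simp: good_def)
  finally show ?thesis .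
qed

text \<open>The arc crossing the face chosen by column \<open>j\<close>, directed away from the vertex of column \<open>j\<close>.\<close>

definition arc_of :: "(nat \<Rightarrow> nat) \<Rightarrow> nat \<Rightarrow> 'a \<times> 'a" where
  "arc_of p j = (SOME d. d \<in> parcs Q \<and> lf d = f (p j) \<and> fst d = vtx j)"

lemma arc_of_eqI:
  assumes "d \<in> parcs Q" "lf d = f (p j)" "fst d = vtx j" "fst (opp d) \<noteq> vtx j" "j < m + k"
  shows "arc_of p j = d"
  unfolding arc_of_def
proof (rule some_equality)
  fix e assume e: "e \<in> parcs Q \<and> lf e = f (p j) \<and> fst e = vtx j"
  moreover have "vtx j \<in> Bt" using vtx_mem assms by blast
  ultimately have "e = d \<or> e = opp d" using lf_eq_black[of d e] assms by simp
  then show "e = d" using assms e by metis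
next
  show "d \<in> parcs Q \<and> lf d = f (p j) \<and> fst d = vtx j" using assms(1-3) by (intro conjI)
qed

text \<open>A nonzero incidence rules out that both black corners of the face are at the vertex, so
  the direction of the arc is unambiguous.\<close>

lemma incident_arc_of:
  assumes "incident p" "j < m + k"
  shows "arc_of p j \<in> parcs Q" "lf (arc_of p j) = f (p j)" "fst (arc_of p j) = vtx j"
    "fst (opp (arc_of p j)) \<noteq> vtx j" "I (p j) j = s (arc_of p j)"
proof -
  have pj: "p j < m + k" using assms perm_less by (simp add: incident_def)
  obtain d0 where d0: "d0 \<in> parcs Q" "fst d0 \<in> Bt \<union> {br}" "f (p j) = lf d0"
    using ex_black_dart[OF f_mem[OF pj]] by blast
  have inc: "I (p j) j = (if fst d0 = vtx j then s d0 else 0) - (if fst (opp d0) = vtx j then s d0 else 0)"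
    unfolding d0(3) by (rule incidence_same_colour) (use d0 dart_colours(3)[of d0] vtx_colour assms in auto)
  have "I (p j) j \<noteq> 0" using assms by (simp add: incident_def)
  then have "\<exists>d\<in>parcs Q. lf d = f (p j) \<and> fst d = vtx j \<and> fst (opp d) \<noteq> vtx j"
  proof (cases "fst d0 = vtx j")
    case True
    then have "fst (opp d0) \<noteq> vtx j" using inc \<open>I (p j) j \<noteq> 0\<close> by (auto split: if_splits)
    then show ?thesis using True d0 by (intro bexI[of _ d0]) simp_all
  next
    case False
    then have "fst (opp d0) = vtx j" using inc \<open>I (p j) j \<noteq> 0\<close> by (auto split: if_splits)
    then show ?thesis using False d0 by (intro bexI[of _ "opp d0"]) simp_all
  qed
  then obtain d where d: "d \<in> parcs Q" "lf d = f (p j)" "fst d = vtx j" "fst (opp d) \<noteq> vtx j" by blast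
  have eq: "arc_of p j = d" using arc_of_eqI d assms(2) by blast
  show "arc_of p j \<in> parcs Q" "lf (arc_of p j) = f (p j)" "fst (arc_of p j) = vtx j" "fst (opp (arc_of p j)) \<noteq> vtx j"
    using d eq by auto
  show "I (p j) j = s (arc_of p j)"
    using incidence_same_colour[of d "vtx j"] d vtx_colour[OF assms(2)] unfolding eq d(2)[symmetric] by simp
qed

lemma arc_of_inj: "incident p \<Longrightarrow> i < m + k \<Longrightarrow> j < m + k \<Longrightarrow> lf (arc_of p i) = lf (arc_of p j) \<longleftrightarrow> i = j"
  using incident_arc_of(2) f_eq_iff perm_less permutes_inj unfolding incident_def by (metis injD)

lemma incidence_other_end:
  assumes "incident p" "j < m + k" "j' < m + k" "j < m \<longleftrightarrow> j' < m" "j' \<noteq> j"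
  shows "I (p j) j' \<noteq> 0 \<longleftrightarrow> fst (opp (arc_of p j)) = vtx j'"
proof -
  note t = incident_arc_of[OF assms(1,2)]
  have "vtx j \<noteq> vtx j'" using vtx_eq_iff assms by simp
  then have "I (p j) j' = (if fst (opp (arc_of p j)) = vtx j' then - s (arc_of p j) else 0)"
    using incidence_same_colour[of "arc_of p j" "vtx j'"] t sign_opp[OF t(1)] vtx_colour[OF assms(2)] vtx_colour[OF assms(3)]
    by simp
  then show ?thesis using sign_pm[OF t(1)] by auto
qed

text \<open>The tree and the forest columns undergo the same arguments; this predicate covers
  both.\<close>

definition layer :: "nat set \<Rightarrow> bool" where "layer J \<longleftrightarrow> J = {..<m} \<or> J = {m..<m + k}"

lemma layerD:
  assumes "layer J"
  shows "J \<subseteq> {..<m + k}" "j \<in> J \<Longrightarrow> j' < m + k \<Longrightarrow> j' \<in> J \<longleftrightarrow> (j < m \<longleftrightarrow> j' < m)"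
  using assms by (auto simp: layer_def)

lemma layers: "layer {..<m}" "layer {m..<m + k}"
  by (auto simp: layer_def)

lemma choice_arcs:
  assumes p: "incident p" and J: "layer J"
  shows "choice (arc_of p ` J)" "fst ` (arc_of p ` J) = vtx ` J"
proof -
  have J': "j < m + k" if "j \<in> J" for j using layerD(1)[OF J] that by auto
  show "fst ` (arc_of p ` J) = vtx ` J" using incident_arc_of(3)[OF p J'] by (auto simp: image_image)
  have "inj_on fst (arc_of p ` J)"
  proof (rule inj_onI)
    fix x y assume xy: "x \<in> arc_of p ` J" "y \<in> arc_of p ` J" "fst x = fst y"
    then obtain i j where ij: "i \<in> J" "j \<in> J" "x = arc_of p i" "y = arc_of p j" by blast
    then have "vtx i = vtx j" using incident_arc_of(3)[OF p J'] xy(3) by simp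
    then have "i = j" using vtx_eq_iff[OF J' J'] ij layerD(2)[OF J] J' by blast
    then show "x = y" using ij by simp
  qed
  moreover have "opp (arc_of p i) \<noteq> arc_of p j" if "i \<in> J" "j \<in> J" for i j
  proof
    assume e: "opp (arc_of p i) = arc_of p j"
    have Pi: "arc_of p i \<in> parcs Q" using incident_arc_of(1)[OF p J'] that by blast
    then have "lf (arc_of p i) = lf (arc_of p j)" using e lf_opp by metis
    then have "i = j" using arc_of_inj[OF p J' J'] that by blast
    then show False using e opp_neq[OF Pi] by simp
  qed
  moreover have "arc_of p ` J \<subseteq> arcs H"
    unfolding H_simps using incident_arc_of(1,3)[OF p J'] vtx_mem[OF J'] by auto
  ultimately show "choice (arc_of p ` J)" by (auto simp: choice_def)
qed

text \<open>Within a layer, columns and vertices correspond to each other. A vertex without a column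
  has no outgoing arc, so walks end there and it is accessible at once.\<close>

lemma wf_end_rel_iff:
  assumes p: "incident p"
  shows "wf (end_rel p) \<longleftrightarrow> wf ((steps (arc_of p ` {..<m}))\<inverse>) \<and> wf ((steps (arc_of p ` {m..<m + k}))\<inverse>)"
proof
  assume wf: "wf (end_rel p)"
  have "wf ((steps (arc_of p ` J))\<inverse>)" if J: "layer J" for J
  proof -
    let ?R = "(steps (arc_of p ` J))\<inverse>"
    have J': "j < m + k" if "j \<in> J" for j using layerD(1)[OF J] that by auto
    have pred: "\<exists>j\<in>J. v = vtx j \<and> v' = fst (opp (arc_of p j))" if "(v', v) \<in> ?R" for v v'
      using that incident_arc_of(3)[OF p J'] by (auto elim!: stepsE)
    have inner: "j \<in> J \<longrightarrow> vtx j \<in> Wellfounded.acc ?R" for j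
      using wf
    proof (induction j rule: wf_induct_rule)
      case (less j)
      show ?case
      proof
        assume j: "j \<in> J"
        show "vtx j \<in> Wellfounded.acc ?R"
        proof (rule accI)
          fix v' assume v': "(v', vtx j) \<in> ?R"
          then obtain i where i: "i \<in> J" "vtx j = vtx i" "v' = fst (opp (arc_of p i))" using pred by blast
          then have "i = j" using vtx_eq_iff J' layerD(2)[OF J] j by metis
          show "v' \<in> Wellfounded.acc ?R"
          proof (cases "v' \<in> vtx ` J")
            case True
            then obtain j' where j': "j' \<in> J" "v' = vtx j'" by blast
            have "j' \<noteq> j" using incident_arc_of(4)[OF p J'[OF j]] i(3) \<open>i = j\<close> j'(2) by metis
            then have "(j', j) \<in> end_rel p"
              using incidence_other_end[OF p J'[OF j] J'[OF j'(1)]] J'[OF j] J'[OF j'(1)] i(3) \<open>i = j\<close>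
                layerD(2)[OF J j J'[OF j'(1)]] j' by (simp add: end_rel_def)
            then show ?thesis using less.IH j' by simp
          next
            case False
            then have "(u, v') \<notin> ?R" for u using pred by blast
            then show ?thesis by (meson accI)
          qed
        qed
      qed
    qed
    have "v \<in> Wellfounded.acc ?R" for v
    proof (cases "v \<in> vtx ` J")
      case False
      then have "(u, v) \<notin> ?R" for u using pred by blast
      then show ?thesis by (meson accI)
    qed (use inner in blast)
    then show ?thesis by (simp add: wf_iff_acc)
  qed
  then show "wf ((steps (arc_of p ` {..<m}))\<inverse>) \<and> wf ((steps (arc_of p ` {m..<m + k}))\<inverse>)"
    using layers by blast
next
  assume wfs: "wf ((steps (arc_of p ` {..<m}))\<inverse>) \<and> wf ((steps (arc_of p ` {m..<m + k}))\<inverse>)"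
  have inner: "\<forall>j\<in>J. vtx j = v \<longrightarrow> j \<in> Wellfounded.acc (end_rel p)"
    if J: "layer J" and wf: "wf ((steps (arc_of p ` J))\<inverse>)" for J v
    using wf
  proof (induction v rule: wf_induct_rule)
    case (less v)
    show ?case
    proof (intro ballI impI, rule accI)
      fix j j' assume j: "j \<in> J" "vtx j = v" and j': "(j', j) \<in> end_rel p"
      have jn: "j < m + k" "j' < m + k" "j' \<noteq> j" "j < m \<longleftrightarrow> j' < m" "I (p j) j' \<noteq> 0" 
        using end_relD[OF j'] by blast+
      have "j' \<in> J" using layerD(2)[OF J j(1) jn(2)] jn by simp
      have "fst (opp (arc_of p j)) = vtx j'" using incidence_other_end[OF p] jn by blast
      then have "(vtx j', v) \<in> (steps (arc_of p ` J))\<inverse>"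
        using stepsI[OF imageI[OF j(1)], of "arc_of p"] incident_arc_of(3)[OF p jn(1)] j(2) by simp
      then show "j' \<in> Wellfounded.acc (end_rel p)" using less.IH \<open>j' \<in> J\<close> by blast
    qed
  qed
  have "j \<in> Wellfounded.acc (end_rel p)" for j
  proof -
    consider "j \<in> {..<m}" | "j \<in> {m..<m + k}" | "j \<ge> m + k" by fastforce
    then show ?thesis
    proof cases
      case 3
      then have "(i, j) \<notin> end_rel p" for i by (auto simp: end_rel_def)
      then show ?thesis by (meson accI)
    qed (use inner[OF layers(1)] inner[OF layers(2)] wfs in blast)+
  qed
  then show "wf (end_rel p)" by (simp add: wf_iff_acc)
qed

section \<open>Good permutations as pairs of a tree and a forest\<close>

definition pair_of :: "(nat \<Rightarrow> nat) \<Rightarrow> ('a \<times> 'a) set \<times> ('a \<times> 'a) set" where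
  "pair_of p = (arc_of p ` {..<m}, arc_of p ` {m..<m + k})"

abbreviation "pairs \<equiv> tree_forest_pairs Q rot Bt br B"

lemma pair_of_mem:
  assumes "p \<in> good"
  shows "pair_of p \<in> pairs"
proof -
  have p: "incident p" "wf (end_rel p)" using assms by (auto simp: good_def)
  note wfs = wf_end_rel_iff[OF p(1), THEN iffD1, OF p(2)]
  note ch = choice_arcs[OF p(1) layers(1)] choice_arcs[OF p(1) layers(2)]
  have "rooted_spanning_tree H opp br (arc_of p ` {..<m})"
    by (rule choice_spanning_tree[OF ch(1)]) (use wfs roots in \<open>auto simp: ch(2) vtx_image\<close>)
  moreover have "rooted_spanning_forest H opp (Bt \<union> {br} - B) (arc_of p ` {m..<m + k})"
    using choice_spanning_forest[OF ch(3)] wfs unfolding ch(4) vtx_image by blast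
  moreover have "lf ` arc_of p ` {..<m} \<inter> lf ` arc_of p ` {m..<m + k} = {}"
    using arc_of_inj[OF p(1)] by fastforce
  ultimately show ?thesis by (simp add: pair_of_def tree_forest_pairs_def)
qed

text \<open>A counting argument. Every vertex of \<open>Bt\<close> needs an outgoing arc in
  \<open>T\<close> and every vertex of \<open>B\<close> one in \<open>F\<close>, so there are at
  least \<open>m + k\<close> arcs; they cross distinct faces, of which there are only
  \<open>m + k\<close>. Equality everywhere makes the outgoing arcs unique and uses up all
  faces.\<close>

lemma pairs_structure:
  assumes "(T, F) \<in> pairs"
  shows "choice T" "fst ` T = Bt" "choice F" "fst ` F = B" "lf ` T \<union> lf ` F = faces Q rot" "lf ` T \<inter> lf ` F = {}"
    "inj_on lf T" "inj_on lf F" "wf ((steps T)\<inverse>)" "wf ((steps F)\<inverse>)"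
proof -
  have T: "rooted_spanning_tree H opp br T" and F: "rooted_spanning_forest H opp (Bt \<union> {br} - B) F"
    and disj: "lf ` T \<inter> lf ` F = {}"
    using assms by (auto simp: tree_forest_pairs_def)
  have TA: "T \<subseteq> arcs H" "\<And>e. e \<in> T \<Longrightarrow> opp e \<notin> T" and FA: "F \<subseteq> arcs H" "\<And>e. e \<in> F \<Longrightarrow> opp e \<notin> F"
    using T F by (auto simp: rooted_spanning_tree_def rooted_spanning_forest_def oriented_forest_def)
  have Treach: "(v, br) \<in> (steps T)\<^sup>*" if "v \<in> Bt \<union> {br}" for v
    using T that unfolding rooted_spanning_tree_def reachable_iff[OF TA(1)] by simp
  have Freach: "\<exists>r\<in>Bt \<union> {br} - B. (v, r) \<in> (steps F)\<^sup>*" if "v \<in> Bt \<union> {br}" for v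
    using F that unfolding rooted_spanning_forest_def reachable_iff[OF FA(1)] by simp blast
  have BT: "Bt \<subseteq> fst ` T"
  proof
    fix v assume v: "v \<in> Bt"
    then have "v \<noteq> br" "(v, br) \<in> (steps T)\<^sup>*" using roots Treach by auto
    then obtain u where "(v, u) \<in> steps T" by (meson converse_rtranclE)
    then show "v \<in> fst ` T" by (auto elim!: stepsE)
  qed
  have BF: "B \<subseteq> fst ` F"
  proof
    fix v assume v: "v \<in> B"
    then obtain r where "r \<noteq> v" "(v, r) \<in> (steps F)\<^sup>*" using B Freach[of v] by (metis DiffE UnI1 subsetD)
    then obtain u where "(v, u) \<in> steps F" by (metis converse_rtranclE)
    then show "v \<in> fst ` F" by (auto elim!: stepsE)
  qed
  have inj: "inj_on lf A" if "A \<subseteq> arcs H" "\<And>e. e \<in> A \<Longrightarrow> opp e \<notin> A" for A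
  proof (rule inj_onI)
    fix x y assume xy: "x \<in> A" "y \<in> A" "lf x = lf y"
    then have "x \<in> parcs Q" "y \<in> parcs Q" "fst x \<in> Bt \<union> {br}" "fst y \<in> Bt \<union> {br}" using that(1) by auto
    then have "y = x \<or> y = opp x" using lf_eq_black xy(3) by blast
    then show "x = y" using that(2)[OF xy(1)] xy(2) by auto
  qed
  show injs: "inj_on lf T" "inj_on lf F" using inj TA FA by blast+
  have fin: "finite T" "finite F" using TA(1) FA(1) by (auto intro: finite_subset[OF _ finite_darts])
  have subf: "lf ` T \<union> lf ` F \<subseteq> faces Q rot" using TA(1) FA(1) by (auto simp: faces_def)
  have card_faces': "card (faces Q rot) = m + k" using bij_betw_same_card[OF f] by simp
  have cards: "card Bt = m" "card B = k" using bij_betw_same_card[OF b] bij_betw_same_card[OF c] by simp_all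
  have "card T + card F = card (lf ` T \<union> lf ` F)"
    using card_image[OF injs(1)] card_image[OF injs(2)] fin disj by (simp add: card_Un_disjoint)
  also have "\<dots> \<le> m + k" using card_mono[OF finite_faces subf] card_faces' by simp
  finally have le: "card T + card F \<le> m + k" .
  have ge: "m \<le> card (fst ` T)" "card (fst ` T) \<le> card T" "k \<le> card (fst ` F)" "card (fst ` F) \<le> card F"
    using card_mono[OF finite_imageI[OF fin(1)] BT] card_mono[OF finite_imageI[OF fin(2)] BF] cards
      card_image_le[OF fin(1), of fst] card_image_le[OF fin(2), of fst] by auto
  have eqT: "card (fst ` T) = card T" "card (fst ` T) = m" and eqF: "card (fst ` F) = card F" "card (fst ` F) = k"
    using le ge by auto
  show T1: "fst ` T = Bt" using card_subset_eq[OF finite_imageI[OF fin(1)] BT] eqT cards by simp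
  show F1: "fst ` F = B" using card_subset_eq[OF finite_imageI[OF fin(2)] BF] eqF cards by simp
  show chT: "choice T" "choice F"
    using TA FA eq_card_imp_inj_on[OF fin(1) eqT(1)] eq_card_imp_inj_on[OF fin(2) eqF(1)] unfolding choice_def by blast+
  show "lf ` T \<union> lf ` F = faces Q rot"
    using card_subset_eq[OF finite_faces subf] \<open>card T + card F = _\<close> eqT eqF card_faces' by simp
  show "lf ` T \<inter> lf ` F = {}" by (rule disj)
  show "wf ((steps T)\<inverse>)"
    unfolding choice_wf_iff[OF chT(1)] T1 using Treach roots by blast
  show "wf ((steps F)\<inverse>)"
    unfolding choice_wf_iff[OF chT(2)] F1 using Freach by blast
qed

lemma pair_of_inj: "inj_on pair_of good"
proof (rule inj_onI)
  fix p q assume pq: "p \<in> good" "q \<in> good" "pair_of p = pair_of q"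
  then have t: "incident p" "incident q" by (auto simp: good_def)
  have eq: "arc_of p ` J = arc_of q ` J" if "layer J" for J using pq(3) that by (auto simp: pair_of_def layer_def)
  have "p j = q j" if j: "j < m + k" for j
  proof -
    obtain J where J: "layer J" "j \<in> J"
      using that[OF layers(1)] that[OF layers(2)] j by (cases "j < m") simp_all
    then obtain i where i: "i \<in> J" "arc_of p j = arc_of q i" using eq[OF J(1)] by blast
    have "i < m + k" using i layerD(1)[OF J(1)] by auto
    have "vtx j = vtx i" using incident_arc_of(3)[OF t(1) j] incident_arc_of(3)[OF t(2) \<open>i < m + k\<close>] i by simp
    then have "i = j" using vtx_eq_iff[OF \<open>i < m + k\<close> j] layerD(2)[OF J(1) i(1) j] J(2) by simp
    then have "f (p j) = f (q j)" using incident_arc_of(2)[OF t(1) j] incident_arc_of(2)[OF t(2) j] i by simp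
    then show ?thesis using f_eq_iff perm_less t j by (simp add: incident_def)
  qed
  moreover have "p j = q j" if "\<not> j < m + k" for j
    using t that by (metis atLeastLessThan_iff permutes_not_in incident_def)
  ultimately show "p = q" by blast
qed

lemma pair_of_surj:
  assumes TF: "(T, F) \<in> pairs"
  shows "(T, F) \<in> pair_of ` good"
proof -
  note st = pairs_structure[OF TF]
  define oa where "oa j = inv_into (if j < m then T else F) fst (vtx j)" for j
  have inj: "inj_on fst T" "inj_on fst F" "T \<subseteq> arcs H" "F \<subseteq> arcs H"
    using st(1,3) unfolding choice_def by blast+
  have bT: "bij_betw oa {..<m} T"
  proof -
    have "bij_betw (inv_into T fst) Bt T" using inj(1) st(2) by (intro bij_betw_inv_into) (simp add: bij_betw_def)
    moreover have "bij_betw vtx {..<m} Bt" using vtx_image(1) vtx_eq_iff by (auto simp: bij_betw_def inj_on_def)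
    ultimately have "bij_betw (inv_into T fst \<circ> vtx) {..<m} T" by (rule bij_betw_trans[rotated])
    then show ?thesis by (rule bij_betw_cong[THEN iffD1, rotated]) (simp add: oa_def)
  qed
  have bF: "bij_betw oa {m..<m + k} F"
  proof -
    have "bij_betw (inv_into F fst) B F" using inj(2) st(4) by (intro bij_betw_inv_into) (simp add: bij_betw_def)
    moreover have "bij_betw vtx {m..<m + k} B" using vtx_image(2) vtx_eq_iff by (auto simp: bij_betw_def inj_on_def)
    ultimately have "bij_betw (inv_into F fst \<circ> vtx) {m..<m + k} F" by (rule bij_betw_trans[rotated])
    then show ?thesis by (rule bij_betw_cong[THEN iffD1, rotated]) (simp add: oa_def)
  qed
  have un: "{..<m} \<union> {m..<m + k} = {..<m + k}" by auto
  have blf: "bij_betw (lf \<circ> oa) {..<m + k} (faces Q rot)"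
    unfolding un[symmetric] st(5)[symmetric]
    by (rule bij_betw_combine[OF bij_betw_trans[OF bT] bij_betw_trans[OF bF] st(6)])
      (use st(7,8) in \<open>auto simp: bij_betw_def\<close>)
  define p where "p j = (if j < m + k then inv_into {..<m + k} f (lf (oa j)) else j)" for j
  have "bij_betw (inv_into {..<m + k} f \<circ> (lf \<circ> oa)) {..<m + k} {..<m + k}"
    by (rule bij_betw_trans[OF blf bij_betw_inv_into[OF f]])
  then have "bij_betw p {0..<m + k} {0..<m + k}"
    unfolding atLeast0LessThan by (rule bij_betw_cong[THEN iffD1, rotated]) (simp add: p_def)
  then have perm: "p permutes {0..<m + k}" by (rule bij_imp_permutes) (simp add: p_def)
  have props: "oa j \<in> parcs Q" "lf (oa j) = f (p j)" "fst (oa j) = vtx j" "fst (opp (oa j)) \<noteq> vtx j" if j: "j < m + k" for j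
  proof -
    have "oa j \<in> T \<or> oa j \<in> F" using bT bF j by (cases "j < m") (auto simp: bij_betw_def)
    then show P: "oa j \<in> parcs Q" using inj(3,4) by auto
    have "lf (oa j) \<in> f ` {..<m + k}" using f P by (auto simp: bij_betw_def faces_def)
    then show "lf (oa j) = f (p j)" using j by (simp add: p_def f_inv_into_f)
    show fst: "fst (oa j) = vtx j"
    proof (cases "j < m")
      case True
      then have "vtx j \<in> fst ` T" using vtx_image(1) st(2) by auto
      then show ?thesis using True by (simp add: oa_def f_inv_into_f)
    next
      case False
      then have "vtx j \<in> fst ` F" using vtx_image(2) st(4) j by auto
      then show ?thesis using False by (simp add: oa_def f_inv_into_f)
    qed
    \<comment> \<open>A loop would be a cycle in a well-founded relation.\<close>
    show "fst (opp (oa j)) \<noteq> vtx j"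
    proof
      assume "fst (opp (oa j)) = vtx j"
      then have "(vtx j, vtx j) \<in> (steps T)\<inverse> \<or> (vtx j, vtx j) \<in> (steps F)\<inverse>"
        using \<open>oa j \<in> T \<or> oa j \<in> F\<close> stepsI fst by blast
      then show False using wf_not_refl[OF st(9)] wf_not_refl[OF st(10)] by (elim disjE) simp_all
    qed
  qed
  have "I (p j) j \<noteq> 0" if j: "j < m + k" for j
    using incidence_same_colour[of "oa j" "vtx j"] props[OF j] sign_pm[OF props(1)[OF j]] vtx_colour[OF j]
    unfolding props(2)[OF j, symmetric] by auto
  then have t: "incident p" using perm by (simp add: incident_def)
  have arcs: "arc_of p j = oa j" if j: "j < m + k" for j
    using arc_of_eqI props[OF j] j by blast
  have "arc_of p ` {..<m} = T" "arc_of p ` {m..<m + k} = F"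
    using bT bF arcs by (auto simp: bij_betw_def)
  moreover from this have "wf (end_rel p)" using wf_end_rel_iff[OF t] st(9,10) by simp
  ultimately show ?thesis using t by (force simp: good_def pair_of_def)
qed

lemma bij_pair_of: "bij_betw pair_of good pairs"
  unfolding bij_betw_def using pair_of_inj pair_of_mem pair_of_surj by auto

end

section \<open>Potentials of flows\<close>

text \<open>Partial sums along the cycle starting at \<open>x\<close>; the vanishing total makes
  them consistent when the cycle closes.\<close>

lemma cyclic_potential:
  fixes z :: "'b \<Rightarrow> int"
  assumes p: "permutation p" and zero: "(\<Sum>y\<in>orbit p x. z y) = 0"
  shows "\<exists>h. \<forall>y\<in>orbit p x. h (p y) - h y = z (p y)"
proof -
  let ?X = "orbit p x"
  have self: "x \<in> ?X" using permutation_self_in_orbit[OF p] .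
  define N where "N = funpow_dist1 p x x"
  have N: "N > 0" "(p ^^ N) x = x" using funpow_dist1_prop[OF self] by (simp_all add: N_def)
  have X: "?X = (\<lambda>n. (p ^^ n) x) ` {0..<N}" and inj: "inj_on (\<lambda>n. (p ^^ n) x) {0..<N}"
    using orbit_conv_funpow_dist1[OF self] inj_on_funpow_dist1[OF self] by (simp_all add: N_def)
  define idx where "idx = the_inv_into {0..<N} (\<lambda>n. (p ^^ n) x)"
  have idx: "idx ((p ^^ n) x) = n" if "n < N" for n
    unfolding idx_def using the_inv_into_f_f[OF inj] that by simp
  \<comment> \<open>The term at the endpoint is included, so that the increment from
    \<open>y\<close> to \<open>p y\<close> is \<open>z (p y)\<close> and not
    \<open>z y\<close>.\<close>
  define h where "h y = (\<Sum>i\<le>idx y. z ((p ^^ i) x))" for y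
  have total: "(\<Sum>i<N. z ((p ^^ i) x)) = 0"
    using zero unfolding X by (subst (asm) sum.reindex[OF inj]) (simp add: atLeast0LessThan)
  have "h (p y) - h y = z (p y)" if y: "y \<in> ?X" for y
  proof -
    obtain n where n: "n < N" "y = (p ^^ n) x" using y unfolding X by auto
    have py: "p y = (p ^^ Suc n) x" using n by simp
    show ?thesis
    proof (cases "Suc n < N")
      case True
      have "h (p y) = (\<Sum>i\<le>Suc n. z ((p ^^ i) x))" unfolding h_def py idx[OF True] ..
      moreover have "h y = (\<Sum>i\<le>n. z ((p ^^ i) x))" unfolding h_def n(2) idx[OF n(1)] ..
      ultimately show ?thesis using py by simp
    next
      case False
      then have sn: "Suc n = N" using n by simp
      then have "p y = (p ^^ 0) x" using py N by simp
      then have "h (p y) = z (p y)" unfolding h_def using idx[of 0] N by simp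
      moreover have "h y = (\<Sum>i<N. z ((p ^^ i) x))"
        unfolding h_def n(2) idx[OF n(1)] sn[symmetric] by (simp add: lessThan_Suc_atMost)
      ultimately show ?thesis using total by simp
    qed
  qed
  then show ?thesis by blast
qed

context rooted_quadrangulation
begin

text \<open>
  A potential exists around every white vertex; the local potentials differ on the two white
  corners of a face by a cocycle of the black graph, hence by the coboundary of a function on the
  white vertices.
\<close>

lemma flow_potential:
  fixes z :: "'v \<times> 'v \<Rightarrow> int"
  assumes white: "\<And>u. u \<in> W \<union> {wr} \<Longrightarrow> (\<Sum>d | d \<in> parcs Q \<and> fst d = u. z d) = 0"
    and black: "\<And>v. v \<in> Bt \<Longrightarrow> (\<Sum>d | d \<in> parcs Q \<and> fst d = v. z (prod.swap d)) = 0"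
  obtains \<chi> :: "('v \<times> 'v) set \<Rightarrow> int"
    where "\<And>d. d \<in> parcs Q \<Longrightarrow> fst d \<in> W \<union> {wr} \<Longrightarrow> \<chi> (lf d) - \<chi> (lf (prod.swap d)) = z d"
proof -
  interpret sw: bicoloured_quadrangulation Q rot "Bt \<union> {br}" "W \<union> {wr}" by (rule swap_colours)
  have "\<exists>h. \<forall>d. d \<in> parcs Q \<and> fst d = u \<longrightarrow> h (rot d) - h d = z (rot d)" if u: "u \<in> W \<union> {wr}" for u
  proof -
    obtain d where d: "d \<in> parcs Q" "fst d = u" using ex_dart u white_mem by blast
    have "orbit rot d = {e. e \<in> parcs Q \<and> fst e = u}" using orbit_rot[OF d(1)] d(2) by simp
    then show ?thesis using cyclic_potential[OF permutation_rot, where x = d and z = z] white[OF u] by simp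
  qed
  then obtain h0 where h0: "\<And>u d. u \<in> W \<union> {wr} \<Longrightarrow> d \<in> parcs Q \<Longrightarrow> fst d = u \<Longrightarrow> h0 u (rot d) - h0 u d = z (rot d)"
    by metis
  define h where "h d = h0 (fst d) d" for d
  have h: "h d - h (rot_inv d) = z d" if "d \<in> parcs Q" "fst d \<in> W \<union> {wr}" for d
    using h0[of "fst d" "rot_inv d"] that by (simp add: h_def)
  define wd where "wd x = (SOME d. d \<in> parcs Q \<and> fst d \<in> W \<union> {wr} \<and> lf d = x)" for x
  have wd: "wd (lf d) = d \<or> wd (lf d) = opp d" if d: "d \<in> parcs Q" "fst d \<in> W \<union> {wr}" for d
  proof -
    have "wd (lf d) \<in> parcs Q \<and> fst (wd (lf d)) \<in> W \<union> {wr} \<and> lf (wd (lf d)) = lf d"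
      unfolding wd_def by (rule someI[of _ d]) (use d in simp)
    then show ?thesis using sw.lf_eq_black[of d "wd (lf d)"] d by simp
  qed
  \<comment> \<open>The sign makes this discrepancy of the local potentials independent of which of
    the two white corners \<open>wd\<close> selects.\<close>
  define x where "x y = s (wd y) * (h (opp (wd y)) - h (wd y))" for y
  have x: "x (lf d) = s d * (h (opp d) - h d)" if "d \<in> parcs Q" "fst d \<in> W \<union> {wr}" for d
    using wd[OF that] that sign_opp[of d] by (auto simp: x_def algebra_simps)
  have orth: "(\<Sum>y\<in>faces Q rot. incidence s y v * x y) = 0" if v: "v \<in> Bt" for v
  proof -
    let ?D = "{e. e \<in> parcs Q \<and> fst e = v}"
    have "(\<Sum>y\<in>faces Q rot. incidence s y v * x y) = (\<Sum>e\<in>?D. s e * x (lf e))"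
      using sum_incidence[of v x] by simp
    also have "\<dots> = (\<Sum>e\<in>?D. h (prod.swap (rot e)) - h (prod.swap e) + z (prod.swap e))"
    proof (rule sum.cong[OF refl])
      fix e assume "e \<in> ?D"
      then have e: "e \<in> parcs Q" "fst e \<in> Bt \<union> {br}" using v by auto
      have we: "fst (fs e) \<in> W \<union> {wr}" "fst (prod.swap e) \<in> W \<union> {wr}"
        using white_fs[OF e(1)] dart_colours(2)[OF e(1)] e(2) by auto
      have op: "opp (fs e) = prod.swap (rot e)" using fs_opp[OF e(1)] by (simp add: opposite_def)
      have "x (lf e) = s e * (h (prod.swap (rot e)) - h (fs e))"
        using x[of "fs e"] we e sign_fs_black[OF e] by (simp add: op)
      moreover have "h (fs e) = h (prod.swap e) - z (prod.swap e)"
        using h[of "prod.swap e"] e we by (simp add: face_succ_def)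
      ultimately show "s e * x (lf e) = h (prod.swap (rot e)) - h (prod.swap e) + z (prod.swap e)"
        using sign_sq[OF e(1)] by (simp add: mult.assoc[symmetric])
    qed
    \<comment> \<open>Around a black vertex the two sums of \<open>h\<close> agree after one
      rotation step, and the remaining sum is the total flow at that vertex.\<close>
    also have "\<dots> = (\<Sum>e\<in>?D. h (prod.swap (rot e))) - (\<Sum>e\<in>?D. h (prod.swap e)) + (\<Sum>e\<in>?D. z (prod.swap e))"
      by (simp add: sum.distrib sum_subtractf)
    also have "(\<Sum>e\<in>?D. h (prod.swap (rot e))) = (\<Sum>e\<in>?D. h (prod.swap e))"
      by (rule sum.reindex_bij_witness[of _ "rot_inv" rot]) auto
    finally show ?thesis using black[OF v] by simp
  qed
  obtain y where y: "y wr = 0" "\<And>t. t \<in> faces Q rot \<Longrightarrow> x t = (\<Sum>u\<in>W. incidence s t u * y u)"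
    using black_orthogonal_imp_white_coboundary[of x] orth by blast
  have same: "y (fst d) + h d = y (fst (opp d)) + h (opp d)" if d: "d \<in> parcs Q" "fst d \<in> W \<union> {wr}" for d
  proof -
    have "s d * (h (opp d) - h d) = s d * (y (fst d) - y (fst (opp d)))"
      unfolding x[OF d, symmetric] sum_white_incidence[of d y, OF d y(1), symmetric]
      using d by (intro y(2)) (simp add: faces_def)
    then show ?thesis using sign_pm[OF d(1)] by auto
  qed
  \<comment> \<open>By \<open>same\<close> the corrected potential takes equal values at both white
    corners of a face, so it is a function of the face.\<close>
  define \<chi> where "\<chi> t = y (fst (wd t)) + h (wd t)" for t
  have \<chi>: "\<chi> (lf d) = y (fst d) + h d" if "d \<in> parcs Q" "fst d \<in> W \<union> {wr}" for d
    using wd[OF that] same[OF that] by (auto simp: \<chi>_def)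
  show ?thesis
  proof (rule that)
    fix d assume d: "d \<in> parcs Q" "fst d \<in> W \<union> {wr}"
    then have "\<chi> (lf (prod.swap d)) = y (fst d) + h (rot_inv d)"
      using \<chi>[of "rot_inv d"] lf_swap[OF d(1)] by simp
    then show "\<chi> (lf d) - \<chi> (lf (prod.swap d)) = z d" using \<chi>[OF d] h[OF d] by simp
  qed
qed

end

section \<open>Faces of a subgraph\<close>

context bicoloured_quadrangulation
begin

text \<open>Undoing the reversal inside \<open>subgraph_face_succ\<close> leaves the clockwise
  first-return map to \<open>E\<close>, whose orbits are the stars of the subgraph.\<close>

definition sub_turn :: "('v \<times> 'v) set \<Rightarrow> 'v \<times> 'v \<Rightarrow> 'v \<times> 'v" where
  "sub_turn E d = subgraph_face_succ rot E (prod.swap d)"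

lemma subgraph_face_succ_eq: "subgraph_face_succ rot E d = sub_turn E (prod.swap d)"
  by (simp add: sub_turn_def)

lemma sub_turn_return:
  assumes "d \<in> E"
  shows "sub_turn E d \<in> E \<and> (\<exists>n>0. sub_turn E d = (rot_inv ^^ n) d \<and>
    (\<forall>i. 0 < i \<and> i < n \<longrightarrow> (rot_inv ^^ i) d \<notin> E))"
proof -
  let ?p = "rot_inv" and ?P = "\<lambda>n. 0 < n \<and> (rot_inv ^^ n) d \<in> E"
  have "\<exists>n. ?P n"
    using permutation_self[OF permutation_inverse[OF permutation_rot], of d] assms by metis
  then have "?P (LEAST n. ?P n)" by (rule LeastI_ex)
  moreover have "(?p ^^ i) d \<notin> E" if "0 < i" "i < (LEAST n. ?P n)" for i
    using not_less_Least[OF that(2)] that(1) by blast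
  ultimately show ?thesis unfolding sub_turn_def subgraph_face_succ_def by auto
qed

context
  fixes E :: "('v \<times> 'v) set"
  assumes E: "E \<subseteq> parcs Q"
begin

lemma sub_turn_mem: "d \<in> E \<Longrightarrow> sub_turn E d \<in> E"
  using sub_turn_return by blast

lemma orbit_sub_turn: "d \<in> E \<Longrightarrow> orbit (sub_turn E) d = {e \<in> E. fst e = fst d}"
proof -
  assume d: "d \<in> E"
  have "orbit (sub_turn E) d = orbit (rot_inv) d \<inter> E"
    by (rule orbit_first_return[OF d sub_turn_return])
  also have "orbit (rot_inv) d = {e \<in> parcs Q. fst e = fst d}"
    using orbit_inv_eq[OF permutation_rot] orbit_rot[of d] d E by blast
  finally show ?thesis using E by auto
qed

lemma fst_sub_turn: "d \<in> E \<Longrightarrow> fst (sub_turn E d) = fst d"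
  using orbit_sub_turn[of d] orbit.base[of "sub_turn E" d] by simp

lemma bij_sub_turn: "bij_betw (sub_turn E) E E"
proof -
  have fin: "finite E" using E finite_subset finite_darts by blast
  have "E \<subseteq> sub_turn E ` E"
  proof
    fix e assume e: "e \<in> E"
    then have "e \<in> orbit (sub_turn E) e" using orbit_sub_turn by simp
    then show "e \<in> sub_turn E ` E"
      by (cases rule: orbit.cases) (use e orbit_sub_turn[OF e] in auto)
  qed
  then have "sub_turn E ` E = E" using sub_turn_mem by blast
  then show ?thesis using fin by (simp add: bij_betw_def eq_card_imp_inj_on)
qed

text \<open>
  \<open>inside\<close> stands for a union of faces whose boundary only consists of darts of \<open>E\<close>, so that
  turning past darts outside of \<open>E\<close> does not leave it.
\<close>

lemma face_succ_inside:
  assumes d: "prod.swap d \<in> E"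
    and inv: "\<And>e. e \<in> parcs Q \<Longrightarrow> e \<notin> E \<Longrightarrow> inside (lf e) = inside (lf (prod.swap e))"
  shows "inside (lf (subgraph_face_succ rot E d)) = inside (lf d)"
proof -
  let ?p = "rot_inv"
  obtain n where n: "n > 0" "sub_turn E (prod.swap d) = (?p ^^ n) (prod.swap d)"
    "\<And>i. 0 < i \<Longrightarrow> i < n \<Longrightarrow> (?p ^^ i) (prod.swap d) \<notin> E"
    using sub_turn_return[OF d] by blast
  have P: "(?p ^^ i) (prod.swap d) \<in> parcs Q" for i using d E by (induction i) auto
  have "inside (lf ((?p ^^ Suc i) (prod.swap d))) = inside (lf d)" if "i < n" for i
    using that
  proof (induction i)
    case 0
    then show ?case using lf_swap[of "prod.swap d"] P[of 0] by simp
  next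
    case (Suc i)
    let ?y = "(?p ^^ Suc i) (prod.swap d)"
    have "inside (lf (?p ?y)) = inside (lf (prod.swap ?y))" using lf_swap[OF P] by metis
    also have "\<dots> = inside (lf ?y)" by (rule inv[OF P n(3)[OF zero_less_Suc Suc.prems], symmetric])
    finally show ?case using Suc by simp
  qed
  then show ?thesis using n unfolding subgraph_face_succ_eq by (cases n) auto
qed

end

end

section \<open>Kasteleyn signs around an alternating cycle\<close>

lemma prod_orbits:
  assumes "finite A" "p permutes A"
  shows "(\<Prod>U\<in>orbit p ` A. \<Prod>d\<in>U. h d) = (\<Prod>d\<in>A. h d)"
proof -
  have perm: "permutation p" using assms permutation_permutes by blast
  have "(\<Prod>U\<in>orbit p ` A. \<Prod>d\<in>U. h d) = (\<Prod>U\<in>orbit p ` A. \<Prod>d\<in>{d \<in> A. orbit p d = U}. h d)"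
  proof (rule prod.cong[OF refl])
    fix U assume "U \<in> orbit p ` A"
    then obtain a where a: "a \<in> A" "U = orbit p a" by blast
    have "U = {d \<in> A. orbit p d = U}"
      using a permutes_orbit_subset[OF assms(2) a(1)] orbit_eq_if_mem[OF perm] permutation_self_in_orbit[OF perm] by blast
    then show "(\<Prod>d\<in>U. h d) = (\<Prod>d\<in>{d \<in> A. orbit p d = U}. h d)" by simp
  qed
  also have "\<dots> = (\<Prod>d\<in>A. h d)" using assms(1) by (intro prod.group) auto
  finally show ?thesis .
qed

lemma mem_swap_image: "d \<in> prod.swap ` S \<longleftrightarrow> prod.swap d \<in> S"
  by (metis image_iff swap_swap)

text \<open>Here \<open>\<sigma>\<close> and \<open>\<sigma> \<circ> \<rho>\<close> describe two
  matchings, and the orbit of \<open>x\<close> under \<open>\<rho>\<close> runs through the white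
  vertices of one cycle of their superposition.\<close>

locale alternating_cycle = forest_quadrangulation +
  fixes \<phi> :: "'a \<times> 'a \<Rightarrow> int" and \<sigma> \<rho> :: "nat \<Rightarrow> nat" and x :: nat
  assumes kast: "kasteleyn_orientation Q rot wr W G \<phi>"
    and sigma: "\<sigma> permutes {0..<k}" and rho: "\<rho> permutes {0..<k}"
    and x: "x < k" "\<rho> x \<noteq> x"
    and edges: "\<And>i. i < k \<Longrightarrow> (w i, c (\<sigma> i)) \<in> parcs Q" "\<And>i. i < k \<Longrightarrow> (w i, c (\<sigma> (\<rho> i))) \<in> parcs Q"
begin

definition E :: "('a \<times> 'a) set" where "E = {d \<in> parcs Q. fst d \<in> W \<union> B \<and> snd d \<in> W \<union> B}"
definition X :: "nat set" where "X = orbit \<rho> x"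
definition e1 :: "nat \<Rightarrow> 'a \<times> 'a" where "e1 i = (w i, c (\<sigma> i))"
definition e2 :: "nat \<Rightarrow> 'a \<times> 'a" where "e2 i = (w i, c (\<sigma> (\<rho> i)))"
definition Cu :: "('a \<times> 'a) set" where "Cu = e1 ` X \<union> e2 ` X"
definition Cy :: "('a \<times> 'a) set" where "Cy = Cu \<union> prod.swap ` Cu"
definition VC :: "'a set" where "VC = w ` X \<union> (\<lambda>i. c (\<sigma> i)) ` X"

lemma permutation_rho: "permutation \<rho>"
  using rho permutation_permutes finite_atLeastLessThan by blast

lemma x_mem: "x \<in> X"
  unfolding X_def by (rule permutation_self_in_orbit[OF permutation_rho])

lemma X_less: "i \<in> X \<Longrightarrow> i < k"
  using permutes_orbit_subset[OF rho, of x] x(1) by (auto simp: X_def)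

lemma X_subset: "X \<subseteq> {..<k}"
  using X_less by blast

lemma finite_X [simp]: "finite X"
  using X_subset finite_subset by blast

lemma orbit_X: "i \<in> X \<Longrightarrow> orbit \<rho> i = X"
  unfolding X_def by (rule orbit_eq_if_mem[OF permutation_rho])

lemma rho_mem: "i \<in> X \<Longrightarrow> \<rho> i \<in> X"
  using orbit_X orbit.base by metis

lemma rho_neq: "i \<in> X \<Longrightarrow> \<rho> i \<noteq> i"
proof
  assume i: "i \<in> X" "\<rho> i = i"
  then have "X = {i}" using orbit_X orbit_eq_singleton_iff by metis
  then show False using x_mem x(2) i by auto
qed

lemma rho_image: "\<rho> ` X = X"
  using rho_mem inj_on_subset[OF permutes_inj[OF rho]] by (intro endo_inj_surj) auto

lemma sigma_less: "i < k \<Longrightarrow> \<sigma> i < k" and rho_less: "i < k \<Longrightarrow> \<rho> i < k"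
  using permutes_in_image[OF sigma] permutes_in_image[OF rho] by auto

lemma cs_eq_iff: "i < k \<Longrightarrow> j < k \<Longrightarrow> c (\<sigma> i) = c (\<sigma> j) \<longleftrightarrow> i = j"
  using c_eq_iff sigma_less inj_eq[OF permutes_inj[OF sigma]] by simp

lemma cs_mem: "i < k \<Longrightarrow> c (\<sigma> i) \<in> B"
  using c_mem sigma_less by simp

lemma ex_cs: "u \<in> B \<Longrightarrow> \<exists>i<k. u = c (\<sigma> i)"
proof -
  assume "u \<in> B"
  then obtain j where j: "j < k" "u = c j" using c by (auto simp: bij_betw_def)
  obtain i where "j = \<sigma> i" using permutes_surj[OF sigma] by blast
  then show ?thesis using j permutes_in_image[OF sigma, of i] by auto
qed

lemma E_subset: "E \<subseteq> parcs Q" by (auto simp: E_def)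

lemma E_swap: "prod.swap d \<in> E \<longleftrightarrow> d \<in> E" by (auto simp: E_def)

lemma arcs_G: "arcs G = E" "verts G = W \<union> B" by (auto simp: E_def)

lemma finite_E [simp]: "finite E" using E_subset finite_subset finite_darts by blast

lemma e1_E: "i < k \<Longrightarrow> e1 i \<in> E" and e2_E: "i < k \<Longrightarrow> e2 i \<in> E"
  using edges cs_mem rho_less w_mem by (simp_all add: e1_def e2_def E_def)

lemma e1_inj: "inj_on e1 {..<k}" and e2_inj: "inj_on e2 {..<k}"
  using w_eq_iff by (auto simp: inj_on_def e1_def e2_def)

lemma e1_neq_e2: "i \<in> X \<Longrightarrow> j \<in> X \<Longrightarrow> e1 i \<noteq> e2 j"
  using w_eq_iff[OF X_less X_less, of i j] cs_eq_iff[OF X_less X_less[OF rho_mem], of i j] rho_neq[of i]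
  by (auto simp: e1_def e2_def)

lemma Cu_E: "Cu \<subseteq> E" and Cy_E: "Cy \<subseteq> E"
proof -
  show "Cu \<subseteq> E" using e1_E e2_E X_less by (auto simp: Cu_def)
  then show "Cy \<subseteq> E" using E_swap unfolding Cy_def by blast
qed

lemma Cy_swap: "prod.swap d \<in> Cy \<longleftrightarrow> d \<in> Cy"
  by (auto simp: Cy_def mem_swap_image)

lemma Cu_white: "d \<in> Cu \<Longrightarrow> fst d \<in> W"
  using X_less w_mem by (auto simp: Cu_def e1_def e2_def)

lemma Cy_white: "d \<in> Cy \<Longrightarrow> fst d \<in> W \<longleftrightarrow> d \<in> Cu"
proof -
  assume d: "d \<in> Cy"
  have "snd d' \<in> B" if "d' \<in> Cu" for d' using that cs_mem X_less rho_less by (auto simp: Cu_def e1_def e2_def)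
  then show ?thesis using d Cu_white[of d] W_B unfolding Cy_def mem_swap_image Un_iff by (metis fst_swap snd_swap swap_swap)
qed

lemma Cu_ends: "d \<in> Cu \<Longrightarrow> fst d \<in> VC \<and> snd d \<in> VC"
  using rho_mem by (auto simp: Cu_def e1_def e2_def VC_def)

lemma Cy_ends: "d \<in> Cy \<Longrightarrow> fst d \<in> VC \<and> snd d \<in> VC"
  using Cu_ends[of d] Cu_ends[of "prod.swap d"] by (auto simp: Cy_def mem_swap_image)

lemma card_Cu: "card Cu = 2 * card X"
proof -
  have "card Cu = card (e1 ` X) + card (e2 ` X)"
    unfolding Cu_def using e1_neq_e2 by (intro card_Un_disjoint) fastforce+
  moreover have "inj_on e1 X" "inj_on e2 X"
    using inj_on_subset[OF e1_inj X_subset] inj_on_subset[OF e2_inj X_subset] by simp_all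
  ultimately show ?thesis by (simp add: card_image)
qed

lemma w_inj_X: "inj_on w X" and cs_inj_X: "inj_on (\<lambda>i. c (\<sigma> i)) X"
  using w_eq_iff cs_eq_iff X_less by (auto simp: inj_on_def)

lemma card_VC: "card VC = 2 * card X"
proof -
  have "card VC = card (w ` X) + card ((\<lambda>i. c (\<sigma> i)) ` X)"
    unfolding VC_def
  proof (rule card_Un_disjoint)
    have "w ` X \<subseteq> W" "(\<lambda>i. c (\<sigma> i)) ` X \<subseteq> B" using w_mem cs_mem X_less by auto
    then show "w ` X \<inter> (\<lambda>i. c (\<sigma> i)) ` X = {}" using W_B by blast
  qed simp_all
  then show ?thesis using w_inj_X cs_inj_X by (simp add: card_image)
qed

lemma VC_white: "VC \<inter> W = w ` X"
  using W_B w_mem cs_mem X_less by (auto simp: VC_def)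

subsection \<open>The region enclosed by the cycle\<close>

text \<open>The unit flow around the cycle, measured from white to black: it uses the edges of one
  matching forwards and those of the other backwards, so nothing accumulates at a vertex.\<close>

definition z :: "'a \<times> 'a \<Rightarrow> int" where
  "z d = (if d \<in> e1 ` X then 1 else 0) - (if d \<in> e2 ` X then 1 else 0)"

lemma z_out: "\<lbrakk>d \<notin> Cu\<rbrakk> \<Longrightarrow> z d = 0"
  by (auto simp: z_def Cu_def)

lemma z_odd: "d \<in> Cu \<Longrightarrow> odd (z d)"
  using e1_neq_e2 by (auto simp: z_def Cu_def)

lemma z_white: "(\<Sum>d | d \<in> parcs Q \<and> fst d = u. z d) = 0"
proof -
  have card: "(\<Sum>d | d \<in> parcs Q \<and> fst d = u. if d \<in> g ` X then 1 else (0::int)) = int (card {i \<in> X. w i = u})"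
    if g: "inj_on g X" "\<And>i. i \<in> X \<Longrightarrow> g i \<in> parcs Q \<and> fst (g i) = w i" for g
  proof -
    have "(\<Sum>d | d \<in> parcs Q \<and> fst d = u. if d \<in> g ` X then 1 else (0::int)) = int (card ({d. d \<in> parcs Q \<and> fst d = u} \<inter> g ` X))"
      by (subst sum.inter_restrict[symmetric]) simp_all
    also have "{d. d \<in> parcs Q \<and> fst d = u} \<inter> g ` X = g ` {i \<in> X. w i = u}" using g(2) by auto
    also have "card \<dots> = card {i \<in> X. w i = u}" using g(1) by (intro card_image) (auto simp: inj_on_def)
    finally show ?thesis .
  qed
  have "inj_on e1 X" "inj_on e2 X" using inj_on_subset[OF e1_inj X_subset] inj_on_subset[OF e2_inj X_subset] by simp_all
  moreover have "e1 i \<in> parcs Q \<and> fst (e1 i) = w i" "e2 i \<in> parcs Q \<and> fst (e2 i) = w i" if "i \<in> X" for i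
    using e1_E e2_E E_subset X_less[OF that] by (auto simp: e1_def e2_def)
  ultimately show ?thesis unfolding z_def sum_subtractf using card[of e1] card[of e2] by simp
qed

text \<open>At a black vertex of the cycle the edge \<open>e2 i\<close> of the second matching meets
  the edge \<open>e1 (\<rho> i)\<close> of the first, so \<open>\<rho>\<close> matches the two
  counts.\<close>

lemma z_black: "(\<Sum>d | d \<in> parcs Q \<and> fst d = v. z (prod.swap d)) = 0"
proof -
  have card: "(\<Sum>d | d \<in> parcs Q \<and> fst d = v. if prod.swap d \<in> g ` X then 1 else (0::int)) = int (card {i \<in> X. snd (g i) = v})"
    if g: "inj_on g X" "\<And>i. i \<in> X \<Longrightarrow> g i \<in> parcs Q" for g
  proof -
    have "(\<Sum>d | d \<in> parcs Q \<and> fst d = v. if prod.swap d \<in> g ` X then 1 else (0::int))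
        = (\<Sum>d | d \<in> parcs Q \<and> fst d = v. if d \<in> (prod.swap \<circ> g) ` X then 1 else 0)"
      by (simp only: image_comp[symmetric] mem_swap_image)
    also have "\<dots> = int (card ({d. d \<in> parcs Q \<and> fst d = v} \<inter> (prod.swap \<circ> g) ` X))"
      by (subst sum.inter_restrict[symmetric]) simp_all
    also have "{d. d \<in> parcs Q \<and> fst d = v} \<inter> (prod.swap \<circ> g) ` X = (prod.swap \<circ> g) ` {i \<in> X. snd (g i) = v}"
      using g(2) by auto
    also have "card \<dots> = card {i \<in> X. snd (g i) = v}"
      by (intro card_image comp_inj_on inj_on_subset[OF g(1)]) auto
    finally show ?thesis .
  qed
  have "inj_on e1 X" "inj_on e2 X" using inj_on_subset[OF e1_inj X_subset] inj_on_subset[OF e2_inj X_subset] by simp_all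
  moreover have "e1 i \<in> parcs Q" "e2 i \<in> parcs Q" if "i \<in> X" for i
    using e1_E e2_E E_subset X_less[OF that] by auto
  moreover have "card {i \<in> X. snd (e1 i) = v} = card {i \<in> X. snd (e2 i) = v}"
  proof -
    have "{i \<in> X. snd (e1 i) = v} = \<rho> ` {i \<in> X. snd (e2 i) = v}"
    proof
      show "\<rho> ` {i \<in> X. snd (e2 i) = v} \<subseteq> {i \<in> X. snd (e1 i) = v}" using rho_mem by (auto simp: e1_def e2_def)
      show "{i \<in> X. snd (e1 i) = v} \<subseteq> \<rho> ` {i \<in> X. snd (e2 i) = v}"
      proof
        fix i assume i: "i \<in> {i \<in> X. snd (e1 i) = v}"
        then obtain j where "j \<in> X" "i = \<rho> j" using rho_image by blast
        then show "i \<in> \<rho> ` {i \<in> X. snd (e2 i) = v}" using i by (auto simp: e1_def e2_def)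
      qed
    qed
    then show ?thesis using card_image[OF inj_on_subset[OF permutes_inj[OF rho] subset_UNIV]] by simp
  qed
  ultimately show ?thesis unfolding z_def sum_subtractf using card[of e1] card[of e2] by simp
qed

definition region :: "(('a \<times> 'a) set \<Rightarrow> bool) \<Rightarrow> bool" where
  "region R \<longleftrightarrow> (\<forall>d\<in>parcs Q. fst d = wr \<longrightarrow> \<not> R (lf d)) \<and>
     (\<forall>d\<in>parcs Q. (R (lf d) = R (lf (prod.swap d))) = (d \<notin> Cy))"

text \<open>The potential changes by an odd amount across the edges of the cycle and not at all
  across others, so the region is given by its parity relative to the faces at \<open>wr\<close>.
  These faces all have the same potential, since the cycle avoids \<open>wr\<close>.\<close>

lemma ex_region: "\<exists>R. region R"
proof -
  obtain \<chi> :: "('a \<times> 'a) set \<Rightarrow> int"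
    where \<chi>: "\<And>d. d \<in> parcs Q \<Longrightarrow> fst d \<in> W \<union> {wr} \<Longrightarrow> \<chi> (lf d) - \<chi> (lf (prod.swap d)) = z d"
    using flow_potential[of z] z_white z_black by blast
  obtain d0 where d0: "d0 \<in> parcs Q" "fst d0 = wr" using ex_dart[of wr] white_mem[of wr] by blast
  define R where "R t = odd (\<chi> t - \<chi> (lf d0))" for t
  have "\<chi> (lf d) = \<chi> (lf d0)" if d: "d \<in> parcs Q" "fst d = wr" for d
  proof -
    have step: "\<chi> (lf (rot e)) = \<chi> (lf e)" if e: "e \<in> parcs Q" "fst e = wr" for e
    proof -
      have "rot e \<notin> Cu" using Cu_white[of "rot e"] roots(1) e by auto
      then have "\<chi> (lf (rot e)) = \<chi> (lf (prod.swap (rot e)))" using \<chi>[of "rot e"] z_out e by simp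
      then show ?thesis using lf_swap[of "rot e"] e by simp
    qed
    have "d \<in> orbit rot d0" using orbit_rot[OF d0(1)] d d0 by simp
    then have "d \<in> parcs Q \<and> fst d = wr \<and> \<chi> (lf d) = \<chi> (lf d0)"
      by induction (use step d0 in auto)
    then show ?thesis by simp
  qed
  then have 1: "\<forall>d\<in>parcs Q. fst d = wr \<longrightarrow> \<not> R (lf d)" by (simp add: R_def)
  have white: "(R (lf d) = R (lf (prod.swap d))) = (d \<notin> Cy)" if d: "d \<in> parcs Q" "fst d \<in> W \<union> {wr}" for d
  proof -
    have "d \<in> Cy \<longleftrightarrow> d \<in> Cu"
    proof
      assume "d \<in> Cy"
      then have "fst d \<in> W \<union> B" using subsetD[OF Cy_E] unfolding E_def by blast
      then have "fst d \<in> W" using d(2) B colours(1) by blast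
      then show "d \<in> Cu" using Cy_white \<open>d \<in> Cy\<close> by simp
    qed (simp add: Cy_def)
    moreover have "R (lf d) = R (lf (prod.swap d)) \<longleftrightarrow> even (z d)"
      unfolding \<chi>[OF d, symmetric] R_def by simp blast
    ultimately show ?thesis using z_out z_odd by fastforce
  qed
  have "(R (lf d) = R (lf (prod.swap d))) = (d \<notin> Cy)" if d: "d \<in> parcs Q" for d
  proof (cases "fst d \<in> W \<union> {wr}")
    case False
    then have "fst (prod.swap d) \<in> W \<union> {wr}" using dart_colours[OF d] by simp
    then show ?thesis using white[of "prod.swap d"] d Cy_swap by auto
  qed (use white d in blast)
  then show ?thesis using 1 unfolding region_def by blast
qed

definition inside :: "('a \<times> 'a) set \<Rightarrow> bool" where "inside = (SOME R. region R)"

lemma region_inside: "region inside"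
  unfolding inside_def using ex_region by (rule someI_ex)

lemma outside_wr: "d \<in> parcs Q \<Longrightarrow> fst d = wr \<Longrightarrow> \<not> inside (lf d)"
  and inside_swap: "d \<in> parcs Q \<Longrightarrow> (inside (lf d) = inside (lf (prod.swap d))) = (d \<notin> Cy)"
  using region_inside by (auto simp: region_def)

definition reach :: "'a \<Rightarrow> bool" where "reach v \<longleftrightarrow> w x \<rightarrow>\<^sup>*\<^bsub>G\<^esub> v"

text \<open>The second condition selects the connected component of the cycle.\<close>

definition L :: "('a \<times> 'a) set" where "L = {d \<in> E. reach (fst d) \<and> inside (lf d)}"

lemma wf_G: "wf_digraph G"
  by unfold_locales auto

lemma arcs_ends_G: "arcs_ends G = E"
  by (auto simp: arcs_ends_def arc_to_ends_def E_def)

lemma E_adj: "d \<in> E \<Longrightarrow> fst d \<rightarrow>\<^bsub>G\<^esub> snd d"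
  by (simp add: arcs_ends_G)

lemma reach_swap: "d \<in> E \<Longrightarrow> reach (snd d) \<longleftrightarrow> reach (fst d)"
  using wf_digraph.reachable_adj_trans[OF wf_G] E_adj E_swap[of d] E_adj[of "prod.swap d"]
  unfolding reach_def by (metis fst_swap snd_swap)

lemma reach_w: "i \<in> X \<Longrightarrow> reach (w i)"
proof -
  have r0: "reach (w x)" unfolding reach_def using wf_digraph.reachable_refl[OF wf_G] w_mem[OF x(1)] by simp
  have step: "reach (w (\<rho> i))" if "i \<in> X" "reach (w i)" for i
  proof -
    have "reach (c (\<sigma> (\<rho> i)))" using reach_swap[OF e2_E[OF X_less[OF that(1)]]] that(2) by (simp add: e2_def)
    then show ?thesis using reach_swap[OF e1_E[OF X_less[OF rho_mem[OF that(1)]]]] by (simp add: e1_def)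
  qed
  assume "i \<in> X"
  then have "i \<in> orbit \<rho> x" by (simp add: X_def)
  then have "i \<in> X \<and> reach (w i)"
    by induction (use step r0 x_mem rho_mem in auto)
  then show ?thesis by simp
qed

lemma reach_Cy: "d \<in> Cy \<Longrightarrow> reach (fst d)"
proof -
  assume d: "d \<in> Cy"
  have "reach (fst e) \<and> reach (snd e)" if "e \<in> Cu" for e
  proof -
    have "fst e \<in> w ` X" using that by (auto simp: Cu_def e1_def e2_def)
    then show ?thesis using reach_w reach_swap[of e] that Cu_E by auto
  qed
  from this[of d] this[of "prod.swap d"] d show ?thesis by (auto simp: Cy_def mem_swap_image)
qed

lemma finite_L [simp]: "finite L" by (rule finite_subset[OF _ finite_E]) (auto simp: L_def)

lemma L_swap: "d \<in> L \<Longrightarrow> d \<notin> Cy \<Longrightarrow> prod.swap d \<in> L"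
  using E_swap[of d] reach_swap[of d] inside_swap[of d] E_subset by (auto simp: L_def)

lemma L_Cy: "d \<in> Cy \<Longrightarrow> (prod.swap d \<in> L) \<noteq> (d \<in> L)"
  using E_swap[of d] reach_swap[of d] inside_swap[of d] E_subset Cy_E reach_Cy[of d] reach_Cy[of "prod.swap d"] Cy_swap[of d]
  by (auto simp: L_def)

text \<open>Ensures that merging faces across edges outside of the component of \<open>d\<close>
  never crosses the cycle.\<close>

lemma component_Cy:
  assumes "d \<in> E" "reach (fst d)"
  shows "Cy \<subseteq> component_arcs G d"
proof
  fix e assume e: "e \<in> Cy"
  have "symmetric G"
    unfolding symmetric_def
  proof (rule symI)
    fix u v assume "(u, v) \<in> arcs_ends G"
    then show "(v, u) \<in> arcs_ends G" using E_swap[of "(u, v)"] by (simp add: arcs_ends_G)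
  qed
  then have "fst d \<rightarrow>\<^sup>*\<^bsub>G\<^esub> w x" 
    by (rule symmetric_reachable[OF _ assms(2)[unfolded reach_def]])
  then have "fst d \<rightarrow>\<^sup>*\<^bsub>G\<^esub> fst e"
    using reach_Cy[OF e] wf_digraph.reachable_trans[OF wf_G] unfolding reach_def by blast
  then show "e \<in> component_arcs G d" using e Cy_E arcs_G unfolding component_arcs_def by blast
qed

end

context alternating_cycle
begin

subsection \<open>Permutations of the enclosed darts\<close>

abbreviation "turn \<equiv> sub_turn E"
abbreviation "next_dart \<equiv> subgraph_face_succ rot E"

lemma next_dart: "next_dart d = turn (prod.swap d)"
  by (rule subgraph_face_succ_eq)

lemma next_dart_E: "d \<in> E \<Longrightarrow> next_dart d \<in> E" "d \<in> E \<Longrightarrow> fst (next_dart d) = snd d"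
  using sub_turn_mem[OF E_subset, of "prod.swap d"] fst_sub_turn[OF E_subset, of "prod.swap d"] E_swap
  by (simp_all add: next_dart)

lemma inside_next: "d \<in> E \<Longrightarrow> inside (lf (next_dart d)) = inside (lf d)"
  using E_swap Cy_E inside_swap by (intro face_succ_inside[OF E_subset]) auto

lemma next_dart_L: "d \<in> L \<Longrightarrow> next_dart d \<in> L"
  using next_dart_E[of d] inside_next[of d] reach_swap[of d] by (simp add: L_def)

lemma L_E: "d \<in> L \<Longrightarrow> d \<in> E" by (simp add: L_def)

lemma next_dart_inj: "d \<in> E \<Longrightarrow> d' \<in> E \<Longrightarrow> next_dart d = next_dart d' \<longleftrightarrow> d = d'"
  unfolding next_dart
  using inj_on_eq_iff[OF bij_betw_imp_inj_on[OF bij_sub_turn[OF E_subset]], of "prod.swap d" "prod.swap d'"] E_swap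
  by (metis swap_swap)

text \<open>
  \<open>pf\<close> turns around faces and \<open>pa\<close> reverses the edges not on the cycle, so that \<open>pt\<close> turns around
  vertices once the cycle is contracted to a single one. The multiplicativity of the sign gives
  Euler's formula for the enclosed region modulo two.
\<close>

definition pf :: "'a \<times> 'a \<Rightarrow> 'a \<times> 'a" where "pf d = (if d \<in> L then next_dart d else d)"
definition pa :: "'a \<times> 'a \<Rightarrow> 'a \<times> 'a" where "pa d = (if d \<in> L \<and> d \<notin> Cy then prod.swap d else d)"
definition pt :: "'a \<times> 'a \<Rightarrow> 'a \<times> 'a" where "pt = pf \<circ> pa"

lemma pf_permutes: "pf permutes L"
proof (rule bij_imp_permutes)
  have "inj_on pf L" using next_dart_inj L_E by (auto simp: inj_on_def pf_def)
  moreover have "pf ` L \<subseteq> L" using next_dart_L by (auto simp: pf_def)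
  ultimately show "bij_betw pf L L" by (simp add: bij_betw_def endo_inj_surj)
qed (simp add: pf_def)

lemma pa_L: "d \<in> L \<Longrightarrow> pa d \<in> L"
  using L_swap by (simp add: pa_def)

lemma pa_pa: "pa (pa d) = d"
  using L_swap[of d] Cy_swap[of d] by (auto simp: pa_def)

lemma pa_permutes: "pa permutes L"
proof (rule bij_imp_permutes)
  show "bij_betw pa L L" by (rule bij_betw_byWitness[of _ pa]) (use pa_L pa_pa in auto)
qed (simp add: pa_def)

lemma pt_permutes: "pt permutes L"
  unfolding pt_def by (rule permutes_compose[OF pa_permutes pf_permutes])

lemma permutations: "permutation pf" "permutation pa" "permutation pt"
  using pf_permutes pa_permutes pt_permutes finite_L permutation_permutes by blast+

lemma sign_pt: "sign pt = sign pf * sign pa"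
  unfolding pt_def by (rule sign_compose[OF permutations(1,2)])

lemma pt_turn: "d \<in> L \<Longrightarrow> d \<notin> Cy \<Longrightarrow> pt d = turn d"
  using L_swap[of d] by (simp add: pt_def pa_def pf_def next_dart)

lemma pt_next: "d \<in> L \<Longrightarrow> d \<in> Cy \<Longrightarrow> pt d = next_dart d"
  by (simp add: pt_def pa_def pf_def)

lemma pt_L: "d \<in> L \<Longrightarrow> pt d \<in> L"
  using permutes_in_image[OF pt_permutes] by simp

definition phi :: "'a \<times> 'a \<Rightarrow> int" where "phi d = \<phi> (from_white W d)"

lemma phi_sq: "d \<in> E \<Longrightarrow> phi d * phi d = 1"
proof -
  assume "d \<in> E"
  then have "from_white W d \<in> arcs G" using E_swap unfolding arcs_G(1) by (simp add: from_white_def)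
  then have "phi d \<in> {1, -1}" using kast unfolding kasteleyn_orientation_def phi_def by blast
  then show ?thesis by auto
qed

lemma E_white_swap: "d \<in> E \<Longrightarrow> fst (prod.swap d) \<in> W \<longleftrightarrow> fst d \<notin> W"
  using dart_colours[of d] W_B B colours(1) by (auto simp: E_def)

lemma phi_swap: "d \<in> E \<Longrightarrow> phi (prod.swap d) = phi d"
  using E_white_swap[of d] by (auto simp: phi_def from_white_def)

text \<open>Colours alternate along a face walk. This makes its length even and provides the half
  length that Kasteleyn's condition refers to.\<close>

lemma face_white_card:
  assumes d: "d \<in> L"
  shows "card (orbit pf d) = 2 * card {e \<in> orbit pf d. fst e \<in> W}"
proof -
  let ?U = "orbit pf d"
  have sub: "?U \<subseteq> L" using permutes_orbit_subset[OF pf_permutes d] .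
  have fin: "finite ?U" using sub finite_subset finite_L by blast
  have step: "pf e \<in> ?U" if "e \<in> ?U" for e using that by (rule orbit.step)
  have col: "fst (pf e) \<in> W \<longleftrightarrow> fst e \<notin> W" if "e \<in> ?U" for e
  proof -
    have "e \<in> L" using that sub by blast
    then have "fst (pf e) = snd e" "e \<in> E" using next_dart_E L_E by (auto simp: pf_def)
    then show ?thesis using dart_colours[of e] W_B B colours(1) by (auto simp: E_def)
  qed
  have inj: "inj_on pf ?U" using permutes_inj[OF pf_permutes] inj_on_subset by blast
  then have onto: "pf ` ?U = ?U" using step fin by (intro endo_inj_surj) auto
  have "pf ` {e \<in> ?U. fst e \<in> W} = {e \<in> ?U. fst e \<notin> W}"
  proof
    show "pf ` {e \<in> ?U. fst e \<in> W} \<subseteq> {e \<in> ?U. fst e \<notin> W}" using step col by blast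
    show "{e \<in> ?U. fst e \<notin> W} \<subseteq> pf ` {e \<in> ?U. fst e \<in> W}"
    proof
      fix e assume e: "e \<in> {e \<in> ?U. fst e \<notin> W}"
      then obtain e' where "e' \<in> ?U" "e = pf e'" using onto by blast
      then show "e \<in> pf ` {e \<in> ?U. fst e \<in> W}" using e col by blast
    qed
  qed
  then have "card {e \<in> ?U. fst e \<notin> W} = card {e \<in> ?U. fst e \<in> W}"
    using card_image[OF inj_on_subset[OF inj, of "{e \<in> ?U. fst e \<in> W}"]] by simp
  moreover have "card ?U = card {e \<in> ?U. fst e \<in> W} + card {e \<in> ?U. fst e \<notin> W}"
    using fin by (subst card_Un_disjoint[symmetric]) (auto intro!: arg_cong[where f = card])
  ultimately show ?thesis by simp
qed

text \<open>A chain of merged faces from \<open>d\<close> to \<open>wr\<close> would have to leave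
  the enclosed region, but the cycle lies in the component of \<open>d\<close>, whose edges the
  chain does not cross.\<close>

lemma bounded_face:
  assumes d: "d \<in> L"
  shows "orbit pf d \<in> bounded_face_boundaries Q rot wr G"
proof -
  have eq: "orbit pf d = orbit (subgraph_face_succ rot (arcs G)) d"
    unfolding arcs_G(1)
    by (rule orbit_cong0[OF d]) (use next_dart_L in \<open>auto simp: pf_def\<close>)
  have "(lf d, lf e) \<notin> same_face Q rot (component_arcs G d)" if e: "e \<in> parcs Q" "fst e = wr" for e
  proof
    assume "(lf d, lf e) \<in> same_face Q rot (component_arcs G d)"
    then have "inside (lf e)"
      unfolding same_face_def
    proof (induction rule: rtrancl_induct)
      case base
      then show ?case using d by (simp add: L_def)
    next
      case (step t u)
      then obtain g where g: "t = lf g" "u = right_face rot g" "g \<in> parcs Q" "g \<notin> component_arcs G d" by auto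
      then have "g \<notin> Cy" using component_Cy[OF L_E[OF d]] d by (auto simp: L_def)
      then show ?case using step.IH inside_swap[OF g(3)] g(1,2) by (simp add: right_face_def)
    qed
    then show False using outside_wr e by blast
  qed
  then show ?thesis unfolding bounded_face_boundaries_def eq using L_E[OF d] arcs_G(1) by blast
qed

text \<open>One dart of each edge and half of the darts of a face start at a white vertex. Hence
  this sign contributes -1 per reversed edge, which is the sign of a transposition, and it turns the
  Kasteleyn sign \<open>(-1) ^ (l + 1)\<close> of a face of degree \<open>2 * l\<close> into -1, the
  sign of a cycle of even length.\<close>

definition wsign :: "'a \<times> 'a \<Rightarrow> int" where "wsign d = (if fst d \<in> W then -1 else 1)"

lemma prod_wsign: "finite D \<Longrightarrow> (\<Prod>d\<in>D. wsign d) = (-1) ^ card {d \<in> D. fst d \<in> W}"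
  unfolding wsign_def by (simp add: prod.If_cases Int_def)

lemma sign_pf: "(\<Prod>d\<in>L. phi d * wsign d) = sign pf"
proof -
  have "(\<Prod>d\<in>L. phi d * wsign d) = (\<Prod>U\<in>orbit pf ` L. \<Prod>d\<in>U. phi d * wsign d)"
    by (rule prod_orbits[OF finite_L pf_permutes, symmetric])
  also have "\<dots> = (\<Prod>U\<in>orbit pf ` L. (-1) ^ (card U + 1))"
  proof (rule prod.cong[OF refl])
    fix U assume "U \<in> orbit pf ` L"
    then obtain d where d: "d \<in> L" "U = orbit pf d" by blast
    have fin: "finite U" using d permutes_orbit_subset[OF pf_permutes] finite_L finite_subset by blast
    let ?l = "card {e \<in> U. fst e \<in> W}"
    have card: "card U = 2 * ?l" using face_white_card d by simp
    have "U \<in> bounded_face_boundaries Q rot wr G" using bounded_face d by simp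
    then have "(\<Prod>d\<in>U. phi d) = (-1) ^ (?l + 1)"
      using kast card unfolding kasteleyn_orientation_def phi_def by blast
    then have "(\<Prod>d\<in>U. phi d * wsign d) = (-1) ^ (?l + 1) * (-1) ^ ?l"
      unfolding prod.distrib prod_wsign[OF fin] by simp
    also have "\<dots> = (-1) ^ (card U + 1)" unfolding card by (simp flip: power_add add: mult_2)
    finally show "(\<Prod>d\<in>U. phi d * wsign d) = (-1) ^ (card U + 1)" .
  qed
  also have "\<dots> = sign pf" by (rule sign_eq_prod_orbits[OF finite_L pf_permutes, symmetric])
  finally show ?thesis .
qed

lemma card_L_even: "(-1 :: int) ^ card L = 1"
proof -
  have "(-1 :: int) ^ card L = (\<Prod>U\<in>orbit pf ` L. \<Prod>d\<in>U. -1)"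
    unfolding prod_orbits[OF finite_L pf_permutes] by simp
  also have "\<dots> = 1"
  proof (rule prod.neutral, rule ballI)
    fix U assume "U \<in> orbit pf ` L"
    then obtain d where "d \<in> L" "U = orbit pf d" by blast
    then have "even (card U)" using face_white_card by simp
    then show "(\<Prod>d\<in>U. -1 :: int) = 1" by simp
  qed
  finally show ?thesis .
qed

lemma orbit_pa:
  assumes d: "d \<in> L"
  shows "orbit pa d = (if d \<in> Cy then {d} else {d, prod.swap d})"
proof -
  have "(pa ^^ 2) d = d" by (simp add: numeral_2_eq_2 pa_pa)
  then have "orbit pa d = {(pa ^^ n) d | n. n < 2}" by (rule orbit_altdef_bounded) simp
  also have "\<dots> = {d, pa d}" by (auto simp: less_2_cases_iff intro: exI[of _ 0] exI[of _ 1])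
  finally show ?thesis using d by (auto simp: pa_def)
qed

lemma swap_neq: "d \<in> parcs Q \<Longrightarrow> prod.swap d \<noteq> d"
  using dart_colours[of d] by (cases d) auto

lemma sign_pa: "(\<Prod>d\<in>L. if d \<in> Cy then 1 else wsign d) = sign pa"
proof -
  have "(\<Prod>d\<in>L. if d \<in> Cy then 1 else wsign d) = (\<Prod>U\<in>orbit pa ` L. \<Prod>d\<in>U. if d \<in> Cy then 1 else wsign d)"
    by (rule prod_orbits[OF finite_L pa_permutes, symmetric])
  also have "\<dots> = (\<Prod>U\<in>orbit pa ` L. (-1) ^ (card U + 1))"
  proof (rule prod.cong[OF refl])
    fix U assume "U \<in> orbit pa ` L"
    then obtain d where d: "d \<in> L" "U = orbit pa d" by blast
    then show "(\<Prod>d\<in>U. if d \<in> Cy then 1 else wsign d) = (-1) ^ (card U + 1)"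
      using swap_neq[of d] L_E[OF d(1)] E_subset Cy_swap[of d] E_white_swap[of d]
      by (auto simp: orbit_pa wsign_def eq_commute[of d])
  qed
  also have "\<dots> = sign pa" by (rule sign_eq_prod_orbits[OF finite_L pa_permutes, symmetric])
  finally show ?thesis .
qed

text \<open>Off the cycle the two darts of an edge are both in \<open>L\<close> and have equal
  \<open>phi\<close>, so they contribute a square.\<close>

lemma prod_phi_L: "(\<Prod>d\<in>L. if d \<in> Cy then 1 else phi d) = 1"
proof -
  have "(\<Prod>d\<in>L. if d \<in> Cy then 1 else phi d) = (\<Prod>U\<in>orbit pa ` L. \<Prod>d\<in>U. if d \<in> Cy then 1 else phi d)"
    by (rule prod_orbits[OF finite_L pa_permutes, symmetric])
  also have "\<dots> = 1"
  proof (rule prod.neutral, rule ballI)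
    fix U assume "U \<in> orbit pa ` L"
    then obtain d where d: "d \<in> L" "U = orbit pa d" by blast
    then show "(\<Prod>d\<in>U. if d \<in> Cy then 1 else phi d) = 1"
      using swap_neq[of d] L_E[OF d(1)] E_subset Cy_swap[of d] phi_swap[of d] phi_sq[of d]
      by (auto simp: orbit_pa eq_commute[of d])
  qed
  finally show ?thesis .
qed

subsection \<open>Turning around the enclosed vertices\<close>

lemma bij_Cu_L: "bij_betw (\<lambda>d. if d \<in> L then d else prod.swap d) Cu (L \<inter> Cy)"
proof (rule bij_betw_byWitness[of _ "\<lambda>d. if d \<in> Cu then d else prod.swap d"])
  have Cu: "d \<in> Cy \<and> prod.swap d \<in> Cy \<and> prod.swap d \<notin> Cu \<and> (prod.swap d \<in> L) \<noteq> (d \<in> L)" if "d \<in> Cu" for d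
    using that L_Cy[of d] Cy_swap[of d] Cy_white[of "prod.swap d"] E_white_swap[of d] Cu_E Cu_white[of d] by (auto simp: Cy_def)
  show "\<forall>d\<in>Cu. (if (if d \<in> L then d else prod.swap d) \<in> Cu then if d \<in> L then d else prod.swap d
      else prod.swap (if d \<in> L then d else prod.swap d)) = d"
    using Cu by auto
  show "\<forall>d\<in>L \<inter> Cy. (if (if d \<in> Cu then d else prod.swap d) \<in> L then if d \<in> Cu then d else prod.swap d
      else prod.swap (if d \<in> Cu then d else prod.swap d)) = d"
    using L_Cy by auto
  show "(\<lambda>d. if d \<in> L then d else prod.swap d) ` Cu \<subseteq> L \<inter> Cy" using Cu by auto
  show "(\<lambda>d. if d \<in> Cu then d else prod.swap d) ` (L \<inter> Cy) \<subseteq> Cu"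
    by (auto simp: Cy_def mem_swap_image)
qed

lemma card_L_Cy: "card (L \<inter> Cy) = 2 * card X"
  using bij_betw_same_card[OF bij_Cu_L] card_Cu by simp

lemma prod_L_Cy: "(\<Prod>d\<in>L \<inter> Cy. phi d) = (\<Prod>d\<in>Cu. phi d)"
proof -
  have "(\<Prod>d\<in>L \<inter> Cy. phi d) = (\<Prod>d\<in>Cu. phi (if d \<in> L then d else prod.swap d))"
    using prod.reindex_bij_betw[OF bij_Cu_L, of phi] by simp
  also have "\<dots> = (\<Prod>d\<in>Cu. phi d)" using phi_swap Cu_E by (intro prod.cong) auto
  finally show ?thesis .
qed

lemma VC_Cy:
  assumes v: "v \<in> VC"
  shows "\<exists>d\<in>Cy. fst d = v"
proof (cases "v \<in> w ` X")
  case True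
  then obtain i where i: "i \<in> X" "v = w i" by blast
  then have "e1 i \<in> Cy" "fst (e1 i) = v" by (auto simp: Cy_def Cu_def e1_def)
  then show ?thesis by blast
next
  case False
  then obtain i where "i \<in> X" "v = c (\<sigma> i)" using v by (auto simp: VC_def)
  then have "prod.swap (e1 i) \<in> Cy" "fst (prod.swap (e1 i)) = v" by (auto simp: Cy_def Cu_def e1_def)
  then show ?thesis by blast
qed

text \<open>Up to the first dart of the cycle \<open>pt\<close> rotates around the vertex without
  leaving \<open>L\<close>, and this rotation runs through all darts of \<open>E\<close>
  there.\<close>

lemma reaches_cycle:
  assumes d: "d \<in> L" "fst d \<in> VC"
  shows "\<exists>e\<in>orbit pt d. e \<in> L \<inter> Cy \<and> fst e = fst d"
proof -
  obtain e where e: "e \<in> Cy" "fst e = fst d" using VC_Cy d(2) by blast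
  have "e \<in> orbit turn d" using orbit_sub_turn[OF E_subset L_E[OF d(1)]] e Cy_E by auto
  then have "\<exists>n. (turn ^^ n) d \<in> Cy" using e unfolding orbit_altdef by blast
  define n where "n = (LEAST n. (turn ^^ n) d \<in> Cy)"
  have n: "(turn ^^ n) d \<in> Cy" unfolding n_def using \<open>\<exists>n. _\<close> by (rule LeastI_ex)
  have least: "(turn ^^ i) d \<notin> Cy" if "i < n" for i using not_less_Least that unfolding n_def by blast
  have "(pt ^^ i) d = (turn ^^ i) d \<and> (turn ^^ i) d \<in> L \<and> fst ((turn ^^ i) d) = fst d" if "i \<le> n" for i
    using that
  proof (induction i)
    case (Suc i)
    let ?y = "(turn ^^ i) d"
    have y: "?y \<in> L" "?y \<notin> Cy" "(pt ^^ i) d = ?y" "fst ?y = fst d" using Suc least by auto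
    then show ?case using pt_turn[OF y(1,2)] pt_L[OF y(1)] fst_sub_turn[OF E_subset L_E[OF y(1)]] by simp
  qed (use d in simp)
  from this[of n] have "(pt ^^ n) d \<in> L \<inter> Cy" "fst ((pt ^^ n) d) = fst d" using n by auto
  moreover have "(pt ^^ n) d \<in> orbit pt d"
    using funpow_in_orbit[OF permutation_self_in_orbit[OF permutations(3)]] .
  ultimately show ?thesis by blast
qed

lemma ex_L_Cy: "v \<in> VC \<Longrightarrow> \<exists>e\<in>L \<inter> Cy. fst e = v"
proof -
  assume v: "v \<in> VC"
  obtain d where d: "d \<in> Cy" "fst d = v" using VC_Cy v by blast
  show ?thesis
  proof (cases "d \<in> L")
    case True
    then show ?thesis using d by blast
  next
    case False
    then have s: "prod.swap d \<in> L" using L_Cy[OF d(1)] by blast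
    have "next_dart (prod.swap d) \<in> L" "fst (next_dart (prod.swap d)) = v"
      using next_dart_L[OF s] next_dart_E(2)[OF L_E[OF s]] d by auto
    then show ?thesis using reaches_cycle[of "next_dart (prod.swap d)"] v by fastforce
  qed
qed

text \<open>The map is onto, and both sets have twice as many elements as \<open>X\<close>. It means
  that the darts with the enclosed region on their left orient the cycle consistently.\<close>

lemma bij_L_Cy: "bij_betw fst (L \<inter> Cy) VC"
proof -
  have im: "fst ` (L \<inter> Cy) = VC" using ex_L_Cy Cy_ends by force
  then have "card (fst ` (L \<inter> Cy)) = card (L \<inter> Cy)" using card_L_Cy card_VC by simp
  then show ?thesis using im by (simp add: bij_betw_def eq_card_imp_inj_on)
qed

lemma card_white_L_Cy: "card {d \<in> L \<inter> Cy. fst d \<in> W} = card X"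
proof -
  let ?D = "{d \<in> L \<inter> Cy. fst d \<in> W}"
  have "inj_on fst ?D"
    by (rule inj_on_subset[OF bij_betw_imp_inj_on[OF bij_L_Cy]]) blast
  then have "card ?D = card (fst ` ?D)" by (rule card_image[symmetric])
  also have "fst ` ?D = fst ` (L \<inter> Cy) \<inter> W" by blast
  also have "\<dots> = w ` X" unfolding bij_betw_imp_surj_on[OF bij_L_Cy] VC_white ..
  also have "card \<dots> = card X" by (rule card_image[OF w_inj_X])
  finally show ?thesis .
qed

end

context alternating_cycle
begin

definition star :: "'a \<Rightarrow> ('a \<times> 'a) set" where "star v = {d \<in> E. fst d = v}"
definition enclosed :: "'a set" where "enclosed = {v. v \<notin> VC \<and> (\<exists>d\<in>L. fst d = v)}"

lemma orbit_pt_enclosed: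
  assumes d: "d \<in> L" "fst d \<notin> VC"
  shows "orbit pt d = star (fst d)"
proof -
  have "pt y \<in> L \<and> fst (pt y) = fst d \<and> pt y = turn y" if "y \<in> L" "fst y = fst d" for y
  proof -
    have "y \<notin> Cy" using Cy_ends[of y] d(2) that by auto
    then show ?thesis using pt_turn[of y] pt_L[of y] fst_sub_turn[OF E_subset, of y] that L_E by simp
  qed
  then have "orbit pt d = orbit turn d"
    using d by (intro orbit_cong0[where A = "{y \<in> L. fst y = fst d}"]) auto
  also have "\<dots> = star (fst d)" using orbit_sub_turn[OF E_subset L_E[OF d(1)]] by (simp add: star_def)
  finally show ?thesis .
qed

lemma star_subset_L: "v \<in> enclosed \<Longrightarrow> star v \<subseteq> L"
proof -
  assume "v \<in> enclosed"
  then obtain d where d: "d \<in> L" "fst d = v" "fst d \<notin> VC" by (auto simp: enclosed_def)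
  then show ?thesis using orbit_pt_enclosed[OF d(1,3)] permutes_orbit_subset[OF pt_permutes d(1)] by simp
qed

lemma orbit_pt_eq: "e \<in> orbit pt d \<Longrightarrow> orbit pt e = orbit pt d"
  by (rule orbit_eq_if_mem[OF permutations(3)])

lemma orbit_pt_self: "d \<in> orbit pt d"
  by (rule permutation_self_in_orbit[OF permutations(3)])

text \<open>At a dart of the cycle \<open>pt\<close> moves on to the next vertex of the cycle
  instead of turning back, so the darts at all vertices of the cycle merge into one orbit.\<close>

lemma orbit_pt_cycle:
  assumes d: "d \<in> L" "fst d \<in> VC"
  shows "orbit pt d = {e \<in> L. fst e \<in> VC}"
proof
  show "orbit pt d \<subseteq> {e \<in> L. fst e \<in> VC}"
  proof
    fix y assume "y \<in> orbit pt d"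
    moreover have "pt y \<in> L \<and> fst (pt y) \<in> VC" if y: "y \<in> L" "fst y \<in> VC" for y
    proof (cases "y \<in> Cy")
      case True
      then show ?thesis using pt_L[OF y(1)] pt_next[OF y(1)] next_dart_E(2)[OF L_E[OF y(1)]] Cy_ends by simp
    next
      case False
      then show ?thesis using pt_L[OF y(1)] pt_turn[OF y(1)] fst_sub_turn[OF E_subset L_E[OF y(1)]] y by simp
    qed
    ultimately show "y \<in> {e \<in> L. fst e \<in> VC}" by induction (use d in auto)
  qed
next
  \<comment> \<open>The vertices of the cycle whose enclosed cycle dart lies in the orbit. This set
    is closed under moving along the cycle in both directions, and it contains \<open>fst d\<close>,
    so it is all of \<open>VC\<close>.\<close>
  define S where "S = fst ` (L \<inter> Cy \<inter> orbit pt d)"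
  have S_iff: "fst e \<in> S \<longleftrightarrow> e \<in> orbit pt d" if "e \<in> L \<inter> Cy" for e
  proof
    assume "fst e \<in> S"
    then obtain e' where "e' \<in> L \<inter> Cy" "e' \<in> orbit pt d" "fst e = fst e'" unfolding S_def by blast
    then show "e \<in> orbit pt d" using that inj_onD[OF bij_betw_imp_inj_on[OF bij_L_Cy]] by metis
  qed (use that in \<open>auto simp: S_def\<close>)
  have adjL: "fst e \<in> S \<longleftrightarrow> snd e \<in> S" if e: "e \<in> L \<inter> Cy" for e
  proof -
    have n: "pt e \<in> L" "fst (pt e) = snd e"
      using pt_L[of e] pt_next[of e] next_dart_E(2)[of e] L_E[of e] e by simp_all
    then obtain e' where e': "e' \<in> orbit pt (pt e)" "e' \<in> L \<inter> Cy" "fst e' = snd e"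
      using reaches_cycle[of "pt e"] Cy_ends[of e] e by (metis IntD2)
    have "orbit pt (pt e) = orbit pt e" using orbit_pt_eq orbit.base by metis
    then have "orbit pt e' = orbit pt e" using e' orbit_pt_eq by metis
    then have "e \<in> orbit pt d \<longleftrightarrow> e' \<in> orbit pt d" using orbit_pt_eq orbit_pt_self by metis
    then show ?thesis using S_iff[OF e] S_iff[OF e'(2)] e'(3) by simp
  qed
  have adj: "fst e \<in> S \<longleftrightarrow> snd e \<in> S" if "e \<in> Cy" for e
    using adjL[of e] adjL[of "prod.swap e"] L_Cy[OF that] that Cy_swap[of e] by auto
  have "e1 i \<in> Cy" "e2 i \<in> Cy" if "i \<in> X" for i using that by (auto simp: Cy_def Cu_def)
  then have cs: "w i \<in> S \<longleftrightarrow> c (\<sigma> i) \<in> S" "w i \<in> S \<longleftrightarrow> c (\<sigma> (\<rho> i)) \<in> S" if "i \<in> X" for i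
    using adj[of "e1 i"] adj[of "e2 i"] that by (auto simp: e1_def e2_def)
  have rho: "w i \<in> S \<longleftrightarrow> w (\<rho> i) \<in> S" if "i \<in> X" for i
    using cs(2)[OF that] cs(1)[OF rho_mem[OF that]] by simp
  have "fst d \<in> S"
  proof -
    obtain e where "e \<in> orbit pt d" "e \<in> L \<inter> Cy" "fst e = fst d" using reaches_cycle[OF d] by blast
    then show ?thesis unfolding S_def by (intro image_eqI[of _ _ e]) auto
  qed
  then have "\<exists>i\<in>X. w i \<in> S" using d(2) cs(1) by (auto simp: VC_def)
  then obtain i where i: "i \<in> X" "w i \<in> S" by blast
  have "w j \<in> S" if "j \<in> X" for j
  proof -
    have "j \<in> orbit \<rho> i" using orbit_X[OF i(1)] that by simp
    then have "j \<in> X \<and> w j \<in> S" by induction (use i rho rho_mem in auto)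
    then show ?thesis by simp
  qed
  then have VC_S: "v \<in> S" if "v \<in> VC" for v using that cs(1) by (auto simp: VC_def)
  show "{e \<in> L. fst e \<in> VC} \<subseteq> orbit pt d"
  proof
    fix y assume y: "y \<in> {e \<in> L. fst e \<in> VC}"
    then obtain e where e: "e \<in> orbit pt y" "e \<in> L \<inter> Cy" "fst e = fst y" using reaches_cycle[of y] by blast
    then have "e \<in> orbit pt d" using S_iff[OF e(2)] VC_S y by simp
    then have "orbit pt y = orbit pt d" using orbit_pt_eq e(1) by metis
    then show "y \<in> orbit pt d" using orbit_pt_self by metis
  qed
qed

text \<open>The first of the two matchings pairs up the enclosed vertices.\<close>

lemma card_enclosed: "even (card enclosed)"
proof -
  have VCw: "w i \<in> VC \<longleftrightarrow> i \<in> X" if "i < k" for i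
  proof
    assume "w i \<in> VC"
    then have "w i \<in> w ` X" using VC_white w_mem[OF that] by blast
    then show "i \<in> X" using w_eq_iff that X_less by auto
  qed (auto simp: VC_def)
  have VCc: "c (\<sigma> i) \<in> VC \<longleftrightarrow> i \<in> X" if "i < k" for i
  proof
    assume "c (\<sigma> i) \<in> VC"
    then have "c (\<sigma> i) \<in> (\<lambda>i. c (\<sigma> i)) ` X" using cs_mem[OF that] W_B w_mem X_less by (auto simp: VC_def)
    then show "i \<in> X" using cs_eq_iff that X_less by auto
  qed (auto simp: VC_def)
  have partner: "w i \<in> enclosed \<longleftrightarrow> c (\<sigma> i) \<in> enclosed" if i: "i < k" for i
  proof -
    have not_Cy: "e1 i \<notin> Cy" if "i \<notin> X" using Cy_ends[of "e1 i"] VCw[OF i] that by (auto simp: e1_def)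
    show ?thesis
    proof
      assume a: "w i \<in> enclosed"
      then have "i \<notin> X" using VCw[OF i] by (auto simp: enclosed_def)
      have "e1 i \<in> L" using star_subset_L[OF a] e1_E[OF i] by (auto simp: star_def e1_def)
      then have "prod.swap (e1 i) \<in> L" using L_swap not_Cy \<open>i \<notin> X\<close> by blast
      then show "c (\<sigma> i) \<in> enclosed" using VCc[OF i] \<open>i \<notin> X\<close> by (force simp: enclosed_def e1_def)
    next
      assume a: "c (\<sigma> i) \<in> enclosed"
      then have "i \<notin> X" using VCc[OF i] by (auto simp: enclosed_def)
      have "prod.swap (e1 i) \<in> L" using star_subset_L[OF a] e1_E[OF i] E_swap[of "e1 i"] by (auto simp: star_def e1_def)
      then have "e1 i \<in> L" using L_swap[of "prod.swap (e1 i)"] not_Cy \<open>i \<notin> X\<close> Cy_swap[of "e1 i"] by simp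
      then show "w i \<in> enclosed" using VCw[OF i] \<open>i \<notin> X\<close> by (force simp: enclosed_def e1_def)
    qed
  qed
  define J where "J = {i. i < k \<and> w i \<in> enclosed}"
  have "v \<in> w ` J \<union> (\<lambda>i. c (\<sigma> i)) ` J" if v: "v \<in> enclosed" for v
  proof -
    have "v \<in> W \<union> B" using v by (auto simp: enclosed_def L_def E_def)
    then show ?thesis
    proof
      assume "v \<in> W"
      then obtain i where "i < k" "v = w i" using ex_w by blast
      then show ?thesis using v by (auto simp: J_def)
    next
      assume "v \<in> B"
      then obtain i where "i < k" "v = c (\<sigma> i)" using ex_cs by blast
      then show ?thesis using v partner[of i] by (auto simp: J_def)
    qed
  qed
  then have eq: "enclosed = w ` J \<union> (\<lambda>i. c (\<sigma> i)) ` J" using partner by (auto simp: J_def)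
  have "w ` J \<subseteq> W" "(\<lambda>i. c (\<sigma> i)) ` J \<subseteq> B" using cs_mem by (auto simp: J_def)
  then have "w ` J \<inter> (\<lambda>i. c (\<sigma> i)) ` J = {}" using W_B by blast
  moreover have "finite J" by (simp add: J_def)
  moreover have "inj_on w J" "inj_on (\<lambda>i. c (\<sigma> i)) J" using w_eq_iff cs_eq_iff by (auto simp: inj_on_def J_def)
  ultimately show ?thesis unfolding eq by (simp add: card_Un_disjoint card_image)
qed

text \<open>The orbits are the stars of the enclosed vertices together with one for the contracted
  cycle. Their number is odd while \<open>card L\<close> is even, and the sign depends only on these
  two parities.\<close>

lemma sign_pt_eq: "sign pt = -1"
proof -
  let ?U = "{e \<in> L. fst e \<in> VC}"
  have "enclosed \<subseteq> fst ` L" by (auto simp: enclosed_def)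
  then have fin: "finite enclosed" using finite_L finite_subset by blast
  have "card (L \<inter> Cy) \<noteq> 0" using card_L_Cy x_mem by auto
  then obtain d0 where d0: "d0 \<in> L" "d0 \<in> Cy" by (metis Int_iff card.empty ex_in_conv)
  have orbits: "orbit pt ` L = insert ?U (star ` enclosed)"
  proof
    show "orbit pt ` L \<subseteq> insert ?U (star ` enclosed)"
    proof
      fix U assume "U \<in> orbit pt ` L"
      then obtain d where d: "d \<in> L" "U = orbit pt d" by blast
      show "U \<in> insert ?U (star ` enclosed)"
      proof (cases "fst d \<in> VC")
        case False
        then have "fst d \<in> enclosed" using d by (auto simp: enclosed_def)
        then show ?thesis using orbit_pt_enclosed[OF d(1) False] d(2) by blast
      qed (use orbit_pt_cycle d in simp)
    qed
    have "fst d0 \<in> VC" using Cy_ends[OF d0(2)] by simp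
    then have "?U = orbit pt d0" using orbit_pt_cycle[OF d0(1)] by simp
    then have "?U \<in> orbit pt ` L" using d0(1) by (rule image_eqI)
    moreover have "star v \<in> orbit pt ` L" if "v \<in> enclosed" for v
      using that orbit_pt_enclosed by (auto simp: enclosed_def intro!: image_eqI)
    ultimately show "insert ?U (star ` enclosed) \<subseteq> orbit pt ` L" by blast
  qed
  have ne: "\<exists>d. d \<in> star v" if "v \<in> enclosed" for v
    using that L_E unfolding enclosed_def star_def by blast
  have inj: "inj_on star enclosed"
  proof (rule inj_onI)
    fix u v assume "u \<in> enclosed" "star u = star v"
    then obtain d where "d \<in> star u" "d \<in> star v" using ne by blast
    then show "u = v" by (simp add: star_def)
  qed
  have "?U \<notin> star ` enclosed"
  proof
    assume "?U \<in> star ` enclosed"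
    then obtain v where v: "v \<in> enclosed" "?U = star v" by blast
    then obtain d where "d \<in> star v" "d \<in> ?U" using ne by blast
    then show False using v(1) by (simp add: star_def enclosed_def)
  qed
  then have card: "card (orbit pt ` L) = Suc (card enclosed)"
    unfolding orbits using fin card_image[OF inj] by simp
  have "sign pt = (\<Prod>U\<in>orbit pt ` L. (-1) ^ (card U + 1))"
    by (rule sign_eq_prod_orbits[OF finite_L pt_permutes])
  also have "\<dots> = (\<Prod>U\<in>orbit pt ` L. -1) * (\<Prod>U\<in>orbit pt ` L. \<Prod>d\<in>U. -1)"
    unfolding prod.distrib[symmetric] by (rule prod.cong) simp_all
  also have "(\<Prod>U\<in>orbit pt ` L. \<Prod>d\<in>U. -1 :: int) = 1"
    unfolding prod_orbits[OF finite_L pt_permutes] using card_L_even by simp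
  also have "(\<Prod>U\<in>orbit pt ` L. -1 :: int) = -1"
    using card_enclosed unfolding prod_constant card by simp
  finally show ?thesis by simp
qed

text \<open>In the product for \<open>sign pf\<close> the darts off the cycle contribute exactly
  \<open>sign pa\<close>, which cancels in \<open>sign pf * sign pa\<close>. The darts of the cycle
  contribute the product of \<open>\<phi>\<close> over its edges and one factor -1 for each white
  vertex.\<close>

lemma cycle_sign: "(\<Prod>i\<in>X. \<phi> (e1 i) * \<phi> (e2 i)) = (-1) ^ (card X + 1)"
proof -
  let ?P = "\<Prod>d\<in>Cu. phi d"
  have "inj_on e1 X" "inj_on e2 X" using inj_on_subset[OF e1_inj X_subset] inj_on_subset[OF e2_inj X_subset] by simp_all
  then have "?P = (\<Prod>i\<in>X. phi (e1 i)) * (\<Prod>i\<in>X. phi (e2 i))"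
    unfolding Cu_def using e1_neq_e2 by (subst prod.union_disjoint) (auto simp: prod.reindex, metis)
  also have "\<dots> = (\<Prod>i\<in>X. \<phi> (e1 i) * \<phi> (e2 i))"
    unfolding prod.distrib[symmetric] using X_less w_mem
    by (intro prod.cong) (auto simp: phi_def from_white_def e1_def e2_def)
  finally have P: "?P = (\<Prod>i\<in>X. \<phi> (e1 i) * \<phi> (e2 i))" .
  have "sign pf = (\<Prod>d\<in>L. phi d * wsign d)" by (rule sign_pf[symmetric])
  also have "\<dots> = (\<Prod>d\<in>L. if d \<in> Cy then phi d * wsign d else 1) * (\<Prod>d\<in>L. if d \<in> Cy then 1 else phi d)
      * (\<Prod>d\<in>L. if d \<in> Cy then 1 else wsign d)"
    unfolding prod.distrib[symmetric] by (rule prod.cong) auto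
  also have "\<dots> = (\<Prod>d\<in>L. if d \<in> Cy then phi d * wsign d else 1) * sign pa"
    unfolding prod_phi_L sign_pa by simp
  also have "(\<Prod>d\<in>L. if d \<in> Cy then phi d * wsign d else 1) = (\<Prod>d\<in>L \<inter> Cy. phi d * wsign d)"
    by (rule prod.inter_restrict[symmetric]) simp
  also have "\<dots> = ?P * (-1) ^ card X"
    unfolding prod.distrib prod_L_Cy prod_wsign[OF finite_Int[OF disjI1[OF finite_L]]] card_white_L_Cy ..
  finally have "sign pt = ?P * (-1) ^ card X * (sign pa * sign pa)"
    unfolding sign_pt by simp
  then have prod: "?P * (-1) ^ card X = -1" using sign_pt_eq by simp
  have "(-1 :: int) ^ card X * (-1) ^ card X = 1" by (simp flip: power_add mult_2)
  then have "?P = (?P * (-1) ^ card X) * (-1) ^ card X" by (simp add: mult.assoc)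
  also have "\<dots> = (-1) ^ (card X + 1)" unfolding prod by simp
  finally show ?thesis unfolding P .
qed

end

section \<open>The partition function as a determinant\<close>

context forest_quadrangulation
begin

definition matching_perm :: "(nat \<Rightarrow> nat) \<Rightarrow> bool" where
  "matching_perm p \<longleftrightarrow> p permutes {0..<k} \<and> (\<forall>i<k. (w i, c (p i)) \<in> parcs Q)"

text \<open>The ratio between the term of a matching in the partition function and its term in the
  Leibniz expansion. Kasteleyn's theorem says that it does not depend on the matching.\<close>

definition signed_phi :: "('a \<times> 'a \<Rightarrow> int) \<Rightarrow> (nat \<Rightarrow> nat) \<Rightarrow> int" where
  "signed_phi \<phi> p = sign p * (\<Prod>i<k. \<phi> (w i, c (p i)))"

lemma matching_arc: "matching_perm p \<Longrightarrow> i < k \<Longrightarrow> (w i, c (p i)) \<in> arcs G"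
  using c_mem[of "p i"] permutes_in_image[of p "{0..<k}" i] by (auto simp: matching_perm_def)

lemma phi_pm:
  assumes "kasteleyn_orientation Q rot wr W G \<phi>" "matching_perm p" "i < k"
  shows "\<phi> (w i, c (p i)) * \<phi> (w i, c (p i)) = 1"
proof -
  have "\<phi> (w i, c (p i)) \<in> {1, -1}"
    using matching_arc[OF assms(2,3)] assms(1) unfolding kasteleyn_orientation_def by blast
  then show ?thesis by auto
qed

text \<open>Two matchings are joined by switching along the cycles of their superposition, one by one.\<close>

lemma signed_phi_constant:
  assumes kast: "kasteleyn_orientation Q rot wr W G \<phi>"
    and "matching_perm p" "matching_perm q"
  shows "signed_phi \<phi> p = signed_phi \<phi> q"
  using assms(2)
proof (induction "card {i. p i \<noteq> q i}" arbitrary: p rule: less_induct)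
  case less
  have p: "p permutes {0..<k}" and q: "q permutes {0..<k}"
    using less.prems assms(3) by (auto simp: matching_perm_def)
  show ?case
  proof (cases "p = q")
    case False
    \<comment> \<open>Chosen so that \<open>p \<circ> \<rho>0 = q\<close>; restricting it to a
      single orbit switches one cycle of the superposition only.\<close>
    define \<rho>0 where "\<rho>0 = Hilbert_Choice.inv p \<circ> q"
    have r0: "\<rho>0 permutes {0..<k}" unfolding \<rho>0_def by (rule permutes_compose[OF q permutes_inv[OF p]])
    have pr0: "p (\<rho>0 i) = q i" for i by (simp add: \<rho>0_def permutes_inverses[OF p])
    have perm0: "permutation \<rho>0" using r0 permutation_permutes finite_atLeastLessThan by blast
    obtain x where x: "p x \<noteq> q x" using False by blast
    have xk: "x < k" using x p q by (metis atLeastLessThan_iff permutes_not_in zero_le)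
    have rx: "\<rho>0 x \<noteq> x" using x pr0 by metis
    let ?X = "orbit \<rho>0 x"
    define \<rho> where "\<rho> = perm_restrict \<rho>0 ?X"
    have sub: "?X \<subseteq> {0..<k}" using permutes_orbit_subset[OF r0] xk by simp
    have cyc: "cyclic_on \<rho>0 ?X" by (rule cyclic_on_orbit'[OF perm0])
    have rX: "\<rho> permutes ?X"
    proof (rule bij_imp_permutes)
      have fin: "finite ?X" using sub finite_subset by blast
      have "inj_on \<rho> ?X" using permutes_inj[OF r0] by (auto simp: inj_on_def \<rho>_def perm_restrict_def dest: injD)
      moreover have "\<rho> ` ?X \<subseteq> ?X" using cyclic_on_inI[OF cyc] by (auto simp: \<rho>_def perm_restrict_def)
      ultimately show "bij_betw \<rho> ?X ?X" using fin by (simp add: bij_betw_def endo_inj_surj)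
    qed (simp add: \<rho>_def perm_restrict_def)
    have r: "\<rho> permutes {0..<k}" by (rule permutes_subset[OF rX sub])
    have xX: "x \<in> ?X" by (rule permutation_self_in_orbit[OF perm0])
    have orb: "orbit \<rho> x = ?X"
      by (rule orbit_cong) (auto simp: \<rho>_def perm_restrict_def xX)
    define p' where "p' = p \<circ> \<rho>"
    have p'i: "p' i = (if i \<in> ?X then q i else p i)" for i
      using pr0 by (simp add: p'_def \<rho>_def perm_restrict_def)
    have m': "matching_perm p'"
      unfolding matching_perm_def
    proof (intro conjI allI impI)
      show "p' permutes {0..<k}" unfolding p'_def by (rule permutes_compose[OF r p])
      show "(w i, c (p' i)) \<in> parcs Q" if "i < k" for i
        using less.prems assms(3) that by (simp add: p'i matching_perm_def)
    qed
    interpret alt: alternating_cycle Q rot W wr Bt br s m k f b w B c \<phi> p \<rho> x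
    proof unfold_locales
      show "kasteleyn_orientation Q rot wr W G \<phi>" by (rule kast)
      show "p permutes {0..<k}" "\<rho> permutes {0..<k}" "x < k" using p r xk by auto
      show "\<rho> x \<noteq> x" using rx xX by (simp add: \<rho>_def perm_restrict_def)
      show "(w i, c (p i)) \<in> parcs Q" if "i < k" for i using less.prems that by (simp add: matching_perm_def)
      show "(w i, c (p (\<rho> i))) \<in> parcs Q" if "i < k" for i using m' that by (simp add: matching_perm_def p'_def)
    qed
    have X: "alt.X = ?X" unfolding alt.X_def by (rule orb)
    have sr: "sign \<rho> = (-1) ^ (card ?X + 1)"
    proof -
      have "orbit \<rho> ` ?X = {?X}"
        using alt.orbit_X xX unfolding X by auto
      moreover have "finite ?X" using sub finite_subset by blast
      ultimately show ?thesis using sign_eq_prod_orbits[OF _ rX] by simp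
    qed
    \<comment> \<open>Away from the cycle both matchings use the same edges, whose signs square to
      1.\<close>
    have "(\<Prod>i<k. \<phi> (w i, c (p i)) * \<phi> (w i, c (p' i))) = (\<Prod>i\<in>?X. \<phi> (w i, c (p i)) * \<phi> (w i, c (p' i)))"
    proof (rule prod.mono_neutral_right)
      show "\<forall>i\<in>{..<k} - ?X. \<phi> (w i, c (p i)) * \<phi> (w i, c (p' i)) = 1"
        using phi_pm[OF kast less.prems] by (simp add: p'i)
    qed (use sub in auto)
    also have "\<dots> = sign \<rho>"
      using alt.cycle_sign unfolding X sr alt.e1_def alt.e2_def p'_def by simp
    finally have prod: "(\<Prod>i<k. \<phi> (w i, c (p i))) * (\<Prod>i<k. \<phi> (w i, c (p' i))) = sign \<rho>"
      by (simp add: prod.distrib)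
    have sq: "(\<Prod>i<k. \<phi> (w i, c (p i))) * (\<Prod>i<k. \<phi> (w i, c (p i))) = 1"
      unfolding prod.distrib[symmetric] using phi_pm[OF kast less.prems] by simp
    have perms: "permutation p" "permutation \<rho>" using p r permutation_permutes finite_atLeastLessThan by blast+
    have sp: "sign p' = sign p * sign \<rho>" unfolding p'_def by (rule sign_compose[OF perms])
    have "signed_phi \<phi> p' = sign p * (sign \<rho> * (\<Prod>i<k. \<phi> (w i, c (p' i))))"
      by (simp add: signed_phi_def sp)
    also have "\<dots> = sign p * ((\<Prod>i<k. \<phi> (w i, c (p i))) * ((\<Prod>i<k. \<phi> (w i, c (p' i))) * (\<Prod>i<k. \<phi> (w i, c (p' i)))))"
      unfolding prod[symmetric] by (simp add: mult.assoc)
    also have "(\<Prod>i<k. \<phi> (w i, c (p' i))) * (\<Prod>i<k. \<phi> (w i, c (p' i))) = 1"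
      unfolding prod.distrib[symmetric] using phi_pm[OF kast m'] by simp
    finally have eq: "signed_phi \<phi> p' = signed_phi \<phi> p" by (simp add: signed_phi_def)
    \<comment> \<open>After the switch \<open>p'\<close> agrees with \<open>q\<close> on the whole
      orbit of \<open>x\<close>, so the set of disagreements shrinks.\<close>
    have "{i. p' i \<noteq> q i} \<subset> {i. p i \<noteq> q i}" using x xX by (auto simp: p'i)
    moreover have "finite {i. p i \<noteq> q i}"
      by (rule finite_subset[of _ "{0..<k}"]) (use p q in \<open>auto dest: permutes_not_in, metis atLeastLessThan_iff not_less permutes_not_in zero_le\<close>)
    ultimately have "card {i. p' i \<noteq> q i} < card {i. p i \<noteq> q i}" by (simp add: psubset_card_mono)
    then show ?thesis using less.hyps[OF _ m'] eq by simp
  qed simp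
qed

section \<open>Perfect matchings as permutations\<close>

definition matching :: "(nat \<Rightarrow> nat) \<Rightarrow> ('a \<times> 'a) set" where
  "matching p = (\<lambda>i. (w i, c (p i))) ` {..<k}"

lemma matching_mem:
  assumes p: "matching_perm p"
  shows "matching p \<in> perfect_matchings W G"
proof -
  have pk: "p permutes {0..<k}" and pl: "p i < k" if "i < k" for i
    using p that permutes_in_image[of p "{0..<k}" i] by (auto simp: matching_perm_def)
  have perm: "p permutes {0..<k}" using p by (simp add: matching_perm_def)
  have "matching p \<subseteq> {e \<in> arcs G. fst e \<in> W}"
    unfolding matching_def using matching_arc[OF p] w_mem by (auto simp del: induce_subgraph_arcs)
  moreover have "\<exists>!e. e \<in> matching p \<and> (fst e = v \<or> snd e = v)" if v: "v \<in> W \<union> B" for v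
  proof (cases "v \<in> W")
    case True
    obtain i where i: "i < k" "v = w i" using ex_w[OF True] by blast
    show ?thesis
    proof (rule ex1I[of _ "(w i, c (p i))"])
      show "(w i, c (p i)) \<in> matching p \<and> (fst (w i, c (p i)) = v \<or> snd (w i, c (p i)) = v)"
        using i by (auto simp: matching_def)
      fix e assume "e \<in> matching p \<and> (fst e = v \<or> snd e = v)"
      then obtain j where j: "j < k" "e = (w j, c (p j))" "w j = v \<or> c (p j) = v" by (auto simp: matching_def)
      then have "w j = w i" using i True c_mem[OF pl[OF j(1)]] W_B by auto
      then show "e = (w i, c (p i))" using w_eq_iff i j by simp
    qed
  next
    case False
    then obtain j0 where j0: "j0 < k" "v = c j0" using v ex_c by blast
    obtain i where i: "j0 = p i" using permutes_surj[OF perm] by blast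
    then have ik: "i < k" using j0 permutes_in_image[OF perm, of i] by simp
    show ?thesis
    proof (rule ex1I[of _ "(w i, c (p i))"])
      show "(w i, c (p i)) \<in> matching p \<and> (fst (w i, c (p i)) = v \<or> snd (w i, c (p i)) = v)"
        using i ik j0 by (auto simp: matching_def)
      fix e assume "e \<in> matching p \<and> (fst e = v \<or> snd e = v)"
      then obtain j where j: "j < k" "e = (w j, c (p j))" "w j = v \<or> c (p j) = v" by (auto simp: matching_def)
      have "w j \<noteq> v" using False w_mem[OF j(1)] by blast
      then have "c (p j) = c (p i)" using j(3) i j0 by simp
      then have "p j = p i" using c_eq_iff pl j(1) ik by simp
      then show "e = (w i, c (p i))" using inj_eq[OF permutes_inj[OF perm]] j by simp
    qed
  qed
  ultimately show ?thesis by (simp add: perfect_matchings_def)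
qed

lemma matching_surj:
  assumes M: "M \<in> perfect_matchings W G"
  shows "M \<in> matching ` {p. matching_perm p}"
proof -
  have sub: "M \<subseteq> {e \<in> arcs G. fst e \<in> W}" and uniq: "\<And>v. v \<in> W \<union> B \<Longrightarrow> \<exists>!e. e \<in> M \<and> (fst e = v \<or> snd e = v)"
    using M by (auto simp: perfect_matchings_def)
  have ends: "e \<in> parcs Q \<and> fst e \<in> W \<and> snd e \<in> B" if "e \<in> M" for e
  proof -
    have e: "e \<in> parcs Q" "fst e \<in> W" "snd e \<in> W \<union> B" using sub that by auto
    then have "snd e \<notin> W" using dart_colours(1)[of e] colours(1) by blast
    then show ?thesis using e by blast
  qed
  have "\<exists>j<k. (w i, c j) \<in> M" if i: "i < k" for i
  proof -
    obtain e where e: "e \<in> M" "fst e = w i \<or> snd e = w i" using uniq[of "w i"] i by auto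
    then have "fst e = w i" using ends[OF e(1)] W_B i w_mem by metis
    moreover obtain j where "j < k" "snd e = c j" using ends[OF e(1)] ex_c by blast
    ultimately show ?thesis using e(1) by (metis prod.collapse)
  qed
  then obtain g where g: "\<And>i. i < k \<Longrightarrow> g i < k \<and> (w i, c (g i)) \<in> M" by metis
  define p where "p i = (if i < k then g i else i)" for i
  have "inj_on p {0..<k}"
  proof (rule inj_onI)
    fix i j assume ij: "i \<in> {0..<k}" "j \<in> {0..<k}" "p i = p j"
    then have M: "(w i, c (g i)) \<in> M" "(w j, c (g i)) \<in> M" "c (g i) \<in> W \<union> B"
      using g[of i] g[of j] c_mem[of "g i"] by (simp_all add: p_def)
    then have "(w i, c (g i)) = (w j, c (g i))" using uniq[OF M(3)] by (metis snd_conv)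
    then show "i = j" using w_eq_iff ij by simp
  qed
  moreover have "p ` {0..<k} \<subseteq> {0..<k}" using g by (auto simp: p_def)
  ultimately have "bij_betw p {0..<k} {0..<k}" by (simp add: bij_betw_def endo_inj_surj)
  then have perm: "p permutes {0..<k}" by (rule bij_imp_permutes) (simp add: p_def)
  have "matching_perm p" using perm g ends by (fastforce simp: matching_perm_def p_def)
  moreover have "M = matching p"
  proof
    show "matching p \<subseteq> M" using g by (auto simp: matching_def p_def)
    show "M \<subseteq> matching p"
    proof
      fix e assume e: "e \<in> M"
      then obtain i where i: "i < k" "fst e = w i" using ends ex_w by blast
      have "w i \<in> W \<union> B" using i(1) by simp
      then have "e = (w i, c (g i))" using uniq[of "w i"] e i g[OF i(1)] by (metis fst_conv)
      then show "e \<in> matching p" using i by (auto simp: matching_def p_def)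
    qed
  qed
  ultimately show ?thesis by blast
qed

lemma matching_inj: "inj_on matching {p. matching_perm p}"
proof (rule inj_onI)
  fix p q assume "p \<in> {p. matching_perm p}" "q \<in> {p. matching_perm p}" and eq: "matching p = matching q"
  then have p: "p permutes {0..<k}" and q: "q permutes {0..<k}" by (auto simp: matching_perm_def)
  have "p i = q i" if i: "i < k" for i
  proof -
    have "(w i, c (p i)) \<in> matching q" using i eq by (auto simp: matching_def)
    then obtain j where "j < k" "w i = w j" "c (p i) = c (q j)" by (auto simp: matching_def)
    then show ?thesis
      using w_eq_iff i c_eq_iff permutes_in_image[OF p, of i] permutes_in_image[OF q, of j] by simp
  qed
  moreover have "p i = q i" if "\<not> i < k" for i
    using that p q by (metis atLeastLessThan_iff permutes_not_in)
  ultimately show "p = q" by blast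
qed

lemma partition_function_det:
  assumes kast: "kasteleyn_orientation Q rot wr W G \<phi>"
  obtains \<epsilon> :: int where "\<epsilon> \<in> {1, -1}"
    "partition_function rot W G \<phi> = of_int \<epsilon> * det (mat k k (\<lambda>(i, j). edge_weight var (w i) (c j)))"
proof -
  let ?M = "{p. matching_perm p}" and ?N = "mat k k (\<lambda>(i, j). edge_weight var (w i) (c j)) :: ('a \<times> 'a) set int_mpoly mat"
  have fin: "finite ?M"
    by (rule finite_subset[of _ "{p. p permutes {0..<k}}"]) (auto simp: matching_perm_def finite_permutations)
  \<comment> \<open>Without any perfect matching the partition function and the determinant both
    vanish, and either sign will do.\<close>
  have "\<exists>\<epsilon>\<in>{1, -1}. \<forall>p\<in>?M. signed_phi \<phi> p = \<epsilon>"
  proof (cases "?M = {}")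
    case False
    then obtain q where q: "matching_perm q" by blast
    have "signed_phi \<phi> q * signed_phi \<phi> q = (sign q * sign q) * (\<Prod>i<k. \<phi> (w i, c (q i)) * \<phi> (w i, c (q i)))"
      by (simp add: signed_phi_def prod.distrib mult_ac)
    also have "\<dots> = 1" using phi_pm[OF kast q] by simp
    finally have "signed_phi \<phi> q = 1 \<or> signed_phi \<phi> q = -1" by (simp add: square_eq_1_iff)
    moreover have "signed_phi \<phi> p = signed_phi \<phi> q" if "p \<in> ?M" for p
      using signed_phi_constant[OF kast, of p q] that q by blast
    ultimately show ?thesis by (intro bexI[of _ "signed_phi \<phi> q"]) auto
  qed auto
  then obtain \<epsilon> where \<epsilon>: "\<epsilon> \<in> {1, -1}" "\<And>p. matching_perm p \<Longrightarrow> signed_phi \<phi> p = \<epsilon>" by blast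
  have bij: "bij_betw matching ?M (perfect_matchings W G)"
    unfolding bij_betw_def using matching_inj matching_mem matching_surj by auto
  have "partition_function rot W G \<phi> = (\<Sum>p\<in>?M. \<Prod>(u, v)\<in>matching p.
      of_int (\<phi> (u, v)) * (var (right_face rot (u, v)) - var (right_face rot (v, u))))"
    unfolding partition_function_def by (rule sum.reindex_bij_betw[OF bij, symmetric])
  also have "\<dots> = (\<Sum>p\<in>?M. of_int \<epsilon> * (of_int (sign p) * (\<Prod>i = 0..<k. ?N $$ (i, p i))))"
  proof (rule sum.cong[OF refl])
    fix p assume "p \<in> ?M"
    then have p: "matching_perm p" by simp
    have inj: "inj_on (\<lambda>i. (w i, c (p i))) {..<k}" using w_eq_iff by (auto simp: inj_on_def)
    have pl: "p i < k" if "i < k" for i using p permutes_in_image[of p "{0..<k}" i] that by (auto simp: matching_perm_def)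
    have "(\<Prod>(u, v)\<in>matching p. of_int (\<phi> (u, v)) * (var (right_face rot (u, v)) - var (right_face rot (v, u))))
        = (\<Prod>i<k. of_int (\<phi> (w i, c (p i))) * edge_weight var (w i) (c (p i)))"
      unfolding matching_def prod.reindex[OF inj] using p
      by (intro prod.cong) (auto simp: edge_weight_def matching_perm_def)
    also have "\<dots> = of_int (\<Prod>i<k. \<phi> (w i, c (p i))) * (\<Prod>i<k. edge_weight var (w i) (c (p i)))"
      by (simp add: prod.distrib)
    also have "(\<Prod>i<k. \<phi> (w i, c (p i))) = \<epsilon> * sign p"
    proof -
      have "\<epsilon> * sign p = (sign p * sign p) * (\<Prod>i<k. \<phi> (w i, c (p i)))"
        unfolding \<epsilon>(2)[OF p, symmetric] signed_phi_def by (simp only: mult_ac)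
      then show ?thesis by simp
    qed
    also have "(\<Prod>i<k. edge_weight var (w i) (c (p i))) = (\<Prod>i = 0..<k. ?N $$ (i, p i))"
      using pl by (simp add: atLeast0LessThan)
    finally show "(\<Prod>(u, v)\<in>matching p. of_int (\<phi> (u, v)) * (var (right_face rot (u, v)) - var (right_face rot (v, u))))
        = of_int \<epsilon> * (of_int (sign p) * (\<Prod>i = 0..<k. ?N $$ (i, p i)))"
      by (simp add: mult.assoc)
  qed
  also have "\<dots> = of_int \<epsilon> * (\<Sum>p\<in>?M. of_int (sign p) * (\<Prod>i = 0..<k. ?N $$ (i, p i)))"
    by (rule sum_distrib_left[symmetric])
  also have "(\<Sum>p\<in>?M. of_int (sign p) * (\<Prod>i = 0..<k. ?N $$ (i, p i)))
      = (\<Sum>p | p permutes {0..<k}. of_int (sign p) * (\<Prod>i = 0..<k. ?N $$ (i, p i)))"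
  proof (rule sum.mono_neutral_left)
    show "\<forall>p\<in>{p. p permutes {0..<k}} - ?M. of_int (sign p) * (\<Prod>i = 0..<k. ?N $$ (i, p i)) = 0"
    proof
      fix p assume "p \<in> {p. p permutes {0..<k}} - ?M"
      then obtain i where i: "i < k" "(w i, c (p i)) \<notin> parcs Q" "p permutes {0..<k}" by (auto simp: matching_perm_def)
      then have "?N $$ (i, p i) = 0" using permutes_in_image[OF i(3), of i] by (simp add: edge_weight_def)
      then have "(\<Prod>i = 0..<k. ?N $$ (i, p i)) = 0" using i(1) by (intro prod_zero bexI[of _ i]) auto
      then show "of_int (sign p) * (\<Prod>i = 0..<k. ?N $$ (i, p i)) = 0" by (simp only: mult_zero_right)
    qed
  qed (auto simp: matching_perm_def finite_permutations)
  also have "\<dots> = det ?N" by (rule det_def'[symmetric]) simp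
  finally show ?thesis using \<epsilon>(1) that by blast
qed

end

section \<open>Signs and monomials of pairs\<close>

context forest_quadrangulation
begin

abbreviation "eta p \<equiv> sign p * (\<Prod>j<m + k. I (p j) j)"

lemma eta_pm:
  assumes "incident p"
  shows "eta p \<in> {1, -1}"
proof -
  have "\<bar>I (p j) j\<bar> = 1" if "j < m + k" for j
    using incident_arc_of(1,5)[OF assms that] sign_pm[of "arc_of p j"] by auto
  then have "\<bar>eta p\<bar> = 1" by (simp add: abs_mult abs_prod)
  moreover have "x \<in> {1, -1}" if "\<bar>x\<bar> = 1" for x :: int using that by auto
  ultimately show ?thesis by blast
qed

lemma forest_monomial_pair_of:
  assumes p: "incident p"
  shows "forest_monomial rot (pair_of p) = (\<Prod>i\<in>forest_rows p. var (f i))"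
proof -
  have perm: "p permutes {0..<m + k}" using p by (simp add: incident_def)
  have "inj_on (arc_of p) {m..<m + k}"
    using arc_of_inj[OF p] by (intro inj_onI) (metis atLeastLessThan_iff)
  then have "forest_monomial rot (pair_of p) = (\<Prod>j\<in>{m..<m + k}. var (lf (arc_of p j)))"
    by (simp add: forest_monomial_def pair_of_def prod.reindex)
  also have "\<dots> = (\<Prod>j\<in>{m..<m + k}. var (f (p j)))"
    using incident_arc_of(2)[OF p] by (intro prod.cong) auto
  also have "\<dots> = (\<Prod>i\<in>forest_rows p. var (f i))"
    unfolding forest_rows_def using inj_on_subset[OF permutes_inj[OF perm] subset_UNIV] by (simp add: prod.reindex)
  finally show ?thesis .
qed

context
  fixes fl :: "nat \<Rightarrow> ('a \<times> 'a) set" and bl :: "nat \<Rightarrow> 'a"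
  assumes fl: "bij_betw fl {1..m + k} (faces Q rot)" "\<And>i. i < m + k \<Longrightarrow> f i = fl (Suc i)"
    and bl: "\<And>j. j < m + k \<Longrightarrow> vtx j = bl (Suc j)"
begin

lemma out_arc_pair_of:
  assumes p: "incident p" and j: "j < m + k"
  shows "out_arc m bl (pair_of p) (Suc j) = arc_of p j"
proof -
  obtain J where J: "layer J" "j \<in> J" "(if Suc j \<le> m then fst (pair_of p) else snd (pair_of p)) = arc_of p ` J"
    using that[OF layers(1)] that[OF layers(2)] j by (cases "j < m") (auto simp: pair_of_def)
  have inj: "inj_on fst (arc_of p ` J)" using choice_arcs(1)[OF p J(1)] by (simp add: choice_def)
  show ?thesis
    unfolding out_arc_def J(3) bl[OF j, symmetric]
  proof (rule the_equality)
    show "arc_of p j \<in> arc_of p ` J \<and> fst (arc_of p j) = vtx j" using J(2) incident_arc_of(3)[OF p j] by blast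
    fix d assume "d \<in> arc_of p ` J \<and> fst d = vtx j"
    then show "d = arc_of p j"
      using inj_onD[OF inj, of d "arc_of p j"] J(2) incident_arc_of(3)[OF p j] by simp
  qed
qed

text \<open>Labels start at 1 and matrix indices at 0, so the permutation of a pair is
  \<open>p\<close> conjugated by \<open>Suc\<close>, which preserves its sign.\<close>

lemma pair_perm_pair_of:
  assumes p: "incident p"
  shows "pair_perm rot m (m + k) fl bl (pair_of p) = map_permutation {0..<m + k} Suc p"
proof
  fix i
  show "pair_perm rot m (m + k) fl bl (pair_of p) i = map_permutation {0..<m + k} Suc p i"
  proof (cases "i \<in> {1..m + k}")
    case True
    then obtain j where j: "i = Suc j" "j < m + k" by (cases i) auto
    have pj: "p j < m + k" using p perm_less j by (simp add: incident_def)
    have "pair_perm rot m (m + k) fl bl (pair_of p) i = the_inv_into {1..m + k} fl (fl (Suc (p j)))"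
      using True incident_arc_of(2)[OF p j(2)] fl(2)[OF pj] by (simp add: pair_perm_def j(1) out_arc_pair_of[OF p j(2)])
    also have "\<dots> = Suc (p j)" using bij_betw_imp_inj_on[OF fl(1)] pj by (intro the_inv_into_f_f) auto
    also have "\<dots> = map_permutation {0..<m + k} Suc p i"
      using j by (simp add: map_permutation_def)
    finally show ?thesis .
  next
    case False
    then have "i \<notin> Suc ` {0..<m + k}" by auto
    then show ?thesis using False by (auto simp: pair_perm_def map_permutation_def)
  qed
qed

lemma pair_sign_pair_of:
  assumes p: "incident p"
  shows "pair_sign rot s m (m + k) fl bl (pair_of p) = eta p"
proof -
  have perm: "p permutes {0..<m + k}" using p by (simp add: incident_def)
  have "sign (pair_perm rot m (m + k) fl bl (pair_of p)) = sign p"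
    unfolding pair_perm_pair_of[OF p] by (rule sign_map_permutation) (use perm in auto)
  moreover have "(\<Prod>j = 1..m + k. s (out_arc m bl (pair_of p) j)) = (\<Prod>j<m + k. I (p j) j)"
  proof (rule prod.reindex_bij_witness[of _ Suc "\<lambda>i. i - 1"])
    fix i assume "i \<in> {1..m + k}"
    then obtain j where j: "i = Suc j" "j < m + k" by (cases i) auto
    then show "I (p (i - 1)) (i - 1) = s (out_arc m bl (pair_of p) i)"
      using out_arc_pair_of[OF p j(2)] incident_arc_of(5)[OF p j(2)] by simp
  qed auto
  ultimately show ?thesis by (simp add: pair_sign_def)
qed

lemma sum_pairs:
  "(\<Sum>p\<in>good. of_int (eta p) * (\<Prod>i\<in>forest_rows p. var (f i))) =
    (\<Sum>TF\<in>pairs. of_int (pair_sign rot s m (m + k) fl bl TF) * forest_monomial rot TF)"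
proof -
  have "(\<Sum>p\<in>good. of_int (eta p) * (\<Prod>i\<in>forest_rows p. var (f i))) =
    (\<Sum>p\<in>good. of_int (pair_sign rot s m (m + k) fl bl (pair_of p)) * forest_monomial rot (pair_of p))"
    by (intro sum.cong) (auto simp: good_def pair_sign_pair_of forest_monomial_pair_of)
  then show ?thesis using sum.reindex_bij_betw[OF bij_pair_of, of "\<lambda>TF. of_int (pair_sign rot s m (m + k) fl bl TF) * forest_monomial rot TF"]
    by simp
qed

end

section \<open>Exponent vectors and monomials\<close>

definition expo :: "nat set \<Rightarrow> ('a \<times> 'a) set \<Rightarrow>\<^sub>0 nat" where
  "expo S = (\<Sum>i\<in>S. Poly_Mapping.single (f i) 1)"

lemma prod_var: "finite S \<Longrightarrow> (\<Prod>i\<in>S. var (f i)) = Poly_Mapping.single (expo S) 1"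
  by (induction S rule: finite_induct) (simp_all add: expo_def var_def mult_single)

lemma lookup_expo:
  assumes "S \<subseteq> {..<m + k}" "i < m + k"
  shows "Poly_Mapping.lookup (expo S) (f i) = (if i \<in> S then 1 else 0)"
proof -
  have fin: "finite S" using assms finite_subset by blast
  have "Poly_Mapping.lookup (expo S) (f i) = (\<Sum>j\<in>S. if j = i then 1 else 0)"
    unfolding expo_def lookup_sum using assms f_eq_iff by (intro sum.cong) (auto simp: lookup_single when_def)
  then show ?thesis using fin by simp
qed

text \<open>A squarefree monomial reveals the forest rows, and these determine a good
  permutation.\<close>

lemma expo_forest_rows_inj: "inj_on (\<lambda>p. expo (forest_rows p)) good"
proof (rule inj_onI)
  fix p q assume pq: "p \<in> good" "q \<in> good" "expo (forest_rows p) = expo (forest_rows q)"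
  then have t: "incident p" "incident q" by (auto simp: good_def)
  have "i \<in> forest_rows p \<longleftrightarrow> i \<in> forest_rows q" if "i < m + k" for i
    using lookup_expo[OF forest_rows_subset[OF t(1)] that] lookup_expo[OF forest_rows_subset[OF t(2)] that] pq(3)
    by (metis zero_neq_one)
  then have "forest_rows p = forest_rows q" using forest_rows_subset[OF t(1)] forest_rows_subset[OF t(2)] by blast
  then show "p = q" using good_unique[OF pq(2) t(1)] by simp
qed

text \<open>No cancellation occurs: distinct good permutations have distinct monomials.\<close>

lemma monomials_signed_sum:
  assumes \<epsilon>: "\<epsilon> \<in> {1, -1 :: int}"
  shows "monomials (of_int \<epsilon> * (\<Sum>p\<in>good. of_int (eta p) * (\<Prod>i\<in>forest_rows p. var (f i)))) = (\<lambda>p. \<Prod>i\<in>forest_rows p. var (f i)) ` good"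
proof -
  let ?Z = "of_int \<epsilon> * (\<Sum>p\<in>good. of_int (eta p) * (\<Prod>i\<in>forest_rows p. var (f i)))"
  have fin: "finite (forest_rows p)" if "p \<in> good" for p
    using forest_rows_subset that finite_subset by (fastforce simp: good_def)
  have mono: "of_int x * Poly_Mapping.single e (1::int) = Poly_Mapping.single e x" for x and e :: "('a \<times> 'a) set \<Rightarrow>\<^sub>0 nat"
  proof -
    have "Poly_Mapping.single 0 (of_int x :: int) = (of_int x :: ('a \<times> 'a) set int_mpoly)"
      by (rule single_of_int)
    then have "(of_int x :: ('a \<times> 'a) set int_mpoly) = Poly_Mapping.single 0 x" by (simp only: of_int_eq_id id_apply)
    then show ?thesis using mult_single[of 0 x e 1] by (simp only: add_0_left mult_1_right)
  qed
  have Z: "?Z = (\<Sum>p\<in>good. Poly_Mapping.single (expo (forest_rows p)) (\<epsilon> * eta p))"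
    unfolding sum_distrib_left
  proof (rule sum.cong[OF refl])
    fix p assume "p \<in> good"
    then have "of_int \<epsilon> * (of_int (eta p) * (\<Prod>i\<in>forest_rows p. var (f i))) = of_int (\<epsilon> * eta p) * Poly_Mapping.single (expo (forest_rows p)) (1::int)"
      unfolding prod_var[OF fin[OF \<open>p \<in> good\<close>]] by (simp only: of_int_mult mult.assoc)
    then show "of_int \<epsilon> * (of_int (eta p) * (\<Prod>i\<in>forest_rows p. var (f i))) = Poly_Mapping.single (expo (forest_rows p)) (\<epsilon> * eta p)"
      unfolding mono .
  qed
  have lookup: "Poly_Mapping.lookup ?Z e = (\<Sum>p\<in>good. if expo (forest_rows p) = e then \<epsilon> * eta p else 0)" for e
    unfolding Z lookup_sum by (intro sum.cong) (auto simp: lookup_single when_def)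
  have "Poly_Mapping.keys ?Z = (\<lambda>p. expo (forest_rows p)) ` good"
  proof
    show "Poly_Mapping.keys ?Z \<subseteq> (\<lambda>p. expo (forest_rows p)) ` good"
    proof
      fix e assume "e \<in> Poly_Mapping.keys ?Z"
      then have "(\<Sum>p\<in>good. if expo (forest_rows p) = e then \<epsilon> * eta p else 0) \<noteq> 0"
        unfolding lookup[symmetric] by (simp only: in_keys_iff not_False_eq_True)
      then obtain p where "p \<in> good" "(if expo (forest_rows p) = e then \<epsilon> * eta p else 0) \<noteq> 0"
        by (rule sum.not_neutral_contains_not_neutral)
      then show "e \<in> (\<lambda>p. expo (forest_rows p)) ` good" by (auto split: if_splits)
    qed
    show "(\<lambda>p. expo (forest_rows p)) ` good \<subseteq> Poly_Mapping.keys ?Z"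
    proof
      fix e assume "e \<in> (\<lambda>p. expo (forest_rows p)) ` good"
      then obtain q where q: "q \<in> good" "e = expo (forest_rows q)" by blast
      have "Poly_Mapping.lookup ?Z e = (\<Sum>p\<in>good. if p = q then \<epsilon> * eta p else 0)"
        unfolding lookup using q inj_on_eq_iff[OF expo_forest_rows_inj] by (intro sum.cong) auto
      also have "\<dots> = \<epsilon> * eta q" using q by simp
      also have "\<dots> \<noteq> 0"
      proof -
        have "eta q \<noteq> 0" using eta_pm[of q] q(1) unfolding good_def by force
        moreover have "\<epsilon> \<noteq> 0" using \<epsilon> by auto
        ultimately show ?thesis by (rule no_zero_divisors[rotated])
      qed
      finally show "e \<in> Poly_Mapping.keys ?Z" by (simp only: in_keys_iff not_False_eq_True)
    qed
  qed
  then have "monomials ?Z = (\<lambda>p. Poly_Mapping.single (expo (forest_rows p)) 1) ` good"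
    unfolding monomials_def by (simp only: image_image)
  also have "\<dots> = (\<lambda>p. \<Prod>i\<in>forest_rows p. var (f i)) ` good"
    using fin prod_var by (intro image_cong) auto
  finally show ?thesis .
qed

lemma forest_monomial_inj: "inj_on (forest_monomial rot) pairs"
proof (rule inj_onI)
  fix P P' assume P: "P \<in> pairs" "P' \<in> pairs" and eq: "forest_monomial rot P = forest_monomial rot P'"
  obtain p q where pq: "p \<in> good" "q \<in> good" "P = pair_of p" "P' = pair_of q"
    using P bij_betw_imp_surj_on[OF bij_pair_of] by blast
  have t: "incident p" "incident q" using pq by (auto simp: good_def)
  have fin: "finite (forest_rows p)" "finite (forest_rows q)" using forest_rows_subset t finite_subset by blast+
  have "Poly_Mapping.single (expo (forest_rows p)) (1::int) = Poly_Mapping.single (expo (forest_rows q)) 1"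
    using eq unfolding pq(3,4) forest_monomial_pair_of[OF t(1)] forest_monomial_pair_of[OF t(2)] prod_var[OF fin(1)] prod_var[OF fin(2)] .
  then have "Poly_Mapping.keys (Poly_Mapping.single (expo (forest_rows p)) (1::int)) = Poly_Mapping.keys (Poly_Mapping.single (expo (forest_rows q)) (1::int))"
    by (rule arg_cong)
  then have "expo (forest_rows p) = expo (forest_rows q)" by simp
  then have "p = q" using inj_onD[OF expo_forest_rows_inj] pq(1,2) by blast
  then show "P = P'" using pq by simp
qed

end

theorem theorem4p2:
  fixes Q :: "'v pair_pre_digraph"
    and rot :: "'v \<times> 'v \<Rightarrow> 'v \<times> 'v"
    and W Bt B :: "'v set" and wr br :: 'v
    and \<phi> s :: "'v \<times> 'v \<Rightarrow> int"
    and l m :: nat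
    and fl :: "nat \<Rightarrow> ('v \<times> 'v) set" and bl :: "nat \<Rightarrow> 'v"
    and G :: "('v, 'v \<times> 'v) pre_digraph"
  assumes quad: "simple_quadrangulation Q rot"
    and colour: "proper_two_colouring Q (W \<union> {wr}) (Bt \<union> {br})"
    and roots: "wr \<notin> W" "br \<notin> Bt" "(wr, br) \<in> parcs Q"
    and B: "B \<subseteq> Bt" "card B = card W"
    and G: "G = with_proj Q \<restriction> (W \<union> B)"
    and kasteleyn: "kasteleyn_orientation Q rot wr W G \<phi>"
    and signs: "corner_signs Q rot (Bt \<union> {br}) s"
    and face_labels: "bij_betw fl {1..l} (faces Q rot)"
    and vertex_labels: "bij_betw bl {1..m} Bt" "bij_betw bl {m + 1..l} B"
  shows "(\<exists>\<epsilon>::int. \<epsilon> \<in> {1, -1} \<and>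
           partition_function rot W G \<phi> =
             of_int \<epsilon> * (\<Sum>TF\<in>tree_forest_pairs Q rot Bt br B.
               of_int (pair_sign rot s m l fl bl TF) * forest_monomial rot TF)) \<and>
         bij_betw (forest_monomial rot) (tree_forest_pairs Q rot Bt br B)
           (monomials (partition_function rot W G \<phi>))"
proof -
  interpret S: signed_quadrangulation Q rot "W \<union> {wr}" "Bt \<union> {br}" s
  proof unfold_locales
    show "simple_quadrangulation Q rot" "proper_two_colouring Q (W \<union> {wr}) (Bt \<union> {br})"
      "corner_signs Q rot (Bt \<union> {br}) s" by (rule quad, rule colour, rule signs)
    show "W \<union> {wr} \<noteq> {}" "Bt \<union> {br} \<noteq> {}" by blast+
  qed
  define k where "k = card W"
  have fin: "finite W" "finite Bt" using S.colours(3,4) by auto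
  have cm: "card Bt = m" using bij_betw_same_card[OF vertex_labels(1)] by simp
  have ck: "l - m = k" using bij_betw_same_card[OF vertex_labels(2)] B(2) by (simp add: k_def)
  have "card (faces Q rot) = l" using bij_betw_same_card[OF face_labels] by simp
  \<comment> \<open>The two roots account for the summand 2 in Euler's count, leaving the vertices
    in \<open>Bt\<close> and \<open>W\<close>.\<close>
  then have l: "l = m + k"
    using S.card_faces fin roots cm by (simp add: k_def Un_insert_right)
  obtain w where w: "bij_betw w {..<k} W"
    using ex_bij_betw_nat_finite[OF fin(1)] unfolding k_def atLeast0LessThan by blast
  have suc: "bij_betw Suc {..<n} {1..n}" for n
    by (rule bij_betw_byWitness[of _ "\<lambda>i. i - 1"]) auto
  have shift: "bij_betw (\<lambda>j. m + 1 + j) {..<k} {m + 1..l}"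
    by (rule bij_betw_byWitness[of _ "\<lambda>i. i - (m + 1)"]) (auto simp: l)
  define f where "f i = fl (Suc i)" for i
  define b where "b j = bl (Suc j)" for j
  define c where "c j = bl (m + 1 + j)" for j
  have bijs: "bij_betw f {..<m + k} (faces Q rot)" "bij_betw b {..<m} Bt" "bij_betw c {..<k} B"
    using bij_betw_trans[OF suc face_labels] bij_betw_trans[OF suc vertex_labels(1)] bij_betw_trans[OF shift vertex_labels(2)]
    by (simp_all add: f_def[abs_def] b_def[abs_def] c_def[abs_def] comp_def l)
  interpret forest_quadrangulation Q rot W wr Bt br s m k f b w B c
  proof unfold_locales
    show "wr \<notin> W" "br \<notin> Bt" by (fact roots)+
    show "bij_betw f {..<m + k} (faces Q rot)" "bij_betw b {..<m} Bt" "bij_betw w {..<k} W"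
      "B \<subseteq> Bt" "bij_betw c {..<k} B" by (fact bijs w B)+
  qed
  obtain \<delta> :: int where \<delta>: "\<delta> \<in> {1, -1}"
    "partition_function rot W G \<phi> = of_int \<delta> * det (mat k k (\<lambda>(i, j). edge_weight var (w i) (c j)))"
    using partition_function_det kasteleyn unfolding G by metis
  have cB: "c j \<in> Bt" if "j < k" for j using c_mem[OF that] B(1) by blast
  obtain \<epsilon> :: int where \<epsilon>: "\<epsilon> \<in> {1, -1}"
    "det (mat k k (\<lambda>(i, j). edge_weight var (w i) (c j))) = of_int \<epsilon> * det (doubled_incidence var c)"
    by (rule det_edge_weight_eq[where a = var and c = c, OF cB])
  have Z: "partition_function rot W G \<phi> = of_int (\<delta> * \<epsilon>) * (\<Sum>p\<in>good. of_int (eta p) * (\<Prod>i\<in>forest_rows p. var (f i)))"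
    unfolding \<delta>(2) \<epsilon>(2) det_doubled_incidence by (simp add: mult.assoc)
  have pm: "\<delta> * \<epsilon> \<in> {1, -1}" using \<delta>(1) \<epsilon>(1) by auto
  have vtx: "vtx j = bl (Suc j)" if "j < m + k" for j
    using that by (auto simp: vtx_def b_def c_def)
  have sum: "(\<Sum>p\<in>good. of_int (eta p) * (\<Prod>i\<in>forest_rows p. var (f i))) =
      (\<Sum>TF\<in>pairs. of_int (pair_sign rot s m l fl bl TF) * forest_monomial rot TF)"
    unfolding l by (rule sum_pairs) (use face_labels vtx in \<open>auto simp: l f_def\<close>)
  have "forest_monomial rot ` pairs = (\<lambda>p. \<Prod>i\<in>forest_rows p. var (f i)) ` good"
    unfolding bij_betw_imp_surj_on[OF bij_pair_of, symmetric] image_image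
    by (intro image_cong) (auto simp: forest_monomial_pair_of good_def)
  also have "\<dots> = monomials (partition_function rot W G \<phi>)"
    unfolding Z monomials_signed_sum[OF pm] ..
  finally have "bij_betw (forest_monomial rot) pairs (monomials (partition_function rot W G \<phi>))"
    using forest_monomial_inj by (simp add: bij_betw_def)
  then show ?thesis using pm Z unfolding sum by blast
qed

end
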